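(* Let $d\ge 2$, let $\mathbb{B}$ be the regular rooted $d$-ary tree and let $0<\alpha<1$. Let $(A_n)_{n\ge1}$ be the growth model on $\mathbb{B}$ with parameter $\alpha$ (defined in the context) and $h(A_n)=\max\{|x|:x\in A_n\}$. There exist constants $\mu_0(\alpha,d)\in(0,1)$ and $\sigma^2=\sigma^2(\alpha,d)>0$ such that (a) $\lim_{n\to\infty} n^{-1}h(A_n)=\mu_0(\alpha,d)$ almost surely; (b) $n^{-1/2}\bigl(h(A_n)-n\mu_0(\alpha,d)\bigr)$ converges weakly to the normal law $N(0,\sigma^2)$ as $n\to\infty$.
   Context: For a vertex $x$ of the rooted tree $\mathbb{B}$ with root $0$, $|x|$ is its distance to the root and $\mathrm{par}(x)$ its parent; every vertex has exactly $d$ children. For a finite subtree $A$ containing the root (a set of vertices closed under taking parents), its external boundary is $\partial A=\{x\notin A:\mathrm{par}(x)\in A\}$. The growth model (diffusion-limited aggregation, DLA, on $\mathbb{B}$ with parameter $\alpha$) is the Markov chain $(A_n)_{n\ge 1}$ of finite subtrees with $A_1=\{0\}$ and $A_{n+1}=A_n\cup\{D_{n+1}\}$, where $$P(D_{n+1}=x\mid A_n)=\alpha^{-|x|}\Bigl(\sum_{y\in\partial A_n}\alpha^{-|y|}\Bigr)^{-1},\qquad x\in\partial A_n .$$ *)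

theory Defs
  imports "HOL-Probability.Probability"
begin

text \<open>A vertex of the \<open>d\<close>-ary tree is the word of child indices read off along the path from the
  root: the root is the empty word, and the children of \<open>x\<close> are \<open>x @ [i]\<close> with \<open>i < d\<close>.  Thus
  \<open>|x|\<close> is \<^const>\<open>length\<close> and the parent of a non-root vertex is \<^const>\<open>butlast\<close>.\<close>

definition vertices :: "nat \<Rightarrow> nat list set" where
  "vertices d = lists {..<d}"

text \<open>As \<open>butlast [] = []\<close>, closure under parents needs no exception for the root, and the root
  is never in the boundary of a subtree.\<close>

definition finite_subtrees :: "nat \<Rightarrow> nat list set set" where
  "finite_subtrees d = {B. B \<subseteq> vertices d \<and> finite B \<and> [] \<in> B \<and> (\<forall>x\<in>B. butlast x \<in> B)}"

definition ext_boundary :: "nat \<Rightarrow> nat list set \<Rightarrow> nat list set" where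
  "ext_boundary d B = {x \<in> vertices d. x \<notin> B \<and> butlast x \<in> B}"

definition tree_height :: "nat list set \<Rightarrow> nat" where
  "tree_height B = Max (length ` B)"

definition growth_prob :: "nat \<Rightarrow> real \<Rightarrow> nat list set \<Rightarrow> nat list \<Rightarrow> real" where
  "growth_prob d \<alpha> B x =
     \<alpha> powi (- int (length x)) / (\<Sum>y\<in>ext_boundary d B. \<alpha> powi (- int (length y)))"

text \<open>Time starts at \<open>1\<close>; \<open>A 0\<close> is unconstrained.  The set of finite subtrees is countable, so the
  chain is specified by conditioning on histories of positive probability.  The
  new vertex \<open>D (n + 1)\<close> is the unique element of \<open>A (n + 1) - A n\<close>, so \<open>D (n + 1) = x\<close> is
  expressed as \<open>A (n + 1) = insert x (A n)\<close>.\<close>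

locale growth_model = prob_space M
  for d :: nat and \<alpha> :: real and M :: "'w measure" and A :: "nat \<Rightarrow> 'w \<Rightarrow> nat list set" +
  assumes measurable_tree: "\<And>n. n \<ge> 1 \<Longrightarrow> A n \<in> M \<rightarrow>\<^sub>M count_space (finite_subtrees d)"
    and initial_tree: "AE \<omega> in M. A 1 \<omega> = {[]}"
    and growth_step: "\<And>n B x. n \<ge> 1 \<Longrightarrow> \<P>(\<omega> in M. \<forall>i\<in>{1..n}. A i \<omega> = B i) > 0 \<Longrightarrow>
      x \<in> ext_boundary d (B n) \<Longrightarrow>
      \<P>(\<omega> in M. A (Suc n) \<omega> = insert x (B n) \<bar> \<forall>i\<in>{1..n}. A i \<omega> = B i) = growth_prob d \<alpha> (B n) x"

definition height_LLN :: "'w measure \<Rightarrow> (nat \<Rightarrow> 'w \<Rightarrow> nat list set) \<Rightarrow> real \<Rightarrow> bool" where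
  "height_LLN M A \<mu> \<longleftrightarrow> (AE \<omega> in M. (\<lambda>n. real (tree_height (A n \<omega>)) / real n) \<longlonglongrightarrow> \<mu>)"

text \<open>The second parameter of \<^const>\<open>normal_density\<close> is the standard deviation.\<close>

definition height_CLT ::
    "'w measure \<Rightarrow> (nat \<Rightarrow> 'w \<Rightarrow> nat list set) \<Rightarrow> real \<Rightarrow> real \<Rightarrow> bool" where
  "height_CLT M A \<mu> v \<longleftrightarrow>
     weak_conv_m
       (\<lambda>n. distr M borel (\<lambda>\<omega>. (real (tree_height (A n \<omega>)) - real n * \<mu>) / sqrt (real n)))
       (density lborel (normal_density 0 (sqrt v)))"

lemma finite_ext_boundary:
  assumes "B \<in> finite_subtrees d"
  shows "finite (ext_boundary d B)"
proof (rule finite_subset)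
  show "ext_boundary d B \<subseteq> (\<lambda>(x, i). x @ [i]) ` (B \<times> {..<d})"
  proof
    fix x assume x: "x \<in> ext_boundary d B"
    then have "x \<noteq> []" using assms by (auto simp: ext_boundary_def finite_subtrees_def)
    then show "x \<in> (\<lambda>(x, i). x @ [i]) ` (B \<times> {..<d})"
      using x by (intro image_eqI[of _ _ "(butlast x, last x)"])
        (auto simp: ext_boundary_def vertices_def)
  qed
  show "finite ((\<lambda>(x, i). x @ [i]) ` (B \<times> {..<d}))"
    using assms by (auto simp: finite_subtrees_def)
qed

lemma ext_boundary_nonempty:
  assumes "B \<in> finite_subtrees d" "d \<ge> 1"
  shows "ext_boundary d B \<noteq> {}"
proof -
  have fin: "finite B" and ne: "B \<noteq> {}" using assms by (auto simp: finite_subtrees_def)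
  have "Max (length ` B) \<in> length ` B" using fin ne by (intro Max_in) auto
  then obtain x where x: "x \<in> B" "length x = Max (length ` B)" by auto
  have "x @ [0] \<notin> B" 
  proof
    assume "x @ [0] \<in> B"
    then have "length (x @ [0]) \<le> Max (length ` B)" using fin by (intro Max_ge finite_imageI imageI)
    then show False using x(2) by simp
  qed
  then have "x @ [0] \<in> ext_boundary d B"
    using x assms by (auto simp: ext_boundary_def finite_subtrees_def vertices_def)
  then show ?thesis by auto
qed

lemma insert_subtrees:
  assumes "B \<in> finite_subtrees d" "x \<in> ext_boundary d B"
  shows "insert x B \<in> finite_subtrees d"
  using assms by (auto simp: finite_subtrees_def ext_boundary_def)

lemma countable_subtrees: "countable (finite_subtrees d)"
  by (rule countable_subset[OF _ countable_Collect_finite]) (auto simp: finite_subtrees_def)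

lemma ex_growth_pmf:
  assumes "B \<in> finite_subtrees d" "d \<ge> 1" "\<alpha> > 0"
  shows "\<exists>p :: nat list pmf. \<forall>x\<in>ext_boundary d B. pmf p x = growth_prob d \<alpha> B x"
proof -
  let ?b = "ext_boundary d B"
  let ?f = "\<lambda>x. if x \<in> ?b then growth_prob d \<alpha> B x else 0"
  have fin: "finite ?b" by (rule finite_ext_boundary[OF assms(1)])
  have pos: "(\<Sum>y\<in>?b. \<alpha> powi (- int (length y))) > 0"
    using fin ext_boundary_nonempty[OF assms(1,2)] assms(3) by (intro sum_pos) auto
  have nn: "?f x \<ge> 0" for x
    using pos assms(3) by (auto simp: growth_prob_def)
  have "(\<integral>\<^sup>+x. ennreal (?f x) \<partial>count_space UNIV) = (\<Sum>x\<in>?b. ennreal (?f x))"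
    by (rule nn_integral_count_space'[OF fin]) auto
  also have "\<dots> = ennreal (\<Sum>x\<in>?b. ?f x)"
    using nn by (intro sum_ennreal) blast
  also have "(\<Sum>x\<in>?b. ?f x) = 1"
    using pos by (simp add: growth_prob_def sum_divide_distrib[symmetric])
  finally have "(\<integral>\<^sup>+x. ennreal (?f x) \<partial>count_space UNIV) = 1" by simp
  then have "pmf (embed_pmf ?f) x = ?f x" for x
    using nn by (intro pmf_embed_pmf) auto
  then show ?thesis by (intro exI[of _ "embed_pmf ?f"]) auto
qed

text \<open>Growth driven by independent candidate vertices \<open>\<omega> (n, B)\<close>, one for each time \<open>n\<close> and tree \<open>B\<close>.\<close>

primrec grow :: "nat \<Rightarrow> (nat \<times> nat list set \<Rightarrow> nat list) \<Rightarrow> nat \<Rightarrow> nat list set" where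
  "grow d \<omega> 0 = {[]}"
| "grow d \<omega> (Suc n) = grow d \<omega> n \<union> ({\<omega> (n, grow d \<omega> n)} \<inter> ext_boundary d (grow d \<omega> n))"

lemma grow_subtrees: "grow d \<omega> n \<in> finite_subtrees d"
proof (induction n)
  case 0 then show ?case by (auto simp: finite_subtrees_def vertices_def)
next
  case (Suc n)
  then show ?case
    using insert_subtrees[OF Suc] by (cases "\<omega> (n, grow d \<omega> n) \<in> ext_boundary d (grow d \<omega> n)") auto
qed

lemma grow_history:
  "(\<forall>i\<le>n. grow d \<omega> i = B i) \<longleftrightarrow>
   B 0 = {[]} \<and> (\<forall>i<n. B i \<union> ({\<omega> (i, B i)} \<inter> ext_boundary d (B i)) = B (Suc i))"
proof (induction n)
  case (Suc n)
  have "(\<forall>i\<le>Suc n. grow d \<omega> i = B i) \<longleftrightarrow> (\<forall>i\<le>n. grow d \<omega> i = B i) \<and> grow d \<omega> (Suc n) = B (Suc n)"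
    by (auto simp: le_Suc_eq)
  also have "\<dots> \<longleftrightarrow> (\<forall>i\<le>n. grow d \<omega> i = B i) \<and>
      B n \<union> ({\<omega> (n, B n)} \<inter> ext_boundary d (B n)) = B (Suc n)"
    by auto
  finally show ?case unfolding Suc by (auto simp: less_Suc_eq)
qed auto

text \<open>The growth model exists on the path space \<open>nat \<Rightarrow> nat list set\<close>.  Hence constants that serve all
  growth models on this type are determined by \<open>d\<close> and \<open>\<alpha>\<close>; requiring the same constants for
  an arbitrary sample space type expresses that they do not depend on the realization.\<close>

theorem growth_model_exists:
  assumes d: "d \<ge> 1" and \<alpha>: "\<alpha> > 0"
  shows "\<exists>(M :: (nat \<Rightarrow> nat list set) measure) A. growth_model d \<alpha> M A"
proof -
  obtain p :: "nat list set \<Rightarrow> nat list pmf" where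
    p: "\<And>B x. B \<in> finite_subtrees d \<Longrightarrow> x \<in> ext_boundary d B \<Longrightarrow> pmf (p B) x = growth_prob d \<alpha> B x"
  proof -
    have "\<forall>B\<in>finite_subtrees d. \<exists>p :: nat list pmf. \<forall>x\<in>ext_boundary d B. pmf p x = growth_prob d \<alpha> B x"
      using ex_growth_pmf[OF _ d \<alpha>] by blast
    from bchoice[OF this] show ?thesis using that by blast
  qed
  define K where "K = (\<lambda>nB :: nat \<times> nat list set. measure_pmf (p (snd nB)))"
  have K: "prob_space (K i)" for i by (simp add: K_def measure_pmf.prob_space_axioms)
  interpret KP: product_prob_space K UNIV by (rule product_prob_spaceI) (rule K)
  define \<Omega> where "\<Omega> = PiM UNIV K"
  interpret \<Omega>: prob_space \<Omega> unfolding \<Omega>_def by (rule prob_space_PiM) (rule K)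
  have sp: "space \<Omega> = UNIV" by (auto simp: \<Omega>_def K_def space_PiM)
  define S where "S B i = {v. B i \<union> ({v} \<inter> ext_boundary d (B i)) = B (Suc i)}" for B i
  define F where "F n B = {\<omega>. \<forall>i\<le>n. grow d \<omega> i = B i}" for n B
  have F_emb: "F n B = prod_emb UNIV K ((\<lambda>i. (i, B i)) ` {..<n}) (PiE ((\<lambda>i. (i, B i)) ` {..<n}) (\<lambda>(i, _). S B i))"
    if "B 0 = {[]}" for n B
  proof -
    have "F n B = {\<omega>. \<forall>i<n. \<omega> (i, B i) \<in> S B i}"
      unfolding F_def grow_history using that by (simp add: S_def)
    then show ?thesis by (auto simp: prod_emb_iff K_def PiE_iff)
  qed
  have F_empty: "F n B = {}" if "B 0 \<noteq> {[]}" for n B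
    unfolding F_def grow_history using that by simp
  have F_sets: "F n B \<in> sets \<Omega>" for n B
  proof (cases "B 0 = {[]}")
    case True
    show ?thesis unfolding F_emb[of B, OF True] \<Omega>_def
      by (intro sets_PiM_I) (auto simp: K_def)
  qed (simp add: F_empty)
  have F_prob: "measure \<Omega> (F n B) = (\<Prod>i<n. measure (p (B i)) (S B i))" if "B 0 = {[]}" for n B
    unfolding F_emb[of B, OF that] \<Omega>_def
    by (subst KP.measure_PiM_emb) (auto simp: K_def prod.reindex inj_on_def)

  have grow_meas: "(\<lambda>\<omega>. grow d \<omega> n) \<in> \<Omega> \<rightarrow>\<^sub>M count_space (finite_subtrees d)" for n
  proof (subst measurable_count_space_eq_countable[OF countable_subtrees], intro conjI ballI)
    show "(\<lambda>\<omega>. grow d \<omega> n) \<in> space \<Omega> \<rightarrow> finite_subtrees d" by (auto intro: grow_subtrees)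
    fix C
    let ?H = "{B \<in> {..n} \<rightarrow>\<^sub>E finite_subtrees d. B n = C}"
    have "(\<lambda>\<omega>. grow d \<omega> n) -` {C} \<inter> space \<Omega> = (\<Union>B\<in>?H. F n B)"
      by (auto simp: sp F_def grow_subtrees intro!: exI[of _ "restrict (grow d _) {..n}"])
    moreover have "countable ?H"
      by (rule countable_subset[of _ "{..n} \<rightarrow>\<^sub>E finite_subtrees d"]) (auto intro!: countable_PiE countable_subtrees)
    ultimately show "(\<lambda>\<omega>. grow d \<omega> n) -` {C} \<inter> space \<Omega> \<in> sets \<Omega>"
      using F_sets by (auto intro!: sets.countable_UN')
  qed

  define N :: "(nat \<Rightarrow> nat list set) measure" where "N = PiM UNIV (\<lambda>_. count_space (finite_subtrees d))"
  define X where "X = (\<lambda>\<omega> n. grow d \<omega> (n - 1))"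
  have X: "X \<in> \<Omega> \<rightarrow>\<^sub>M N"
    unfolding N_def X_def by (rule measurable_PiM_single') (auto intro: grow_meas grow_subtrees)
  define M where "M = distr \<Omega> N X"
  have spM: "space M = space N" and setsM: "sets M = sets N" by (auto simp: M_def)
  have comp: "(\<lambda>\<omega>. \<omega> n) \<in> M \<rightarrow>\<^sub>M count_space (finite_subtrees d)" for n
    unfolding measurable_cong_sets[OF setsM refl] N_def by measurable
  interpret PM: prob_space M unfolding M_def by (rule \<Omega>.prob_space_distr[OF X])
  have ev: "{\<omega> \<in> space M. \<omega> i = C} \<in> sets M" for i C
  proof (cases "C \<in> finite_subtrees d")
    case True
    then show ?thesis using measurable_sets[OF comp[of i], of "{C}"]
      by (auto simp: vimage_def Int_def conj_commute)
  next
    case False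
    have "{\<omega> \<in> space M. \<omega> i = C} = {}"
      using False by (auto simp: spM N_def space_PiM)
    then show ?thesis by (metis sets.empty_sets)
  qed
  have prob_hist: "measure M {\<omega> \<in> space M. \<forall>i\<in>{1..Suc n}. \<omega> i = B i} = measure \<Omega> (F n (\<lambda>i. B (Suc i)))" for n B
  proof -
    have "{\<omega> \<in> space M. \<forall>i\<in>{1..Suc n}. \<omega> i = B i} \<in> sets M"
      by (intro sets.sets_Collect_finite_All' ev) auto
    then have "measure M {\<omega> \<in> space M. \<forall>i\<in>{1..Suc n}. \<omega> i = B i} =
       measure \<Omega> (X -` {\<omega> \<in> space M. \<forall>i\<in>{1..Suc n}. \<omega> i = B i} \<inter> space \<Omega>)"
      using X by (simp add: M_def measure_distr)
    also have "X -` {\<omega> \<in> space M. \<forall>i\<in>{1..Suc n}. \<omega> i = B i} \<inter> space \<Omega> = F n (\<lambda>i. B (Suc i))"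
    proof -
      have "X \<omega> \<in> space M" for \<omega> using measurable_space[OF X] by (auto simp: sp spM)
      moreover have "(\<forall>i\<in>{1..Suc n}. P i) \<longleftrightarrow> (\<forall>i\<le>n. P (Suc i))" for P
        by (metis One_nat_def Suc_le_D Suc_le_mono atLeastAtMost_iff le_add1 plus_1_eq_Suc)
      ultimately show ?thesis by (auto simp: sp F_def X_def)
    qed
    finally show ?thesis .
  qed
  have "growth_model d \<alpha> M (\<lambda>n \<omega>. \<omega> n)"
  proof
    show "(\<lambda>\<omega>. \<omega> n) \<in> M \<rightarrow>\<^sub>M count_space (finite_subtrees d)" for n by (rule comp)
    show "AE \<omega> in M. \<omega> 1 = {[]}"
      using X ev[of 1 "{[]}"] unfolding M_def
      by (subst AE_distr_iff) (auto simp: X_def)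
    fix n :: nat and B :: "nat \<Rightarrow> nat list set" and x
    assume n: "n \<ge> 1" and pos: "\<P>(\<omega> in M. \<forall>i\<in>{1..n}. \<omega> i = B i) > 0"
      and x: "x \<in> ext_boundary d (B n)"
    obtain m where m: "n = Suc m" using n by (cases n) auto
    let ?B = "\<lambda>i. B (Suc i)" and ?B' = "\<lambda>i. (B(Suc n := insert x (B n))) (Suc i)"
    have pos': "measure \<Omega> (F m ?B) > 0" using pos prob_hist[of m B] m by simp
    then have "F m ?B \<noteq> {}" by auto
    then obtain \<omega> where \<omega>: "\<And>i. i \<le> m \<Longrightarrow> grow d \<omega> i = B (Suc i)" by (auto simp: F_def)
    have B0: "B (Suc 0) = {[]}" using \<omega>[of 0] by simp
    have Bn: "B n \<in> finite_subtrees d" using grow_subtrees[of d \<omega> m] \<omega>[of m] m by simp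
    have "x \<notin> B n" using x by (auto simp: ext_boundary_def)
    have "b \<union> ({v} \<inter> c) = insert x b \<longleftrightarrow> v = x" if "x \<notin> b" "x \<in> c" for v and b c :: "nat list set"
      using that by auto
    from this[OF \<open>x \<notin> B n\<close> x]
    have S: "S ?B' m = {x}" unfolding S_def by (simp add: m)
    have S': "S ?B' i = S ?B i" if "i < m" for i
      using that m unfolding S_def by simp
    have "measure \<Omega> (F (Suc m) ?B') = (\<Prod>i<Suc m. measure (p (?B' i)) (S ?B' i))"
      using B0 m by (intro F_prob) simp
    also have "\<dots> = (\<Prod>i<m. measure (p (?B i)) (S ?B i)) * pmf (p (B n)) x"
      using S S' m by (simp add: measure_pmf_single)
    also have "(\<Prod>i<m. measure (p (?B i)) (S ?B i)) = measure \<Omega> (F m ?B)"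
      using B0 by (intro F_prob[symmetric]) simp
    finally have "measure \<Omega> (F (Suc m) ?B') = measure \<Omega> (F m ?B) * pmf (p (B n)) x" .
    moreover have "\<P>(\<omega> in M. \<omega> (Suc n) = insert x (B n) \<and> (\<forall>i\<in>{1..n}. \<omega> i = B i)) = measure \<Omega> (F (Suc m) ?B')"
    proof -
      have "(\<omega> (Suc n) = insert x (B n) \<and> (\<forall>i\<in>{1..n}. \<omega> i = B i)) \<longleftrightarrow>
         (\<forall>i\<in>{1..Suc n}. \<omega> i = (B(Suc n := insert x (B n))) i)" for \<omega> :: "nat \<Rightarrow> nat list set"
      proof -
        have "{1..Suc n} = insert (Suc n) {1..n}" by auto
        then show ?thesis by simp
      qed
      then show ?thesis
        using prob_hist[of "Suc m" "B(Suc n := insert x (B n))"] by (simp only: m)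
    qed
    moreover have "\<P>(\<omega> in M. \<forall>i\<in>{1..n}. \<omega> i = B i) = measure \<Omega> (F m ?B)"
      using prob_hist[of m B] m by simp
    ultimately show "\<P>(\<omega> in M. \<omega> (Suc n) = insert x (B n) \<bar> \<forall>i\<in>{1..n}. \<omega> i = B i) = growth_prob d \<alpha> (B n) x"
      using pos' p[OF Bn x] by (simp add: cond_prob_def)
  qed
  then show ?thesis by blast
qed

end

theory Submission
  imports Defs
begin

text \<open>Seen from its top, the tree is a Markov chain on multisets of depths of boundary vertices, in which
  old boundary vertices lose relevance geometrically as the height grows.  A Lyapunov function and a
  coupling show that the transition from one height to the next contracts a weighted distance of
  profiles.  Hence Poisson equations for the chain are solvable: there is a corrector \<open>v\<close>
  such that \<open>h + v - n \<mu>\<close> is a martingale, and a second one for its conditional variance.  The law of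
  large numbers follows from a second moment bound along squares and monotonicity; for the central
  limit theorem the second corrector turns the mean of \<open>exp (i \<theta> (h + v - n \<mu>))\<close> into an almost
  geometric sequence.\<close>

section \<open>Boundary profiles\<close>

text \<open>Every step replaces one boundary vertex by d of them, so the boundary grows by d - 1, no
  profile is visited twice and there are no regeneration times. What helps is that a differing
  vertex of depth i matters only at rate \<alpha> ^ i and sinks with each rise. Forgetting is
  therefore measured by a distance that charges the weight of the differing vertices. Such a
  distance needs control of the total weight, which is unbounded: a ring multiplies the rate of a
  vertex by d / \<alpha>, and a crowd just below the top can make the weight grow for a while before
  a rise scales it down. Contraction is sought per level, between successive heights, because only a
  rise shrinks old weights. If a level takes x steps on average, then \<mu> = 1 / x. The correctors
  are unbounded as well, v being of the order of the weight and the second one of its cube; moments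
  of the weight of any order grow slowly enough in time to make both negligible at scale sqrt
  n.\<close>

text \<open>A boundary vertex \<open>y\<close> of a tree of height \<open>h\<close> is recorded by its depth \<open>h + 1 - |y|\<close>; relative
  to the top it is chosen with weight \<open>\<alpha> ^ depth\<close>.  Choosing a vertex of depth \<open>i > 0\<close> puts \<open>d\<close> vertices
  of depth \<open>i - 1\<close> in its place (\<open>ring i\<close>); choosing one of depth \<open>0\<close> increases the height, so that
  all other depths grow by one (\<open>rise\<close>).\<close>

locale boundary_profile =
  fixes d :: nat and \<alpha> :: real
  assumes d2: "2 \<le> d" and al0: "0 < \<alpha>" and al1: "\<alpha> < 1"
begin

text \<open>Up to the factor \<open>\<alpha> powi (- int (h + 1))\<close>, with h the height, this
  is the normalizing sum in \<open>growth_prob\<close>; it is the total rate when a vertex of depth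
  i rings at rate \<alpha> ^ i.\<close>

definition weight :: "nat multiset \<Rightarrow> real" where
  "weight b = (\<Sum>i\<in>#b. \<alpha> ^ i)"

definition lower :: "nat multiset \<Rightarrow> nat multiset" where
  "lower b = filter_mset ((<) 0) b"

definition ring :: "nat \<Rightarrow> nat multiset \<Rightarrow> nat multiset" where
  "ring i b = b - {#i#} + replicate_mset d (i - 1)"

definition rise :: "nat multiset \<Rightarrow> nat multiset" where
  "rise b = image_mset Suc (b - {#0#}) + replicate_mset d 0"

text \<open>Not divided by \<open>weight b\<close>: multiplied through by the total rate, first-step
  equations become linear identities between \<open>weight\<close>, \<open>low_sum\<close> and
  \<open>tops\<close>.\<close>

definition low_sum :: "(nat multiset \<Rightarrow> real) \<Rightarrow> nat multiset \<Rightarrow> real" where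
  "low_sum f b = (\<Sum>i\<in>#lower b. \<alpha> ^ i * f (ring i b))"

text \<open>A vertex of maximal height has all its d children on the boundary, at depth 0. Rings at
  positive depth keep them and a rise creates d new ones, so this is an invariant of the chain; it
  bounds \<open>tops\<close> and \<open>weight\<close> below by 1.\<close>

definition state :: "nat multiset \<Rightarrow> bool" where
  "state b \<longleftrightarrow> d \<le> count b 0"

definition tops :: "nat multiset \<Rightarrow> real" where
  "tops b = real (count b 0)"

lemma d_pos: "0 < d" using d2 by simp

lemma weight_add [simp]: "weight (a + b) = weight a + weight b"
  by (simp add: weight_def)

lemma weight_empty [simp]: "weight {#} = 0" by (simp add: weight_def)

lemma weight_nonneg: "0 \<le> weight b"
  using al0 by (induction b) (auto simp: weight_def)

lemma lower_add [simp]: "lower (a + b) = lower a + lower b"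
  by (simp add: lower_def)

lemma lower_idem: "0 \<notin># r \<Longrightarrow> lower r = r"
  unfolding lower_def by (rule filter_mset_eq_conv[THEN iffD2]) (auto intro: gr0I)

lemma weight_split: "weight b = tops b + weight (lower b)"
  unfolding weight_def tops_def lower_def
  by (induction b) auto

lemma weight_replicate [simp]: "weight (replicate_mset n i) = real n * \<alpha> ^ i"
  by (induction n) (auto simp: weight_def algebra_simps)

lemma weight_remove: "i \<in># b \<Longrightarrow> weight (b - {#i#}) = weight b - \<alpha> ^ i"
  by (auto simp: weight_def dest!: multi_member_split)

lemma weight_image_Suc: "weight (image_mset Suc b) = \<alpha> * weight b"
  by (induction b) (auto simp: weight_def algebra_simps)

lemma weight_ring:
  "i \<in># b \<Longrightarrow> 0 < i \<Longrightarrow> weight (ring i b) = weight b + (real d / \<alpha> - 1) * \<alpha> ^ i"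
  using al0 by (cases i) (auto simp: ring_def weight_remove field_simps)

lemma weight_rise: "0 \<in># b \<Longrightarrow> weight (rise b) = \<alpha> * (weight b - 1) + real d"
  by (simp add: rise_def weight_image_Suc weight_remove)

lemma state_0: "state b \<Longrightarrow> 0 \<in># b"
  using d2 by (simp add: state_def flip: count_greater_zero_iff)

lemma state_ring: "state b \<Longrightarrow> 0 < i \<Longrightarrow> state (ring i b)"
  by (simp add: state_def ring_def)

lemma count_image_Suc_0 [simp]: "count (image_mset Suc b) 0 = 0"
  by (induction b) auto

lemma count_image_Suc [simp]: "count (image_mset Suc b) (Suc n) = count b n"
  by (induction b) auto

lemma state_rise: "state (rise b)"
  by (simp add: state_def rise_def)

lemma state_replicate: "state (replicate_mset d 0)"
  by (simp add: state_def)

lemma state_add: "state m \<Longrightarrow> state (m + r)"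
  by (simp add: state_def)

lemma tops_ge_d: "state b \<Longrightarrow> real d \<le> tops b"
  by (simp add: state_def tops_def)

lemma tops_ge_1: "state b \<Longrightarrow> 1 \<le> tops b"
  using tops_ge_d[of b] d2 by simp

lemma tops_add: "0 \<notin># r \<Longrightarrow> tops (m + r) = tops m"
  by (simp add: tops_def not_in_iff)

lemma weight_ge_tops: "tops b \<le> weight b"
  using weight_split[of b] weight_nonneg[of "lower b"] by simp

lemma weight_ge_1: "state b \<Longrightarrow> 1 \<le> weight b"
  using tops_ge_1 weight_ge_tops order_trans by blast

lemma lower_mem: "i \<in># lower b \<longleftrightarrow> i \<in># b \<and> 0 < i"
  by (auto simp: lower_def)

lemma ring_add_left: "i \<in># m \<Longrightarrow> ring i (m + r) = ring i m + r"
  by (auto simp: ring_def dest!: multi_member_split)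

lemma ring_add_right: "i \<in># r \<Longrightarrow> ring i (m + r) = m + ring i r"
  by (auto simp: ring_def dest!: multi_member_split)

lemma rise_add: "0 \<in># m \<Longrightarrow> rise (m + r) = rise m + image_mset Suc r"
  by (auto simp: rise_def dest!: multi_member_split)

text \<open>Splits the possible rings between a common part m and a remainder r; as r has no depth
  0, every top belongs to m. The coupling compares two such sums with the same m.\<close>

lemma low_sum_add:
  assumes "0 \<notin># r"
  shows "low_sum f (m + r) =
    (\<Sum>i\<in>#lower m. \<alpha> ^ i * f (ring i m + r)) + (\<Sum>i\<in>#r. \<alpha> ^ i * f (m + ring i r))"
proof -
  have "low_sum f (m + r) = (\<Sum>i\<in>#lower m. \<alpha> ^ i * f (ring i (m + r))) + (\<Sum>i\<in>#r. \<alpha> ^ i * f (ring i (m + r)))"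
    by (simp add: low_sum_def lower_idem[OF assms])
  also have "image_mset (\<lambda>i. \<alpha> ^ i * f (ring i (m + r))) (lower m) = image_mset (\<lambda>i. \<alpha> ^ i * f (ring i m + r)) (lower m)"
    by (rule image_mset_cong) (simp add: ring_add_left lower_mem)
  also have "image_mset (\<lambda>i. \<alpha> ^ i * f (ring i (m + r))) r = image_mset (\<lambda>i. \<alpha> ^ i * f (m + ring i r)) r"
    by (rule image_mset_cong) (simp add: ring_add_right)
  finally show ?thesis .
qed

lemma wsum_mono:
  assumes "\<And>i. i \<in># M \<Longrightarrow> f i \<le> (g i :: real)"
  shows "(\<Sum>i\<in>#M. \<alpha> ^ i * f i) \<le> (\<Sum>i\<in>#M. \<alpha> ^ i * g i)"
  using al0 by (intro sum_mset_mono mult_left_mono assms) auto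

lemma wsum_const: "(\<Sum>i\<in>#M. \<alpha> ^ i * c) = weight M * c"
  by (simp add: weight_def sum_mset_distrib_right)

lemma wsum_abs: "\<bar>\<Sum>i\<in>#M. \<alpha> ^ i * f i\<bar> \<le> (\<Sum>i\<in>#M. \<alpha> ^ i * \<bar>f i\<bar>)" for f :: "nat \<Rightarrow> real"
proof (induction M)
  case (add x M)
  have "\<bar>\<alpha> ^ x * f x + (\<Sum>i\<in>#M. \<alpha> ^ i * f i)\<bar> \<le> \<bar>\<alpha> ^ x * f x\<bar> + \<bar>\<Sum>i\<in>#M. \<alpha> ^ i * f i\<bar>" by simp
  with add al0 show ?case by (simp add: abs_mult)
qed simp

lemma wsum_add: "(\<Sum>i\<in>#M. \<alpha> ^ i * (f i + g i)) = (\<Sum>i\<in>#M. \<alpha> ^ i * f i) + (\<Sum>i\<in>#M. \<alpha> ^ i * g i)"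
  for f g :: "nat \<Rightarrow> real"
  by (simp add: distrib_left sum_mset.distrib)

lemma wsum_cmult: "(\<Sum>i\<in>#M. \<alpha> ^ i * (c * f i)) = c * (\<Sum>i\<in>#M. \<alpha> ^ i * f i)"
  for f :: "nat \<Rightarrow> real"
  by (simp add: sum_mset_distrib_left mult.left_commute)

lemma wsum_diff: "(\<Sum>i\<in>#M. \<alpha> ^ i * (f i - g i)) = (\<Sum>i\<in>#M. \<alpha> ^ i * f i) - (\<Sum>i\<in>#M. \<alpha> ^ i * g i)"
  for f g :: "nat \<Rightarrow> real"
  using wsum_add[of f "\<lambda>i. - 1 * g i" M] unfolding wsum_cmult by simp

lemma low_sum_mono:
  assumes "\<And>i. i \<in># b \<Longrightarrow> 0 < i \<Longrightarrow> f (ring i b) \<le> g (ring i b)"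
  shows "low_sum f b \<le> low_sum g b"
  unfolding low_sum_def using assms by (intro wsum_mono) (auto simp: lower_mem)

lemma low_sum_const: "low_sum (\<lambda>_. c) b = (weight b - tops b) * c"
  using weight_split[of b] by (simp add: low_sum_def wsum_const)

lemma low_sum_plus: "low_sum (\<lambda>b. f b + g b) b = low_sum f b + low_sum g b"
  by (simp add: low_sum_def wsum_add)

lemma low_sum_diff: "low_sum (\<lambda>b. f b - g b) b = low_sum f b - low_sum g b"
  by (simp add: low_sum_def wsum_diff)

lemma low_sum_cmult: "low_sum (\<lambda>b. c * f b) b = c * low_sum f b"
  by (simp add: low_sum_def wsum_cmult)

lemma low_sum_nonneg: "(\<And>i. i \<in># b \<Longrightarrow> 0 < i \<Longrightarrow> 0 \<le> f (ring i b)) \<Longrightarrow> 0 \<le> low_sum f b"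
  using low_sum_mono[of b "\<lambda>_. 0" f] by (simp add: low_sum_const)

section \<open>One level: the steps between two increases of the height\<close>

definition potential :: "nat multiset \<Rightarrow> nat" where
  "potential b = (\<Sum>i\<in>#b. Suc d ^ i)"

lemma potential_add [simp]: "potential (a + b) = potential a + potential b"
  by (simp add: potential_def)

text \<open>The base \<open>Suc d\<close> beats the branching: d vertices at depth i - 1 count less
  than one at depth i. Hence only finitely many rings can precede the next rise.\<close>

lemma potential_ring:
  assumes "i \<in># b" "0 < i" shows "potential (ring i b) < potential b"
proof -
  obtain c where b: "b = add_mset i c" using assms(1) by (auto dest: multi_member_split)
  obtain j where i: "i = Suc j" using assms(2) by (cases i) auto
  have "potential (replicate_mset n j) = n * Suc d ^ j" for n
    by (induction n) (auto simp: potential_def)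
  then show ?thesis by (simp add: ring_def b i) (simp add: potential_def)
qed

lemma ring_induct [consumes 1, case_names step]:
  assumes "state b"
    and "\<And>b. state b \<Longrightarrow> (\<And>i. i \<in># b \<Longrightarrow> 0 < i \<Longrightarrow> P (ring i b)) \<Longrightarrow> P b"
  shows "P b"
  using assms(1)
proof (induction "potential b" arbitrary: b rule: less_induct)
  case less
  show ?case
    by (rule assms(2)[OF less.prems]) (auto intro: less.hyps potential_ring state_ring less.prems)
qed

text \<open>The expected total of \<open>c / weight\<close> over the steps until the next increase of the height, plus the
  expected value of \<open>g\<close> afterwards.\<close>

function level_cost :: "(nat multiset \<Rightarrow> real) \<Rightarrow> (nat multiset \<Rightarrow> real) \<Rightarrow> nat multiset \<Rightarrow> real" where
  "level_cost c g b =
     (c b + (\<Sum>i\<in>set_mset (lower b). real (count b i) * \<alpha> ^ i * level_cost c g (ring i b)) + tops b * g (rise b))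
       / weight b"
  by auto
termination
  by (relation "Wellfounded.measure (\<lambda>(c, g, b). potential b)") (auto simp: lower_mem potential_ring)

declare level_cost.simps [simp del]

text \<open>First-step analysis in linear form. The recursion runs over the finite set of depths
  with multiplicities; the inner claim returns to sums over the multiset.\<close>

lemma level_cost_eq:
  assumes "state b"
  shows "weight b * level_cost c g b = c b + low_sum (level_cost c g) b + tops b * g (rise b)"
proof -
  have "low_sum f b = (\<Sum>i\<in>set_mset (lower b). real (count b i) * \<alpha> ^ i * f (ring i b))" for f
  proof -
    have *: "(\<Sum>i\<in>#M. h i) = (\<Sum>i\<in>set_mset M. real (count M i) * h i)" for M and h :: "nat \<Rightarrow> real"
    proof (induction M)
      case (add x M)
      have "(\<Sum>i\<in>set_mset (add_mset x M). real (count (add_mset x M) i) * h i) =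
        (\<Sum>i\<in>insert x (set_mset M). real (count M i) * h i + (if i = x then h x else 0))"
        by (intro sum.cong) (auto simp: algebra_simps)
      also have "\<dots> = (\<Sum>i\<in>insert x (set_mset M). real (count M i) * h i) + h x"
        by (simp add: sum.distrib)
      also have "(\<Sum>i\<in>insert x (set_mset M). real (count M i) * h i) = (\<Sum>i\<in>set_mset M. real (count M i) * h i)"
        by (rule sum.mono_neutral_right) (auto simp: not_in_iff)
      finally show ?case using add by simp
    qed simp
    show ?thesis unfolding low_sum_def *
      by (intro sum.cong) (auto simp: lower_def)
  qed
  then show ?thesis
    using weight_ge_1[OF assms] by (subst (1) level_cost.simps) simp
qed

section \<open>A Lyapunov function\<close>

text \<open>The generator of the rings alone. The rise is left out because it ends the level and is
  estimated separately.\<close>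

definition drift :: "(nat multiset \<Rightarrow> real) \<Rightarrow> nat multiset \<Rightarrow> real" where
  "drift f b = (\<Sum>i\<in>#lower b. \<alpha> ^ i * (f (ring i b) - f b))"

lemma drift_eq: "drift f b = low_sum f b - (weight b - tops b) * f b"
  using weight_split[of b] by (simp add: drift_def low_sum_def wsum_diff wsum_const)

lemma wsum_delta: "(\<Sum>i\<in>#M. \<alpha> ^ i * (if i = j then x else 0)) = real (count M j) * \<alpha> ^ j * x"
  by (induction M) (auto simp: algebra_simps)

text \<open>Relative lack of vertices at depth j compared with a quota t. Rings at depth j + 1
  reduce it, so a crowd moving upwards is rewarded.\<close>

definition shortage :: "nat \<Rightarrow> nat \<Rightarrow> nat multiset \<Rightarrow> real" where
  "shortage j t b = max 0 (1 - real (count b j) / real t)"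

lemma shortage_bounds: "0 \<le> shortage j t b" "shortage j t b \<le> 1"
  by (auto simp: shortage_def)

text \<open>Only rings at depths j and j + 1 change the count at j. A ring at j adds at most 1 / t,
  and only while the count is at most t, so these rings contribute at most 1 in total; a ring at j +
  1 brings in d \<ge> 1 vertices and removes at least 1 / t as long as the quota is not met.\<close>

lemma drift_shortage:
  assumes t: "0 < t"
  shows "drift (shortage j t) b \<le>
    1 - (if count b j < t then \<alpha> ^ Suc j * real (count b (Suc j)) / real t else 0)"
proof -
  \<comment> \<open>Largest increase and least decrease per ring. In x a count equal to t is
    included, because one ring then falls below the quota; in y it is excluded, because the shortage
    is already 0.\<close>
  define x where "x = (if count b j \<le> t \<and> 0 < j then 1 / real t else 0)"
  define y where "y = (if count b j < t then 1 / real t else 0)"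
  have step: "shortage j t (ring i b) - shortage j t b \<le>
      (if i = j then x else 0) - (if i = Suc j then y else 0)" if i: "i \<in># b" "0 < i" for i
  proof -
    have c: "real (count (ring i b) j) =
        real (count b j) - (if i = j then 1 else 0) + (if i = Suc j then real d else 0)"
      using i by (cases i) (auto simp: ring_def of_nat_diff Suc_le_eq)
    consider "i = j" | "i = Suc j" | "i \<noteq> j" "i \<noteq> Suc j" by blast
    then show ?thesis
    proof cases
      case 1
      then have "real (count (ring i b) j) = real (count b j) - 1" using c by simp
      then have c': "shortage j t (ring i b) = max 0 (1 - real (count b j) / real t + 1 / real t)"
        by (simp add: shortage_def diff_divide_distrib)
      have t1: "0 \<le> 1 / real t" by simp
      show ?thesis
      proof (cases "count b j \<le> t")
        case True
        then have "shortage j t (ring i b) - shortage j t b \<le> 1 / real t"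
          using c' t1 unfolding shortage_def by linarith
        then show ?thesis using 1 i True by (simp add: x_def)
      next
        case False
        then have "real t + 1 \<le> real (count b j)" by linarith
        then have "1 + 1 / real t \<le> real (count b j) / real t"
          using t divide_right_mono[of "real t + 1" "real (count b j)" "real t"]
          by (simp add: add_divide_distrib)
        then have "shortage j t (ring i b) \<le> 0" unfolding c' by simp
        then show ?thesis using 1 False shortage_bounds(1)[of j t b] by (simp add: x_def)
      qed
    next
      case 2
      then have c': "real (count (ring i b) j) = real (count b j) + real d" using c by simp
      have "1 / real t \<le> real d / real t" using d2 by (intro divide_right_mono) auto
      then have c'': "shortage j t (ring i b) \<le> max 0 (1 - real (count b j) / real t - 1 / real t)"
        unfolding shortage_def c' add_divide_distrib by (intro max.mono) auto
      show ?thesis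
      proof (cases "count b j < t")
        case True
        then have "real (count b j) + 1 \<le> real t" by linarith
        then have "real (count b j) / real t + 1 / real t \<le> 1"
          using t by (simp add: add_divide_distrib[symmetric])
        then have "shortage j t (ring i b) \<le> shortage j t b - 1 / real t"
          using c'' unfolding shortage_def by linarith
        then show ?thesis using 2 True by (simp add: y_def)
      next
        case False
        have "max 0 (1 - real (count b j) / real t - 1 / real t) \<le> shortage j t b"
          unfolding shortage_def by (intro max.mono) auto
        then show ?thesis using 2 False order_trans[OF c''] by (simp add: y_def)
      qed
    next
      case 3
      then show ?thesis using c by (simp add: shortage_def)
    qed
  qed
  have "drift (shortage j t) b \<le>
      (\<Sum>i\<in>#lower b. \<alpha> ^ i * ((if i = j then x else 0) - (if i = Suc j then y else 0)))"
    unfolding drift_def using step by (intro wsum_mono) (auto simp: lower_mem)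
  also have "\<dots> = real (count (lower b) j) * \<alpha> ^ j * x - real (count (lower b) (Suc j)) * \<alpha> ^ Suc j * y"
    unfolding wsum_diff wsum_delta ..
  also have "real (count (lower b) j) * \<alpha> ^ j * x \<le> 1"
  proof (cases "count b j \<le> t \<and> 0 < j")
    case True
    have "real (count (lower b) j) * \<alpha> ^ j \<le> real t * 1"
      using True al0 al1 by (intro mult_mono) (auto simp: lower_def power_le_one)
    then show ?thesis using t True by (simp add: x_def)
  next
    case False
    then have "x = 0" unfolding x_def by meson
    then show ?thesis by simp
  qed
  also have "real (count (lower b) (Suc j)) * \<alpha> ^ Suc j * y =
      (if count b j < t then \<alpha> ^ Suc j * real (count b (Suc j)) / real t else 0)"
    by (simp add: y_def lower_def)
  finally show ?thesis by simp
qed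

text \<open>A convex function of x lies below its chord on [0, 1]. Thus the relative growth of a
  power of the weight becomes linear in the ringing rate.\<close>

lemma power_convex_bound:
  fixes x D :: real
  assumes "0 \<le> x" "x \<le> 1" "0 \<le> D"
  shows "(1 + x * D) ^ p \<le> 1 + x * ((1 + D) ^ p - 1)"
proof (induction p)
  case (Suc p)
  let ?E = "(1 + D) ^ p - 1"
  have E: "0 \<le> ?E" using assms by (simp add: one_le_power)
  have "(1 + x * D) ^ Suc p \<le> (1 + x * D) * (1 + x * ?E)"
    using Suc assms by (auto intro!: mult_left_mono)
  also have "\<dots> = 1 + x * D + x * ?E + x * (x * (D * ?E))" by (simp add: algebra_simps)
  also have "x * (x * (D * ?E)) \<le> x * (1 * (D * ?E))"
    using assms E by (intro mult_left_mono mult_right_mono) auto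
  also have "1 + x * D + x * ?E + x * (1 * (D * ?E)) = 1 + x * ((1 + D) ^ Suc p - 1)"
    by (simp add: algebra_simps)
  finally show ?case by simp
qed simp

section \<open>Powers of the weight under rings and rises\<close>

definition gain :: real where "gain = real d / \<alpha> - 1"

lemma gain_nonneg: "0 \<le> gain"
proof -
  have "\<alpha> \<le> real d" using al1 d2 by linarith
  then show ?thesis using al0 by (simp add: gain_def field_simps)
qed

lemma weight_ring_power:
  assumes "state b" "i \<in># b" "0 < i"
  shows "weight (ring i b) ^ p \<le> weight b ^ p * (1 + \<alpha> ^ i / weight b * ((1 + gain) ^ p - 1))"
proof -
  have w: "1 \<le> weight b" by (rule weight_ge_1[OF assms(1)])
  have "\<alpha> ^ i \<le> 1" using al0 al1 by (simp add: power_le_one)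
  then have x: "0 \<le> \<alpha> ^ i / weight b" "\<alpha> ^ i / weight b \<le> 1" using w al0 by auto
  have "weight (ring i b) = weight b + gain * \<alpha> ^ i"
    using weight_ring[OF assms(2,3)] by (simp only: gain_def)
  also have "\<dots> = weight b * (1 + \<alpha> ^ i / weight b * gain)"
    using w by (simp add: distrib_left)
  finally have "weight (ring i b) = weight b * (1 + \<alpha> ^ i / weight b * gain)" .
  then have "weight (ring i b) ^ p = weight b ^ p * (1 + \<alpha> ^ i / weight b * gain) ^ p"
    by (simp add: power_mult_distrib)
  also have "\<dots> \<le> weight b ^ p * (1 + \<alpha> ^ i / weight b * ((1 + gain) ^ p - 1))"
    using w x gain_nonneg by (intro mult_left_mono power_convex_bound) auto
  finally show ?thesis .
qed

text \<open>Depths below I contribute at most 1 per vertex, deeper ones carry an extra factor of at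
  most \<alpha> ^ I. So a large sum of squared rates reveals a crowd at one of finitely many
  depths.\<close>

lemma square_weight_split:
  "(\<Sum>i\<in>#b. \<alpha> ^ i * \<alpha> ^ i) \<le> (\<Sum>j<I. real (count b j)) + \<alpha> ^ I * weight b"
proof (induction b)
  case empty then show ?case by simp
next
  case (add x b)
  have w: "weight (add_mset x b) = weight b + \<alpha> ^ x" by (simp add: weight_def)
  have s: "(\<Sum>j<I. real (count (add_mset x b) j)) = (\<Sum>j<I. real (count b j)) + (if x < I then 1 else 0)"
  proof -
    have "(\<Sum>j<I. real (count (add_mset x b) j)) = (\<Sum>j<I. real (count b j) + (if x = j then 1 else 0))"
      by (intro sum.cong) auto
    then show ?thesis by (simp add: sum.distrib)
  qed
  have "\<alpha> ^ x * \<alpha> ^ x \<le> (if x < I then 1 else 0) + \<alpha> ^ I * \<alpha> ^ x"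
  proof (cases "x < I")
    case True
    have "\<alpha> ^ x * \<alpha> ^ x \<le> 1 * 1" using al0 al1 by (intro mult_mono power_le_one) auto
    moreover have "0 \<le> \<alpha> ^ I * \<alpha> ^ x" using al0 by simp
    ultimately show ?thesis using True by simp
  next
    case False
    then have "\<alpha> ^ x \<le> \<alpha> ^ I" using al0 al1 by (intro power_decreasing) auto
    then show ?thesis using False al0 by (simp add: mult_right_mono)
  qed
  then show ?case using add w s by (simp add: algebra_simps)
qed

text \<open>A rise is affine with slope \<alpha>. The larger slope \<beta> < 1 absorbs the constant
  d once the weight reaches d / (\<beta> - \<alpha>); below that threshold the new power is
  bounded.\<close>

lemma weight_rise_power:
  assumes "state b" "1 \<le> p"
  defines "\<beta> \<equiv> (1 + \<alpha>) / 2"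
  shows "weight (rise b) ^ p \<le> \<beta> * weight b ^ p + (\<alpha> * (real d / (\<beta> - \<alpha>)) + real d) ^ p"
proof -
  have \<beta>: "\<alpha> < \<beta>" "\<beta> < 1" "0 < \<beta>" using al0 al1 by (auto simp: \<beta>_def)
  have w: "weight (rise b) \<le> \<alpha> * weight b + real d"
    using weight_rise[OF state_0[OF assms(1)]] al0 by (simp add: algebra_simps)
  have w0: "0 \<le> weight b" "0 \<le> weight (rise b)" by (rule weight_nonneg)+
  have pos: "0 \<le> (\<alpha> * (real d / (\<beta> - \<alpha>)) + real d) ^ p" using al0 \<beta> by simp
  show ?thesis
  proof (cases "real d / (\<beta> - \<alpha>) \<le> weight b")
    case True
    then have "real d \<le> (\<beta> - \<alpha>) * weight b" using \<beta> by (simp add: pos_divide_le_eq mult.commute)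
    then have "weight (rise b) \<le> \<beta> * weight b" using w by (simp add: algebra_simps)
    then have "weight (rise b) ^ p \<le> \<beta> ^ p * weight b ^ p"
      using w0 by (metis power_mono power_mult_distrib)
    also have "\<beta> ^ p \<le> \<beta> ^ 1" using \<beta> assms(2) by (intro power_decreasing) auto
    finally show ?thesis using pos w0 by (simp add: mult_right_mono)
  next
    case False
    then have "weight (rise b) \<le> \<alpha> * (real d / (\<beta> - \<alpha>)) + real d"
      using w al0 by (smt (verit) mult_left_mono)
    then have "weight (rise b) ^ p \<le> (\<alpha> * (real d / (\<beta> - \<alpha>)) + real d) ^ p"
      using w0 by (intro power_mono)
    moreover have "0 \<le> \<beta> * weight b ^ p" using \<beta> w0 by simp
    ultimately show ?thesis by linarith
  qed
qed

text \<open>A plain power of the weight fails to decrease in expectation only when there are few top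
  vertices but many vertices slightly below them; the factor \<open>g\<close> records how close such a crowd is
  to reaching the top.\<close>

lemma lyapunov_drift:
  assumes p: "1 \<le> p" and \<delta>: "0 < \<delta>" "\<delta> \<le> 1"
  shows "\<exists>g C. (\<forall>b. 1 \<le> g b) \<and> (\<forall>b. g b \<le> 1 + \<delta>) \<and> 0 \<le> C \<and>
    (\<forall>b. state b \<longrightarrow>
      drift (\<lambda>b. weight b ^ p * g b) b \<le> \<delta> * tops b * (weight b ^ p * g b) + C * tops b)"
proof -
  \<comment> \<open>The increment of the chord in \<open>power_convex_bound\<close>, doubled because
    the factor g is at most 2.\<close>
  define E where "E = 2 * ((1 + gain) ^ p - 1)"
  have E: "0 \<le> E" using gain_nonneg by (simp add: E_def one_le_power)
  define \<epsilon> where "\<epsilon> = \<delta> / (2 * (E + 1))"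
  have \<epsilon>: "0 < \<epsilon>" "E * \<epsilon> \<le> \<delta> / 2" using \<delta> E by (auto simp: \<epsilon>_def field_simps)
  \<comment> \<open>Depths from I on, even if they carried the whole weight, contribute at most
    \<epsilon> / 2 times the weight to the sum of squares Q.\<close>
  obtain I where I: "\<alpha> ^ I < \<epsilon> / 2" using real_arch_pow_inv[of "\<epsilon> / 2" \<alpha>] \<epsilon> al1 by auto
  define \<eta> where "\<eta> = \<delta> / (2 * (real I + 1))"
  have \<eta>: "0 < \<eta>" "\<eta> * real I \<le> \<delta> / 2" using \<delta> by (auto simp: \<eta>_def field_simps)
  \<comment> \<open>The quotas \<theta> grow by the factor X from depth to depth. If depth j meets
    its quota and j - 1 does not, the stream from j to j - 1 lowers the shortage there at rate at
    least X * \<alpha> ^ j, enough to beat all other terms.\<close>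
  define X where "X = nat \<lceil>(real I + E / \<eta>) / \<alpha> ^ I\<rceil> + 1"
  have X: "1 \<le> X" "real I + E / \<eta> \<le> real X * \<alpha> ^ I"
  proof -
    have "(real I + E / \<eta>) / \<alpha> ^ I \<le> real X" unfolding X_def by linarith
    then show "real I + E / \<eta> \<le> real X * \<alpha> ^ I" using al0 by (simp add: field_simps)
  qed (simp add: X_def)
  \<comment> \<open>With t0 tops the allowance \<delta> * tops b alone covers a drift of E +
    \<delta>.\<close>
  define t0 where "t0 = nat \<lceil>(E + \<delta>) / \<delta>\<rceil> + 1"
  have t0: "1 \<le> t0" "E + \<delta> \<le> \<delta> * real t0"
  proof -
    have "(E + \<delta>) / \<delta> \<le> real t0" unfolding t0_def by linarith
    then show "E + \<delta> \<le> \<delta> * real t0" using \<delta> by (simp add: field_simps)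
  qed (simp add: t0_def)
  define \<theta> where "\<theta> j = t0 * X ^ j" for j
  have \<theta>: "0 < \<theta> j" for j using t0 X by (simp add: \<theta>_def)
  define g where "g b = 1 + \<eta> * (\<Sum>j<I. shortage j (\<theta> j) b)" for b
  have sh: "(\<Sum>j<I. shortage j (\<theta> j) b) \<le> real I" for b
    using sum_bounded_above[of "{..<I}" "\<lambda>j. shortage j (\<theta> j) b" 1] shortage_bounds by simp
  have g1: "1 \<le> g b" for b using \<eta> by (simp add: g_def sum_nonneg shortage_bounds)
  have g2: "g b \<le> 1 + \<delta>" for b
    using mult_left_mono[OF sh, of \<eta> b] \<eta> \<delta> unfolding g_def by linarith
  have g2': "g b \<le> 2" for b using g2[of b] \<delta> by simp
  define f where "f j b = (if count b j < \<theta> j then \<alpha> ^ Suc j * real (count b (Suc j)) / real (\<theta> j) else 0)" for j b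
  have f0: "0 \<le> f j b" for j b using al0 by (simp add: f_def)
  have drift_g: "drift g b \<le> \<eta> * (real I - (\<Sum>j<I. f j b))" for b
  proof -
    have sum_ms: "(\<Sum>i\<in>#M. \<Sum>j<n. h i j) = (\<Sum>j<n. \<Sum>i\<in>#M. h i j)" for M n and h :: "nat \<Rightarrow> nat \<Rightarrow> real"
      by (induction n) (auto simp: sum_mset.distrib)
    have "drift g b = (\<Sum>i\<in>#lower b. \<Sum>j<I. \<eta> * (\<alpha> ^ i * (shortage j (\<theta> j) (ring i b) - shortage j (\<theta> j) b)))"
      unfolding drift_def g_def
      by (simp add: sum_distrib_left[symmetric] sum_subtractf algebra_simps)
    also have "\<dots> = \<eta> * (\<Sum>j<I. drift (shortage j (\<theta> j)) b)"
      unfolding sum_ms drift_def by (simp add: sum_distrib_left sum_mset_distrib_left)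
    also have "(\<Sum>j<I. drift (shortage j (\<theta> j)) b) \<le> (\<Sum>j<I. 1 - f j b)"
      unfolding f_def using \<theta> by (intro sum_mono drift_shortage) auto
    finally show ?thesis using \<eta> by (simp add: sum_subtractf)
  qed
  define W0 where "W0 = 2 * (\<Sum>j<I. real (\<theta> j)) / \<epsilon> + 1"
  have W0: "0 \<le> W0" using \<epsilon> by (simp add: W0_def sum_nonneg)
  define Q where "Q b = (\<Sum>i\<in>#lower b. \<alpha> ^ i * \<alpha> ^ i)" for b
  define C where "C = (E + \<delta>) * W0 ^ p"
  have C: "0 \<le> C" using E \<delta> W0 by (simp add: C_def)
  \<comment> \<open>Product rule for the drift. A ring at depth i has rate \<alpha> ^ i and a
    relative effect on the weight proportional to \<alpha> ^ i, whence Q, the sum of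
    squares.\<close>
  have main: "drift (\<lambda>b. weight b ^ p * g b) b \<le> weight b ^ p * (E * (Q b / weight b) + drift g b)"
    if b: "state b" for b
  proof -
    have "drift (\<lambda>b. weight b ^ p * g b) b \<le>
      (\<Sum>i\<in>#lower b. \<alpha> ^ i * (weight b ^ p * E / weight b * \<alpha> ^ i + weight b ^ p * (g (ring i b) - g b)))"
      unfolding drift_def
    proof (rule wsum_mono)
      fix i assume "i \<in># lower b"
      then have i: "i \<in># b" "0 < i" by (auto simp: lower_mem)
      have "weight (ring i b) ^ p - weight b ^ p \<le> weight b ^ p * (\<alpha> ^ i / weight b * (E / 2))"
        using weight_ring_power[OF b i, of p] by (simp add: E_def algebra_simps)
      then have "(weight (ring i b) ^ p - weight b ^ p) * g (ring i b) \<le> weight b ^ p * (\<alpha> ^ i / weight b * (E / 2)) * g (ring i b)"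
        using g1[of "ring i b"] by (intro mult_right_mono) auto
      also have "\<dots> \<le> weight b ^ p * (\<alpha> ^ i / weight b * (E / 2)) * 2"
        using g2' al0 E weight_nonneg[of b] by (intro mult_left_mono) auto
      finally show "weight (ring i b) ^ p * g (ring i b) - weight b ^ p * g b \<le>
        weight b ^ p * E / weight b * \<alpha> ^ i + weight b ^ p * (g (ring i b) - g b)"
        by (simp add: algebra_simps)
    qed
    also have "\<dots> = weight b ^ p * E / weight b * Q b + weight b ^ p * drift g b"
      unfolding wsum_add wsum_cmult drift_def Q_def ..
    finally show ?thesis by (simp add: algebra_simps)
  qed
  have QW: "Q b \<le> weight b" if "state b" for b
  proof -
    have "Q b \<le> (\<Sum>i\<in>#lower b. \<alpha> ^ i * 1)"
      unfolding Q_def using al0 al1 by (intro wsum_mono) (auto simp: power_le_one)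
    then show ?thesis using weight_split[of b] tops_ge_1[OF that] unfolding wsum_const by simp
  qed
  show ?thesis
  proof (intro exI[of _ g] exI[of _ C] conjI allI impI g1 g2 C)
    fix b assume b: "state b"
    note dV = main[OF b]
    have w: "1 \<le> weight b" and k: "1 \<le> tops b" using weight_ge_1 tops_ge_1 b by auto
    have wp: "1 \<le> weight b ^ p" using w by simp
    have V: "weight b ^ p * 1 \<le> weight b ^ p * g b" using g1[of b] wp by (intro mult_left_mono) auto
    have Ck: "0 \<le> C * tops b" using C k by simp
    have qw: "Q b / weight b \<le> 1" using QW[OF b] w by simp
    have dg: "drift g b \<le> \<delta> / 2"
    proof -
      have "0 \<le> (\<Sum>j<I. f j b)" using f0 by (intro sum_nonneg) auto
      then have "\<eta> * (real I - (\<Sum>j<I. f j b)) \<le> \<eta> * real I"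
        using \<eta> by (intro mult_left_mono) auto
      then show ?thesis using drift_g[of b] \<eta> by linarith
    qed
    show "drift (\<lambda>b. weight b ^ p * g b) b \<le> \<delta> * tops b * (weight b ^ p * g b) + C * tops b"
    \<comment> \<open>The drift is harmless if the weight is small (absorbed by C), if there are
      many tops, or if Q is small compared with the weight. Otherwise there is a crowd at shallow
      depth, and g pays.\<close>
    proof (cases "weight b \<le> W0")
      case True
      have "E * (Q b / weight b) + drift g b \<le> E + \<delta>"
        using qw dg \<delta> E mult_left_mono[OF qw E] by simp
      then have "weight b ^ p * (E * (Q b / weight b) + drift g b) \<le> W0 ^ p * (E + \<delta>)"
        using w E \<delta> True W0 by (intro order_trans[OF mult_left_mono mult_right_mono] power_mono) auto
      also have "\<dots> \<le> C * tops b" using mult_left_mono[OF k C] by (simp add: C_def mult.commute)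
      finally have "weight b ^ p * (E * (Q b / weight b) + drift g b) \<le> C * tops b" .
      moreover have "0 \<le> \<delta> * tops b * (weight b ^ p * g b)"
        using \<delta> k V wp by (intro mult_nonneg_nonneg) auto
      ultimately show ?thesis using dV by linarith
    next
      case False
      have "E * (Q b / weight b) + drift g b \<le> \<delta> * tops b"
      proof (cases "\<theta> 0 \<le> count b 0")
        case True
        then have "\<delta> * real t0 \<le> \<delta> * tops b" using \<delta> by (simp add: tops_def \<theta>_def)
        then show ?thesis using t0(2) qw dg \<delta> E mult_left_mono[OF qw E] by linarith
      next
        case k_small: False
        show ?thesis
        proof (cases "Q b \<le> \<epsilon> * weight b")
          case True
          then have "Q b / weight b \<le> \<epsilon>" using w by (simp add: field_simps)
          then have "E * (Q b / weight b) \<le> E * \<epsilon>" by (rule mult_left_mono) (rule E)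
          then have "E * (Q b / weight b) \<le> \<delta> / 2" using \<epsilon>(2) by linarith
          moreover have "\<delta> * 1 \<le> \<delta> * tops b" using k \<delta> by (intro mult_left_mono) auto
          ultimately show ?thesis using dg by linarith
        next
          case Q_large: False
          have "\<exists>j<I. \<theta> j \<le> count b j"
          proof (rule ccontr)
            assume "\<not> ?thesis"
            then have "(\<Sum>j<I. real (count b j)) \<le> (\<Sum>j<I. real (\<theta> j))"
              by (intro sum_mono) (auto simp: not_le less_imp_le)
            also have "\<dots> \<le> \<epsilon> / 2 * weight b" using False \<epsilon> unfolding W0_def by (simp add: field_simps)
            finally have "(\<Sum>j<I. real (count b j)) + \<alpha> ^ I * weight b \<le> \<epsilon> * weight b"
              using mult_right_mono[of "\<alpha> ^ I" "\<epsilon> / 2" "weight b"] I w by linarith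
            moreover have "Q b \<le> (\<Sum>i\<in>#b. \<alpha> ^ i * \<alpha> ^ i)"
              unfolding Q_def lower_def using al0 by (induction b) auto
            ultimately show False using Q_large square_weight_split[of b I] by linarith
          qed
          \<comment> \<open>The least depth that meets its quota is not 0, so the depth just above
            it is short of vertices and is being filled quickly.\<close>
          then obtain j where j: "j < I" "\<theta> j \<le> count b j" and
            least: "\<And>l. l < j \<Longrightarrow> \<not> (l < I \<and> \<theta> l \<le> count b l)"
            using exists_least_iff[of "\<lambda>j. j < I \<and> \<theta> j \<le> count b j"] by blast
          obtain l where l: "j = Suc l" using j(2) k_small by (cases j) auto
          have "count b l < \<theta> l" using least[of l] j l by auto
          then have "f l b = \<alpha> ^ j * real (count b j) / real (\<theta> l)" by (simp add: f_def l)
          also have "\<dots> \<ge> \<alpha> ^ j * real (\<theta> j) / real (\<theta> l)"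
            using j al0 by (intro divide_right_mono mult_left_mono) auto
          also have "\<alpha> ^ j * real (\<theta> j) / real (\<theta> l) = real X * \<alpha> ^ j"
            using \<theta>[of l] by (simp add: \<theta>_def l)
          also have "\<dots> \<ge> real X * \<alpha> ^ I"
            using j al0 al1 by (intro mult_left_mono power_decreasing) auto
          finally have "real I + E / \<eta> \<le> f l b" using X(2) by linarith
          also have "f l b \<le> (\<Sum>j<I. f j b)" using f0 j l by (intro member_le_sum) auto
          finally have "E \<le> \<eta> * ((\<Sum>j<I. f j b) - real I)" using \<eta> by (simp add: field_simps)
          then have "drift g b \<le> - E" using drift_g[of b] by (simp add: algebra_simps)
          moreover have "0 \<le> \<delta> * tops b" using \<delta> k by simp
          ultimately show ?thesis using mult_left_mono[OF qw E] by simp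
        qed
      qed
      then have "weight b ^ p * (E * (Q b / weight b) + drift g b) \<le> weight b ^ p * (\<delta> * tops b)"
        using wp by (intro mult_left_mono) auto
      also have "\<dots> \<le> \<delta> * tops b * (weight b ^ p * g b)"
        using V k \<delta> mult_left_mono[OF V, of "\<delta> * tops b"] by (simp add: mult.commute)
      finally show ?thesis using dV Ck by linarith
    qed
  qed
qed

text \<open>\<delta> bounds the growth of V inside a level per unit of top rate, \<gamma> is its
  contraction at the rise. As g lies in [1, 1 + \<delta>], comparing V before and after a rise costs
  only a factor 1 + \<delta>; so \<gamma> = (1 + \<delta>) * \<beta>, and \<delta> + \<gamma> < 1
  for small \<delta>. A whole level then contracts V up to a constant.\<close>

lemma lyapunov:
  assumes p: "1 \<le> p"
  obtains V C \<delta> \<gamma> where "0 \<le> \<delta>" "0 \<le> \<gamma>" "\<delta> + \<gamma> < 1" "1 \<le> C"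
    "\<And>b. weight b ^ p \<le> V b" "\<And>b. V b \<le> 2 * weight b ^ p"
    "\<And>b. state b \<Longrightarrow> low_sum V b \<le> (weight b - tops b + \<delta> * tops b) * V b + C * tops b"
    "\<And>b. state b \<Longrightarrow> V (rise b) \<le> \<gamma> * V b + C"
    "\<And>b i. state b \<Longrightarrow> i \<in># b \<Longrightarrow> 0 < i \<Longrightarrow> V (ring i b) \<le> C * V b"
proof -
  define \<beta> where "\<beta> = (1 + \<alpha>) / 2"
  define \<delta> where "\<delta> = (1 - \<beta>) / 4"
  have \<beta>: "\<alpha> < \<beta>" "\<beta> < 1" "0 < \<beta>" and \<delta>: "0 < \<delta>" "\<delta> \<le> 1" using al0 al1 by (auto simp: \<beta>_def \<delta>_def field_simps)
  obtain g C where g: "\<And>b. 1 \<le> g b" "\<And>b. g b \<le> 1 + \<delta>" and C: "0 \<le> C"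
    "\<And>b. state b \<Longrightarrow> drift (\<lambda>b. weight b ^ p * g b) b \<le> \<delta> * tops b * (weight b ^ p * g b) + C * tops b"
    using lyapunov_drift[OF p \<delta>] by blast
  define V where "V b = weight b ^ p * g b" for b
  have V1: "weight b ^ p \<le> V b" for b
    using mult_left_mono[OF g(1), of "weight b ^ p" b] weight_nonneg[of b] by (simp add: V_def)
  have V2': "V b \<le> (1 + \<delta>) * weight b ^ p" for b
    using mult_left_mono[OF g(2), of "weight b ^ p" b] weight_nonneg[of b] by (simp add: V_def mult.commute)
  have V2: "V b \<le> 2 * weight b ^ p" for b
  proof -
    have "(1 + \<delta>) * weight b ^ p \<le> 2 * weight b ^ p"
      using \<delta> weight_nonneg[of b] by (intro mult_right_mono) auto
    then show ?thesis using V2'[of b] by linarith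
  qed
  define C1 where "C1 = 2 * (\<alpha> * (real d / (\<beta> - \<alpha>)) + real d) ^ p"
  have C1: "0 \<le> C1" using al0 \<beta> by (simp add: C1_def)
  define C2 where "C2 = 2 * (1 + gain) ^ p"
  have C2: "0 \<le> C2" using gain_nonneg by (simp add: C2_def)
  have V0: "0 \<le> V b" for b
    using V1[of b] zero_le_power[OF weight_nonneg[of b], of p] by linarith
  show thesis
  proof (rule that[of \<delta> "(1 + \<delta>) * \<beta>" "C + C1 + C2 + 1" V, OF _ _ _ _ V1 V2])
    show "\<delta> + (1 + \<delta>) * \<beta> < 1"
    proof -
      have "\<delta> + (1 + \<delta>) * \<beta> = \<beta> + \<delta> + \<delta> * \<beta>" by (simp add: algebra_simps)
      also have "\<delta> * \<beta> \<le> \<delta> * 1" using \<beta> \<delta> by (intro mult_left_mono) auto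
      finally have "\<delta> + (1 + \<delta>) * \<beta> \<le> \<beta> + \<delta> + \<delta> * 1" by simp
      moreover have "4 * \<delta> = 1 - \<beta>" by (simp add: \<delta>_def)
      ultimately show ?thesis using \<beta>(2) by linarith
    qed
    fix b assume b: "state b"
    have k: "1 \<le> tops b" by (rule tops_ge_1[OF b])
    have "low_sum V b \<le> (weight b - tops b) * V b + \<delta> * tops b * V b + C * tops b"
      using C(2)[OF b] unfolding drift_eq V_def[symmetric] by simp
    also have "C * tops b \<le> (C + C1 + C2 + 1) * tops b" using C1 C2 k by (intro mult_right_mono) auto
    finally show "low_sum V b \<le> (weight b - tops b + \<delta> * tops b) * V b + (C + C1 + C2 + 1) * tops b"
      by (simp add: algebra_simps)
    have "V (rise b) \<le> (1 + \<delta>) * weight (rise b) ^ p" by (rule V2')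
    also have "\<dots> \<le> (1 + \<delta>) * (\<beta> * weight b ^ p + C1 / 2)"
      using weight_rise_power[OF b p] \<delta> by (intro mult_left_mono) (auto simp: \<beta>_def C1_def)
    also have "\<dots> = (1 + \<delta>) * \<beta> * weight b ^ p + (1 + \<delta>) / 2 * C1" by (simp add: algebra_simps)
    also have "(1 + \<delta>) * \<beta> * weight b ^ p \<le> (1 + \<delta>) * \<beta> * V b" using V1 \<beta> \<delta> by (intro mult_left_mono) auto
    also have "(1 + \<delta>) / 2 * C1 \<le> 1 * C1" using \<delta> C1 by (intro mult_right_mono) auto
    finally show "V (rise b) \<le> (1 + \<delta>) * \<beta> * V b + (C + C1 + C2 + 1)" using C C2 by linarith
    fix i assume i: "i \<in># b" "0 < i"
    have w: "1 \<le> weight b" by (rule weight_ge_1[OF b])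
    have "\<alpha> ^ i \<le> 1" using al0 al1 by (simp add: power_le_one)
    then have x: "\<alpha> ^ i / weight b \<le> 1" using w by auto
    have E: "0 \<le> (1 + gain) ^ p - 1" using gain_nonneg by (simp add: one_le_power)
    have "V (ring i b) \<le> 2 * weight (ring i b) ^ p" by (rule V2)
    also have "\<dots> \<le> 2 * (weight b ^ p * (1 + \<alpha> ^ i / weight b * ((1 + gain) ^ p - 1)))"
      using weight_ring_power[OF b i, of p] by simp
    also have "\<dots> \<le> 2 * (weight b ^ p * (1 + 1 * ((1 + gain) ^ p - 1)))"
      using x E w by (intro mult_left_mono add_left_mono mult_right_mono) auto
    also have "\<dots> = C2 * weight b ^ p" by (simp add: C2_def)
    also have "\<dots> \<le> C2 * V b" using C2 V1 by (intro mult_left_mono)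
    also have "\<dots> \<le> (C + C1 + C2 + 1) * V b" using C C1 V0 by (intro mult_right_mono) auto
    finally show "V (ring i b) \<le> (C + C1 + C2 + 1) * V b" .
  qed (use \<delta> \<beta> C C1 C2 in auto)
qed

section \<open>Coupling and contraction\<close>

text \<open>Comparison principle: a supersolution Y of the first-step equation dominates its
  solution, by induction along rings. Bounds on \<open>level_cost\<close> are obtained by guessing
  such a Y.\<close>

lemma level_cost_le:
  assumes "\<And>b. state b \<Longrightarrow> c b + low_sum Y b + tops b * g (rise b) \<le> weight b * Y b" "state b"
  shows "level_cost c g b \<le> Y b"
  using assms(2)
proof (induction rule: ring_induct)
  case (step b)
  have "weight b * level_cost c g b \<le> c b + low_sum Y b + tops b * g (rise b)"
    unfolding level_cost_eq[OF step(1)] using step(2)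
    by (intro add_mono low_sum_mono order_refl) auto
  also have "\<dots> \<le> weight b * Y b" by (rule assms(1)[OF step(1)])
  finally show ?case using weight_ge_1[OF step(1)] by simp
qed

lemma level_cost_ge:
  assumes "\<And>b. state b \<Longrightarrow> weight b * Y b \<le> c b + low_sum Y b + tops b * g (rise b)" "state b"
  shows "Y b \<le> level_cost c g b"
  using assms(2)
proof (induction rule: ring_induct)
  case (step b)
  have "weight b * Y b \<le> c b + low_sum Y b + tops b * g (rise b)" by (rule assms(1)[OF step(1)])
  also have "\<dots> \<le> weight b * level_cost c g b"
    unfolding level_cost_eq[OF step(1)] using step(2)
    by (intro add_mono low_sum_mono order_refl) auto
  finally show ?case using weight_ge_1[OF step(1)] by simp
qed

lemma level_cost_unique:
  assumes "\<And>b. state b \<Longrightarrow> weight b * Y b = c b + low_sum Y b + tops b * g (rise b)" "state b"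
  shows "level_cost c g b = Y b"
  using level_cost_le[of c Y g b] level_cost_ge[of Y c g b] assms by (simp add: order_antisym)

lemma level_cost_diff:
  assumes "state b"
  shows "level_cost (\<lambda>b. c b - c' b) (\<lambda>b. g b - g' b) b = level_cost c g b - level_cost c' g' b"
  by (rule level_cost_unique[OF _ assms])
    (simp add: right_diff_distrib level_cost_eq low_sum_diff)

lemma level_cost_cmult:
  assumes "state b"
  shows "level_cost (\<lambda>b. x * c b) (\<lambda>b. x * g b) b = x * level_cost c g b"
proof (rule level_cost_unique[OF _ assms])
  fix b assume b: "state b"
  have "weight b * (x * level_cost c g b) = x * (weight b * level_cost c g b)" by simp
  also have "\<dots> = x * c b + low_sum (\<lambda>b. x * level_cost c g b) b + tops b * (x * g (rise b))"
    unfolding level_cost_eq[OF b] low_sum_cmult by (simp add: algebra_simps)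
  finally show "weight b * (x * level_cost c g b) =
    x * c b + low_sum (\<lambda>b. x * level_cost c g b) b + tops b * (x * g (rise b))" .
qed

lemma level_cost_const: "state b \<Longrightarrow> level_cost (\<lambda>_. 0) (\<lambda>_. x) b = x"
  by (rule level_cost_unique) (auto simp: low_sum_const algebra_simps)

lemma level_cost_mono:
  assumes "\<And>b. state b \<Longrightarrow> c b \<le> c' b" "\<And>b. state b \<Longrightarrow> g (rise b) \<le> g' (rise b)" "state b"
  shows "level_cost c g b \<le> level_cost c' g' b"
proof (rule level_cost_le[OF _ assms(3)])
  fix b assume b: "state b"
  have "tops b * g (rise b) \<le> tops b * g' (rise b)"
    using assms(2)[OF b] tops_ge_1[OF b] by (intro mult_left_mono) auto
  then show "c b + low_sum (level_cost c' g') b + tops b * g (rise b) \<le> weight b * level_cost c' g' b"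
    using level_cost_eq[OF b, of c' g'] assms(1)[OF b] by simp
qed

text \<open>From a given profile a level can reach only finitely many others, so its cost depends
  continuously on the values after the rise.\<close>

lemma level_cost_tendsto:
  assumes "\<And>b. state b \<Longrightarrow> (\<lambda>n. g n b) \<longlonglongrightarrow> G b" "state b"
  shows "(\<lambda>n. level_cost c (g n) b) \<longlonglongrightarrow> level_cost c G b"
  using assms(2)
proof (induction rule: ring_induct)
  case (step b)
  have low: "(\<lambda>n. low_sum (f n) b) \<longlonglongrightarrow> low_sum F b"
    if "\<And>i. i \<in># b \<Longrightarrow> 0 < i \<Longrightarrow> (\<lambda>n. f n (ring i b)) \<longlonglongrightarrow> F (ring i b)" for f F
  proof -
    have "(\<lambda>n. \<Sum>i\<in>#M. \<alpha> ^ i * f n (ring i b)) \<longlonglongrightarrow> (\<Sum>i\<in>#M. \<alpha> ^ i * F (ring i b))"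
      if "M \<subseteq># lower b" for M
      using that
    proof (induction M)
      case (add x M)
      then have "x \<in># lower b" "M \<subseteq># lower b"
        by (auto dest: mset_subset_eq_insertD mset_subset_eqD subset_mset.less_imp_le)
      then show ?case
        using add.IH \<open>\<And>i. i \<in># b \<Longrightarrow> 0 < i \<Longrightarrow> (\<lambda>n. f n (ring i b)) \<longlonglongrightarrow> F (ring i b)\<close>
        by (auto simp: lower_mem intro!: tendsto_intros)
    qed simp
    then show ?thesis by (auto simp: low_sum_def)
  qed
  have "(\<lambda>n. (c b + low_sum (level_cost c (g n)) b + tops b * g n (rise b)) / weight b)
      \<longlonglongrightarrow> (c b + low_sum (level_cost c G) b + tops b * G (rise b)) / weight b"
    using weight_ge_1[OF step(1)] step(2) assms(1)[OF state_rise]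
    by (intro tendsto_intros low) auto
  moreover have "level_cost c g b = (c b + low_sum (level_cost c g) b + tops b * g (rise b)) / weight b" for g
    using level_cost_eq[OF step(1), of c g] weight_ge_1[OF step(1)] by (simp add: field_simps)
  ultimately show ?case by simp
qed

text \<open>The states \<open>m + r\<close> and \<open>m + r'\<close> evolve together as long as only elements of \<open>m\<close> ring.  The
  total rate of the coupled process is \<open>weight m + weight r + weight r'\<close>: while an element of
  \<open>r'\<close> rings, the state \<open>m + r\<close> stands still.\<close>

lemma coupling:
  assumes r: "0 \<notin># r" "0 \<notin># r'" and m: "state m"
    and \<Phi>: "\<And>b. state b \<Longrightarrow> weight b * \<Phi> b = c b + low_sum \<Phi> b + tops b * g (rise b)"
    and Y: "\<And>m. state m \<Longrightarrow>
      low_sum Y m + tops m * \<bar>g (rise m + image_mset Suc r) - g (rise m + image_mset Suc r')\<bar>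
      + \<bar>c (m + r) - c (m + r')\<bar>
      + ((\<Sum>i\<in>#r. \<alpha> ^ i * \<bar>\<Phi> (m + ring i r) - \<Phi> (m + r')\<bar>)
       + (\<Sum>i\<in>#r'. \<alpha> ^ i * \<bar>\<Phi> (m + r) - \<Phi> (m + ring i r')\<bar>))
      \<le> (weight m + weight r + weight r') * Y m"
  shows "\<bar>\<Phi> (m + r) - \<Phi> (m + r')\<bar> \<le> Y m"
  using m
proof (induction rule: ring_induct)
  case (step m)
  let ?N = "weight m + weight r + weight r'"
  have top: "0 \<in># m" by (rule state_0[OF step(1)])
  have e1: "(weight m + weight r) * \<Phi> (m + r) = c (m + r)
      + ((\<Sum>i\<in>#lower m. \<alpha> ^ i * \<Phi> (ring i m + r)) + (\<Sum>i\<in>#r. \<alpha> ^ i * \<Phi> (m + ring i r)))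
      + tops m * g (rise m + image_mset Suc r)"
    using \<Phi>[OF state_add[OF step(1)], of r] r
    by (simp add: low_sum_add tops_add rise_add[OF top])
  have e2: "(weight m + weight r') * \<Phi> (m + r') = c (m + r')
      + ((\<Sum>i\<in>#lower m. \<alpha> ^ i * \<Phi> (ring i m + r')) + (\<Sum>i\<in>#r'. \<alpha> ^ i * \<Phi> (m + ring i r')))
      + tops m * g (rise m + image_mset Suc r')"
    using \<Phi>[OF state_add[OF step(1)], of r'] r
    by (simp add: low_sum_add tops_add rise_add[OF top])
  define a where "a = (\<Sum>i\<in>#lower m. \<alpha> ^ i * (\<Phi> (ring i m + r) - \<Phi> (ring i m + r')))"
  define e where "e = (\<Sum>i\<in>#r. \<alpha> ^ i * (\<Phi> (m + ring i r) - \<Phi> (m + r')))"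
  define f where "f = (\<Sum>i\<in>#r'. \<alpha> ^ i * (\<Phi> (m + r) - \<Phi> (m + ring i r')))"
  define t where "t = tops m * (g (rise m + image_mset Suc r) - g (rise m + image_mset Suc r'))"
  have N0: "1 \<le> ?N" using weight_ge_1[OF step(1)] weight_nonneg[of r] weight_nonneg[of r'] by simp
  have eq: "?N * (\<Phi> (m + r) - \<Phi> (m + r')) = (c (m + r) - c (m + r')) + a + e + f + t"
  proof -
    have "?N * (\<Phi> (m + r) - \<Phi> (m + r')) = (weight m + weight r) * \<Phi> (m + r)
        - (weight m + weight r') * \<Phi> (m + r') + weight r' * \<Phi> (m + r) - weight r * \<Phi> (m + r')"
      by (simp add: algebra_simps)
    then show ?thesis unfolding e1 e2 a_def e_def f_def t_def wsum_diff wsum_const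
      by (simp add: algebra_simps)
  qed
  have "?N * \<bar>\<Phi> (m + r) - \<Phi> (m + r')\<bar> = \<bar>?N * (\<Phi> (m + r) - \<Phi> (m + r'))\<bar>"
    using N0 by (simp add: abs_mult)
  also have "\<dots> \<le> \<bar>c (m + r) - c (m + r')\<bar> + \<bar>a\<bar> + \<bar>e\<bar> + \<bar>f\<bar> + \<bar>t\<bar>" unfolding eq by linarith
  also have "\<bar>a\<bar> \<le> low_sum Y m"
    unfolding a_def low_sum_def
    by (rule order_trans[OF wsum_abs wsum_mono]) (use step(2) in \<open>auto simp: lower_mem\<close>)
  also have "\<bar>e\<bar> \<le> (\<Sum>i\<in>#r. \<alpha> ^ i * \<bar>\<Phi> (m + ring i r) - \<Phi> (m + r')\<bar>)"
    unfolding e_def by (rule wsum_abs)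
  also have "\<bar>f\<bar> \<le> (\<Sum>i\<in>#r'. \<alpha> ^ i * \<bar>\<Phi> (m + r) - \<Phi> (m + ring i r')\<bar>)"
    unfolding f_def by (rule wsum_abs)
  also have "\<bar>t\<bar> = tops m * \<bar>g (rise m + image_mset Suc r) - g (rise m + image_mset Suc r')\<bar>"
    unfolding t_def by (simp add: abs_mult tops_def)
  finally have "?N * \<bar>\<Phi> (m + r) - \<Phi> (m + r')\<bar> \<le> ?N * Y m" using Y[OF step(1)] by linarith
  then show ?case using N0 by simp
qed

end

text \<open>\<open>Z \<rho> v\<close> is a distance of two states that differ by vertices of total weight \<open>\<rho>\<close> and have Lyapunov
  values of sum \<open>v\<close>.  Increasing the height by one replaces \<open>\<rho>\<close> by \<open>\<alpha> * \<rho>\<close> if none of the differing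
  vertices is chosen.  For small \<open>\<rho>\<close> the distance is proportional to \<open>\<rho>\<close> (first alternative);
  otherwise the bounded part \<open>B * chi\<close> gains from the probability at least \<open>1 / (1 + \<rho>)\<close> of staying
  coupled, and \<open>v\<close> contracts up to a constant (second alternative).\<close>

lemma contraction_weight_exists:
  fixes \<alpha> C \<kappa> C2 :: real
  assumes al: "0 < \<alpha>" "\<alpha> < 1" and C: "1 \<le> C" and \<kappa>: "0 \<le> \<kappa>" "\<kappa> < 1" and C2: "0 \<le> C2"
  shows "\<exists>Z \<eta> B D. 0 < \<eta> \<and> \<eta> < 1 \<and> 4 * C \<le> B \<and> 0 \<le> D \<and>
    (\<forall>\<rho> v. 0 \<le> \<rho> \<longrightarrow> 1 \<le> v \<longrightarrow> 0 \<le> Z \<rho> v \<and> Z \<rho> v \<le> B + v \<and> Z \<rho> v \<le> D * \<rho> * v \<and> min 1 \<rho> * v \<le> D * Z \<rho> v) \<and>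
    (\<forall>\<rho>\<ge>0.
      (\<exists>s\<ge>0. (\<forall>v\<ge>1. Z (\<alpha> * \<rho>) v \<le> s * (B / 2 + v)) \<and>
        (\<forall>v\<ge>1. s * (B / 2 + \<kappa> * v + 4 * C) + \<rho> * C2 * (B + v) \<le> (1 - \<eta>) * Z \<rho> v)) \<or>
      (\<exists>x. 0 \<le> x \<and> x \<le> 1 \<and> (\<forall>v\<ge>1. Z (\<alpha> * \<rho>) v \<le> B * x + v) \<and>
        (\<forall>v\<ge>1. \<rho> \<le> v \<longrightarrow> B * ((x + \<rho>) / (1 + \<rho>)) + \<kappa> * v + 4 * C \<le> (1 - \<eta>) * Z \<rho> v)))"
proof -
  \<comment> \<open>1 / K separates small from larger \<rho>. K is so large that the decoupling cost
    \<rho> * C2 is a small fraction of the linear scale K * \<rho>, and that \<rho> is at most (1 -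
    \<alpha>) / 4 as long as K * \<alpha> * \<rho> < 1.\<close>
  define K where "K = max 1 (max (16 * C2 / (1 - \<alpha>)) (4 / (\<alpha> * (1 - \<alpha>))))"
  have K: "1 \<le> K" "C2 / K \<le> (1 - \<alpha>) / 16" "1 / (\<alpha> * K) \<le> (1 - \<alpha>) / 4"
  proof -
    show "1 \<le> K" by (simp add: K_def)
    have "16 * C2 / (1 - \<alpha>) \<le> K" "4 / (\<alpha> * (1 - \<alpha>)) \<le> K" by (auto simp: K_def)
    then show "C2 / K \<le> (1 - \<alpha>) / 16" "1 / (\<alpha> * K) \<le> (1 - \<alpha>) / 4"
      using al \<open>1 \<le> K\<close> by (auto simp: field_simps)
  qed
  \<comment> \<open>In the second alternative v \<ge> \<rho>. Beyond R half of the contraction of v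
    therefore pays 5 * C, and chi may be constant.\<close>
  define R where "R = 10 * C / (1 - \<kappa>)"
  have "10 * C * (1 - \<kappa>) \<le> 10 * C * 1" using C \<kappa> by (intro mult_left_mono) auto
  then have R: "1 \<le> R" "(1 - \<kappa>) / 2 * R = 5 * C"
    using C \<kappa> by (auto simp: R_def field_simps)
  obtain n0 where n0: "\<alpha> ^ n0 < 1 / (2 * (1 + R))"
    using real_arch_pow_inv[of "1 / (2 * (1 + R))" \<alpha>] R al by auto
  \<comment> \<open>The exponent in chi. A rise multiplies the deficit 1 - chi by at least 2 * (1 +
    R), while the risk of decoupling divides it by at most 1 + R.\<close>
  define n where "n = Suc n0"
  have "\<alpha> ^ n \<le> \<alpha> ^ n0" using al by (simp add: n_def mult_le_cancel_right2)
  then have "\<alpha> ^ n * (2 * (1 + R)) \<le> \<alpha> ^ n0 * (2 * (1 + R))" using R by (intro mult_right_mono) auto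
  also have "\<dots> \<le> 1" using n0 R by (simp add: field_simps)
  finally have n: "1 \<le> n" "\<alpha> ^ n * (2 * (1 + R)) \<le> 1" by (auto simp: n_def)
  have KR: "1 \<le> K * R" using K R by (metis mult_mono mult_1 zero_le_one order_trans)
  define \<epsilon> where "\<epsilon> = min (1 / 2 * (1 / (K * R)) ^ n) ((1 - \<alpha>) / 4)"
  have \<epsilon>: "0 < \<epsilon>" using al KR by (simp add: \<epsilon>_def)
  \<comment> \<open>Large enough for the gain in the part proportional to B to beat the additive
    constant 4 * C, in the linear regime and in that of chi.\<close>
  define B where "B = max (32 * C / (1 - \<alpha>)) (max (4 * C) (8 * C / \<epsilon>))"
  have B: "32 * C / (1 - \<alpha>) \<le> B" "4 * C \<le> B" "8 * C / \<epsilon> \<le> B" by (auto simp: B_def)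
  have B1: "4 * C \<le> B * (1 - \<alpha>) / 8" "4 * C \<le> \<epsilon> * B / 2" using B al \<epsilon> by (auto simp: field_simps)
  define \<eta> where "\<eta> = min ((1 - \<alpha>) / 2) (min ((1 - \<kappa>) / 2) (min (C / B) (\<epsilon> / 2)))"
  have \<eta>: "0 < \<eta>" "\<eta> \<le> (1 - \<alpha>) / 2" "\<eta> \<le> (1 - \<kappa>) / 2" "\<eta> \<le> C / B" "\<eta> \<le> \<epsilon> / 2"
  proof -
    show "0 < \<eta>" using al \<kappa> \<epsilon> B C by (simp add: \<eta>_def)
    show "\<eta> \<le> (1 - \<alpha>) / 2" unfolding \<eta>_def by (rule min.cobounded1)
    show "\<eta> \<le> (1 - \<kappa>) / 2" unfolding \<eta>_def by (rule min.coboundedI2, rule min.cobounded1)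
    show "\<eta> \<le> C / B" unfolding \<eta>_def by (rule min.coboundedI2, rule min.coboundedI2, rule min.cobounded1)
    show "\<eta> \<le> \<epsilon> / 2" unfolding \<eta>_def by (rule min.coboundedI2, rule min.coboundedI2, rule min.cobounded2)
  qed
  have \<eta>B: "\<eta> * B \<le> C" "\<eta> * B \<le> \<epsilon> * B / 2" using \<eta> B C by (auto simp: field_simps)
  \<comment> \<open>The deficit 1 - chi equals 1 / 2 at K * \<rho> = 1, so both branches of Z have
    the value B / 2 + v there. It decreases like a power of \<rho>, which leaves room for
    improvement at every \<rho> \<le> R.\<close>
  define chi where "chi \<rho> = (if \<rho> \<le> R then 1 - 1 / 2 * (1 / (K * \<rho>)) ^ n else 1)" for \<rho>
  define Z where "Z \<rho> v = (if K * \<rho> < 1 then K * \<rho> * (B / 2 + v) else B * chi \<rho> + v)" for \<rho> v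
  have chi: "1 / 2 \<le> chi \<rho>" "chi \<rho> \<le> 1" if "1 \<le> K * \<rho>" for \<rho>
  proof -
    have "(1 / (K * \<rho>)) ^ n \<le> 1" "0 \<le> (1 / (K * \<rho>)) ^ n" using that by (auto intro: power_le_one)
    then show "1 / 2 \<le> chi \<rho>" "chi \<rho> \<le> 1" by (auto simp: chi_def)
  qed
  have B0: "0 < B" using B C by linarith
  have bounds: "0 \<le> Z \<rho> v \<and> Z \<rho> v \<le> B + v \<and> Z \<rho> v \<le> K * (B + 1) * \<rho> * v \<and> min 1 \<rho> * v \<le> K * (B + 1) * Z \<rho> v"
    if \<rho>: "0 \<le> \<rho>" and v: "1 \<le> v" for \<rho> v
  proof -
    have KB: "1 \<le> K * (B + 1)" using K B0 by (metis mult_mono mult_1 zero_le_one le_add_same_cancel2 less_imp_le order_trans)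
    have Bv: "B * 1 \<le> B * v" using B0 v by (intro mult_left_mono) auto
    show ?thesis
    proof (cases "K * \<rho> < 1")
      case True
      have Z: "Z \<rho> v = K * \<rho> * (B / 2 + v)" using True by (simp add: Z_def)
      have "K * \<rho> * (B / 2 + v) \<le> 1 * (B / 2 + v)" using True B0 v by (intro mult_right_mono) auto
      then have 1: "Z \<rho> v \<le> B + v" using Z B0 by simp
      have "(K * \<rho>) * (B / 2 + v) \<le> (K * \<rho>) * (B * v + v)" using Bv K \<rho> B0 by (intro mult_left_mono) auto
      then have 2: "Z \<rho> v \<le> K * (B + 1) * \<rho> * v" using Z by (simp add: algebra_simps)
      have "\<rho> * v \<le> (K * \<rho>) * (B / 2 + v)" using K \<rho> v B0 by (intro mult_mono) (auto simp: mult_le_cancel_right1)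
      then have 3: "\<rho> * v \<le> Z \<rho> v" "0 \<le> Z \<rho> v" using Z K \<rho> v B0 by auto
      have "min 1 \<rho> * v \<le> \<rho> * v" using v by (intro mult_right_mono) auto
      also have "\<dots> \<le> 1 * Z \<rho> v" using 3 by simp
      also have "\<dots> \<le> K * (B + 1) * Z \<rho> v" using KB 3 by (intro mult_right_mono)
      finally show ?thesis using 1 2 3 by blast
    next
      case False
      then have k: "1 \<le> K * \<rho>" by simp
      have Z: "Z \<rho> v = B * chi \<rho> + v" using False by (simp add: Z_def)
      have c: "0 \<le> B * chi \<rho>" "B * chi \<rho> \<le> B * 1" using chi[OF k] B0 by (auto intro!: mult_left_mono)
      have "1 * ((B + 1) * v) \<le> K * \<rho> * ((B + 1) * v)" using k v B0 by (intro mult_right_mono) auto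
      then have 2: "Z \<rho> v \<le> K * (B + 1) * \<rho> * v" using Z c Bv by (simp add: algebra_simps)
      have "min 1 \<rho> * v \<le> 1 * v" using v by (intro mult_right_mono) auto
      also have "\<dots> \<le> 1 * Z \<rho> v" using Z c by simp
      also have "\<dots> \<le> K * (B + 1) * Z \<rho> v" using KB Z c v by (intro mult_right_mono) auto
      finally show ?thesis using 2 Z c v by auto
    qed
  qed
  have main: "(\<exists>s\<ge>0. (\<forall>v\<ge>1. Z (\<alpha> * \<rho>) v \<le> s * (B / 2 + v)) \<and>
        (\<forall>v\<ge>1. s * (B / 2 + \<kappa> * v + 4 * C) + \<rho> * C2 * (B + v) \<le> (1 - \<eta>) * Z \<rho> v)) \<or>
      (\<exists>x. 0 \<le> x \<and> x \<le> 1 \<and> (\<forall>v\<ge>1. Z (\<alpha> * \<rho>) v \<le> B * x + v) \<and>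
        (\<forall>v\<ge>1. \<rho> \<le> v \<longrightarrow> B * ((x + \<rho>) / (1 + \<rho>)) + \<kappa> * v + 4 * C \<le> (1 - \<eta>) * Z \<rho> v))"
    if \<rho>: "0 \<le> \<rho>" for \<rho>
  proof (cases "K * \<rho> < 1")
    case True
    have K\<rho>: "0 \<le> K * \<rho>" using K \<rho> by simp
    have "\<alpha> * (K * \<rho>) \<le> 1 * (K * \<rho>)" using al K\<rho> by (intro mult_right_mono) auto
    then have "K * (\<alpha> * \<rho>) < 1" using True by (simp add: mult.left_commute)
    then have Z1: "Z (\<alpha> * \<rho>) v = \<alpha> * (K * \<rho>) * (B / 2 + v)" for v by (simp add: Z_def mult_ac)
    have Z2: "Z \<rho> v = K * \<rho> * (B / 2 + v)" for v using True by (simp add: Z_def)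
    have "\<alpha> * (K * \<rho>) * (B / 2 + \<kappa> * v + 4 * C) + \<rho> * C2 * (B + v) \<le> (1 - \<eta>) * Z \<rho> v" if v: "1 \<le> v" for v
    proof -
      define p q where "p = (1 - \<alpha>) * B" and "q = (1 - \<alpha>) * v"
      have pq: "0 \<le> p" "0 \<le> q" using al B0 v by (auto simp: p_def q_def)
      have "C2 / K * (B + v) \<le> (1 - \<alpha>) / 16 * (B + v)" using K v B0 by (intro mult_right_mono) auto
      then have 1: "C2 / K * (B + v) \<le> p / 16 + q / 16" unfolding p_def q_def by argo
      have "\<kappa> * v \<le> 1 * v" using \<kappa> v by (intro mult_right_mono) auto
      then have "\<alpha> * (B / 2 + \<kappa> * v + 4 * C) \<le> \<alpha> * (B / 2 + v + p / 8)"
        using B1(1) al by (intro mult_left_mono) (auto simp: p_def mult.commute)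
      also have "\<dots> = B / 2 - p / 2 + v - q + \<alpha> * (p / 8)" unfolding p_def q_def by argo
      also have "\<alpha> * (p / 8) \<le> 1 * (p / 8)" using al pq by (intro mult_right_mono) auto
      finally have 2: "\<alpha> * (B / 2 + \<kappa> * v + 4 * C) \<le> B / 2 - p / 2 + v - q + p / 8" by simp
      have "\<eta> * (B / 2 + v) \<le> (1 - \<alpha>) / 2 * (B / 2 + v)" using \<eta>(2) B0 v by (intro mult_right_mono) auto
      also have "\<dots> = p / 4 + q / 2" unfolding p_def q_def by argo
      finally have 3: "\<eta> * (B / 2 + v) \<le> p / 4 + q / 2" .
      have "(1 - \<eta>) * (B / 2 + v) = B / 2 + v - \<eta> * (B / 2 + v)" by (simp only: left_diff_distrib mult_1)
      then have *: "\<alpha> * (B / 2 + \<kappa> * v + 4 * C) + C2 / K * (B + v) \<le> (1 - \<eta>) * (B / 2 + v)"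
        using 1 2 3 pq by linarith
      have "\<alpha> * (K * \<rho>) * (B / 2 + \<kappa> * v + 4 * C) + \<rho> * C2 * (B + v) =
          K * \<rho> * (\<alpha> * (B / 2 + \<kappa> * v + 4 * C) + C2 / K * (B + v))"
        using K by (simp add: field_simps)
      also have "\<dots> \<le> K * \<rho> * ((1 - \<eta>) * (B / 2 + v))" using * K\<rho> by (rule mult_left_mono)
      finally show ?thesis unfolding Z2 by (simp add: mult_ac)
    qed
    then show ?thesis using Z1 al K\<rho> by (intro disjI1 exI[of _ "\<alpha> * (K * \<rho>)"]) auto
  next
    case False
    then have k: "1 \<le> K * \<rho>" by simp
    have Z2: "Z \<rho> v = B * chi \<rho> + v" for v using False by (simp add: Z_def)
    \<comment> \<open>If \<alpha> * \<rho> has entered the linear regime, then t * (B / 2 + v) \<le>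
      B * (t / 2) + v for t = K * \<alpha> * \<rho> < 1.\<close>
    define x where "x = (if K * (\<alpha> * \<rho>) < 1 then K * (\<alpha> * \<rho>) / 2 else chi (\<alpha> * \<rho>))"
    have x: "0 \<le> x" "x \<le> 1"
      using chi[of "\<alpha> * \<rho>"] K al \<rho> by (auto simp: x_def)
    have Z1: "Z (\<alpha> * \<rho>) v \<le> B * x + v" if v: "1 \<le> v" for v
    proof (cases "K * (\<alpha> * \<rho>) < 1")
      case True
      have "K * (\<alpha> * \<rho>) * v \<le> 1 * v" using True v by (intro mult_right_mono) auto
      then show ?thesis using True by (simp add: Z_def x_def algebra_simps)
    qed (simp add: Z_def x_def)
    \<comment> \<open>Average of the value x after a coupled rise and the worst value 1 after
      decoupling, with probabilities 1 / (1 + \<rho>) and \<rho> / (1 + \<rho>).\<close>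
    define y where "y = (x + \<rho>) / (1 + \<rho>)"
    have y: "y \<le> 1" "1 - y = (1 - x) / (1 + \<rho>)" using x \<rho> by (auto simp: y_def field_simps)
    have "B * y + \<kappa> * v + 4 * C \<le> (1 - \<eta>) * Z \<rho> v" if v: "1 \<le> v" "\<rho> \<le> v" for v
    proof (cases "\<rho> \<le> R")
      case False
      then have "(1 - \<kappa>) / 2 * R \<le> (1 - \<kappa>) / 2 * v" using v \<kappa> by (intro mult_left_mono) auto
      then have "5 * C \<le> (1 - \<kappa>) / 2 * v" using R by simp
      moreover have "\<eta> * v \<le> (1 - \<kappa>) / 2 * v" using \<eta> v by (intro mult_right_mono) auto
      moreover have "B * y \<le> B * 1" using y B0 by (intro mult_left_mono) auto
      moreover have "(1 - \<kappa>) / 2 * v + (1 - \<kappa>) / 2 * v = v - \<kappa> * v" by (simp add: field_simps)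
      moreover have "(1 - \<eta>) * Z \<rho> v = B + v - \<eta> * B - \<eta> * v"
        using False by (simp add: Z2 chi_def algebra_simps)
      ultimately show ?thesis using \<eta>B by linarith
    next
      case True
      have "1 / 2 * (1 / (K * \<rho>)) ^ n + \<epsilon> \<le> 1 - y"
      proof (cases "K * (\<alpha> * \<rho>) < 1")
        case True
        define t where "t = K * \<rho>"
        have t: "1 \<le> t" "\<alpha> * t < 1" using k True by (auto simp: t_def mult_ac)
        have x': "1 - x = 1 - \<alpha> * t / 2" using True by (simp add: x_def t_def mult_ac)
        \<comment> \<open>On [1, 1 / \<alpha>] the convex function 1 / t + \<alpha> * t is at most
          its value 1 + \<alpha> at the endpoints. This is the gain at the passage between the two
          branches of Z.\<close>
        have "0 \<le> (t - 1) * (1 - \<alpha> * t)" using t by simp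
        then have "1 / t + \<alpha> * t \<le> 1 + \<alpha>" using t by (simp add: field_simps)
        then have a: "1 / (2 * t) + (1 - \<alpha>) / 2 \<le> 1 - x" unfolding x' by (simp add: field_simps)
        have "\<rho> \<le> 1 / (\<alpha> * K)" using True al K by (simp add: field_simps)
        then have r: "\<rho> \<le> (1 - \<alpha>) / 4" using K by linarith
        have "(1 - x) * (1 - \<rho> * \<rho>) \<le> (1 - x) * 1" using x \<rho> by (intro mult_left_mono) auto
        then have "(1 - x) * (1 - \<rho>) \<le> (1 - x) / (1 + \<rho>)" using \<rho> by (simp add: field_simps)
        moreover have "(1 - x) * (1 - \<rho>) \<ge> (1 - x) - \<rho>"
          using mult_right_mono[of "1 - x" 1 \<rho>] x \<rho> by (simp add: algebra_simps)
        ultimately have "1 / (2 * t) + (1 - \<alpha>) / 4 \<le> 1 - y" using a r y by linarith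
        moreover have "(1 / t) ^ n \<le> (1 / t) ^ 1" using t n by (intro power_decreasing) auto
        then have "1 / 2 * (1 / t) ^ n \<le> 1 / (2 * t)" by simp
        moreover have "\<epsilon> \<le> (1 - \<alpha>) / 4" unfolding \<epsilon>_def by (rule min.cobounded2)
        ultimately show ?thesis unfolding t_def by linarith
      next
        case False
        have "\<alpha> * \<rho> \<le> R" using True al \<rho> by (smt (verit) mult_left_le_one_le)
        then have "1 - x = 1 / 2 * (1 / (K * (\<alpha> * \<rho>))) ^ n" using False by (simp add: x_def chi_def)
        \<comment> \<open>Shrinking \<rho> to \<alpha> * \<rho> enlarges the deficit so much that
          after division by 1 + \<rho> at least twice the old deficit is left; the surplus is at
          least \<epsilon>.\<close>
        also have "\<dots> = 1 / 2 * (1 / (K * \<rho>)) ^ n / \<alpha> ^ n" by (simp add: power_divide power_mult_distrib)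
        also have "\<dots> \<ge> 1 / 2 * (1 / (K * \<rho>)) ^ n * (2 * (1 + R))"
        proof -
          have "2 * (1 + R) \<le> 1 / \<alpha> ^ n" using n al by (simp add: field_simps)
          then have "1 / 2 * (1 / (K * \<rho>)) ^ n * (2 * (1 + R)) \<le> 1 / 2 * (1 / (K * \<rho>)) ^ n * (1 / \<alpha> ^ n)"
            using k by (intro mult_left_mono) auto
          then show ?thesis by simp
        qed
        finally have "(1 / (K * \<rho>)) ^ n * (1 + R) \<le> 1 - x" by argo
        moreover have "(1 / (K * \<rho>)) ^ n * (1 + \<rho>) \<le> (1 / (K * \<rho>)) ^ n * (1 + R)"
          using True k by (intro mult_left_mono) auto
        ultimately have "(1 / (K * \<rho>)) ^ n * (1 + \<rho>) \<le> 1 - x" by linarith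
        then have "(1 / (K * \<rho>)) ^ n \<le> 1 - y" unfolding y using \<rho> by (simp add: pos_le_divide_eq)
        moreover have "0 < \<rho>" using k \<rho> by (cases "\<rho> = 0") auto
        then have "1 / (K * R) \<le> 1 / (K * \<rho>)"
          using True K(1) k KR R(1) by (intro divide_left_mono mult_left_mono mult_pos_pos) auto
        then have "(1 / (K * R)) ^ n \<le> (1 / (K * \<rho>)) ^ n" using KR by (intro power_mono) auto
        moreover have "\<epsilon> \<le> 1 / 2 * (1 / (K * R)) ^ n" unfolding \<epsilon>_def by (rule min.cobounded1)
        ultimately show ?thesis by linarith
      qed
      then have "y \<le> chi \<rho> - \<epsilon>" using True by (simp add: chi_def)
      then have "B * y \<le> B * (chi \<rho> - \<epsilon>)" using B0 by (intro mult_left_mono) auto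
      then have 1: "B * y \<le> B * chi \<rho> - \<epsilon> * B" by (simp add: algebra_simps)
      have "(\<eta> * B) * chi \<rho> \<le> (\<eta> * B) * 1" using chi[OF k] \<eta> B0 by (intro mult_left_mono) auto
      moreover have "\<eta> * v \<le> (1 - \<kappa>) * v" using \<eta> v \<kappa> by (intro mult_right_mono) auto
      moreover have "(1 - \<eta>) * Z \<rho> v = B * chi \<rho> + v - \<eta> * B * chi \<rho> - \<eta> * v"
        by (simp add: Z2 algebra_simps)
      moreover have "(1 - \<kappa>) * v = v - \<kappa> * v" by (simp add: algebra_simps)
      ultimately show ?thesis using 1 \<eta>B B1 by linarith
    qed
    then show ?thesis using Z1 x unfolding y_def by (intro disjI2 exI[of _ x]) auto
  qed
  have \<eta>1: "\<eta> < 1" using \<eta>(2) al by argo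
  have D: "0 \<le> K * (B + 1)" using K B0 by auto
  show ?thesis
    by (rule exI[of _ Z], rule exI[of _ \<eta>], rule exI[of _ B], rule exI[of _ "K * (B + 1)"])
      (use \<eta>(1) \<eta>1 B(2) D bounds main in auto)
qed

section \<open>Pairs of profiles under a Lyapunov function\<close>

locale lyapunov_profile = boundary_profile +
  fixes V :: "nat multiset \<Rightarrow> real" and C \<delta> \<gamma> :: real
  assumes \<delta>0: "0 \<le> \<delta>" and \<gamma>0: "0 \<le> \<gamma>" and \<delta>\<gamma>: "\<delta> + \<gamma> < 1" and C1: "1 \<le> C"
    and V_weight: "\<And>b. state b \<Longrightarrow> weight b \<le> V b"
    and V_low: "\<And>b. state b \<Longrightarrow>
      low_sum V b \<le> (weight b - tops b + \<delta> * tops b) * V b + C * tops b"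
    and V_rise: "\<And>b. state b \<Longrightarrow> V (rise b) \<le> \<gamma> * V b + C"
    and V_ring: "\<And>b i. state b \<Longrightarrow> i \<in># b \<Longrightarrow> 0 < i \<Longrightarrow> V (ring i b) \<le> C * V b"
begin

lemma V_ge_1: "state b \<Longrightarrow> 1 \<le> V b"
  using V_weight weight_ge_1 order_trans by blast

text \<open>Balance of growth inside a level and contraction at its end: \<kappa> * (1 - \<delta>) =
  \<gamma> makes \<kappa> * V + 2 * C a supersolution for the expected value of V after the
  rise.\<close>

definition \<kappa> :: real where "\<kappa> = \<gamma> / (1 - \<delta>)"

lemma \<kappa>: "0 \<le> \<kappa>" "\<kappa> < 1" "\<kappa> * (1 - \<delta>) = \<gamma>"
  using \<delta>0 \<gamma>0 \<delta>\<gamma> by (auto simp: \<kappa>_def field_simps)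

definition expV :: "nat multiset \<Rightarrow> real" where "expV = level_cost (\<lambda>_. 0) V"

lemma expV_eq: "state b \<Longrightarrow> weight b * expV b = low_sum expV b + tops b * V (rise b)"
  unfolding expV_def by (simp add: level_cost_eq)

lemma expV_le: "state b \<Longrightarrow> expV b \<le> \<kappa> * V b + 2 * C"
  unfolding expV_def
proof (rule level_cost_le)
  fix b assume b: "state b"
  have k: "1 \<le> tops b" by (rule tops_ge_1[OF b])
  have "0 + low_sum (\<lambda>b. \<kappa> * V b + 2 * C) b + tops b * V (rise b)
      = \<kappa> * low_sum V b + (weight b - tops b) * (2 * C) + tops b * V (rise b)"
    by (simp add: low_sum_plus low_sum_cmult low_sum_const)
  also have "\<dots> \<le> \<kappa> * ((weight b - tops b + \<delta> * tops b) * V b + C * tops b)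
      + (weight b - tops b) * (2 * C) + tops b * (\<gamma> * V b + C)"
    using V_low[OF b] V_rise[OF b] \<kappa> k by (intro add_mono mult_left_mono order_refl) auto
  also have "\<dots> = weight b * (\<kappa> * V b + 2 * C) + tops b * (\<gamma> - \<kappa> * (1 - \<delta>)) * V b - (1 - \<kappa>) * (C * tops b)"
    by (simp add: algebra_simps)
  also have "\<dots> \<le> weight b * (\<kappa> * V b + 2 * C)" using \<kappa> C1 k by simp
  finally show "0 + low_sum (\<lambda>b. \<kappa> * V b + 2 * C) b + tops b * V (rise b) \<le> weight b * (\<kappa> * V b + 2 * C)" .
qed

lemma expV_ge_1: "state b \<Longrightarrow> 1 \<le> expV b"
  unfolding expV_def using level_cost_mono[of "\<lambda>_. 0" "\<lambda>_. 0" "\<lambda>_. 1" V b] V_ge_1 state_rise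
  by (simp add: level_cost_const)

lemma expV_le_V: "state b \<Longrightarrow> expV b \<le> (1 + 2 * C) * V b"
proof -
  assume b: "state b"
  have "\<kappa> * V b \<le> 1 * V b" "2 * C * 1 \<le> 2 * C * V b"
    using \<kappa> V_ge_1[OF b] C1 by (auto intro: mult_right_mono mult_left_mono)
  then show ?thesis using expV_le[OF b] by (simp add: algebra_simps)
qed

text \<open>A multiple of V + C is a supersolution: its loss at the rise exceeds its drift inside
  the level by a multiple of (1 - \<delta>) * tops b * V b, which pays a cost of order V because
  tops b \<ge> 1.\<close>

lemma level_cost_bound:
  assumes "\<And>b. state b \<Longrightarrow> \<bar>c b\<bar> \<le> a * V b" "state b"
  shows "\<bar>level_cost c (\<lambda>_. 0) b\<bar> \<le> a * ((1 + C) / (1 - \<delta>)) * V b"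
proof -
  have a: "0 \<le> a" using assms V_ge_1[of b] by (smt (verit) mult_neg_pos)
  define A where "A = a / (1 - \<delta>)"
  have A: "0 \<le> A" "A * (1 - \<delta>) = a" using a \<delta>0 \<gamma>0 \<delta>\<gamma> by (auto simp: A_def)
  have super: "c b + low_sum (\<lambda>b. A * (V b + C)) b + tops b * 0 \<le> weight b * (A * (V b + C))"
    if c: "\<And>b. state b \<Longrightarrow> c b \<le> a * V b" and b: "state b" for b c
  proof -
    have k: "1 \<le> tops b" by (rule tops_ge_1[OF b])
    have "c b + low_sum (\<lambda>b. A * (V b + C)) b + tops b * 0 = c b + A * (low_sum V b + (weight b - tops b) * C)"
      by (simp add: low_sum_plus low_sum_cmult low_sum_const)
    also have "\<dots> \<le> a * V b + A * (((weight b - tops b + \<delta> * tops b) * V b + C * tops b) + (weight b - tops b) * C)"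
      using A V_low[OF b] c[OF b] by (intro add_mono mult_left_mono order_refl) auto
    also have "\<dots> = a * V b - (A * (1 - \<delta>)) * (tops b * V b) + weight b * (A * (V b + C))" by (simp add: algebra_simps)
    also have "\<dots> \<le> weight b * (A * (V b + C))"
    proof -
      have "1 * V b \<le> tops b * V b" using k V_ge_1[OF b] by (intro mult_right_mono) auto
      then have "a * V b \<le> a * (tops b * V b)" using a by (intro mult_left_mono) auto
      then show ?thesis unfolding A by simp
    qed
    finally show ?thesis .
  qed
  have "level_cost c (\<lambda>_. 0) b \<le> A * (V b + C)"
    using super[of c] assms by (intro level_cost_le) fastforce+
  moreover have "level_cost (\<lambda>b. - 1 * c b) (\<lambda>b. - 1 * 0) b \<le> A * (V b + C)"
    using super[of "\<lambda>b. - 1 * c b"] assms by (intro level_cost_le) fastforce+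
  then have "- level_cost c (\<lambda>_. 0) b \<le> A * (V b + C)"
    unfolding level_cost_cmult[OF assms(2)] by simp
  moreover have "A * (V b + C) \<le> A * ((1 + C) * V b)"
    using A mult_left_mono[of 1 "V b" C] C1 V_ge_1[OF assms(2)] by (intro mult_left_mono) (auto simp: algebra_simps)
  ultimately show ?thesis by (simp add: A_def abs_le_iff mult.assoc)
qed

definition pairV :: "nat multiset \<Rightarrow> nat multiset \<Rightarrow> nat multiset \<Rightarrow> real" where
  "pairV r r' m = V (m + r) + V (m + r')"

lemma pairV_ge:
  assumes "state m"
  shows "1 \<le> pairV r r' m" "weight r + weight r' \<le> pairV r r' m"
proof -
  show "1 \<le> pairV r r' m"
    using V_ge_1[OF state_add[OF assms], of r] V_ge_1[OF state_add[OF assms], of r'] by (simp add: pairV_def)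
  show "weight r + weight r' \<le> pairV r r' m"
    using V_weight[OF state_add[OF assms], of r] V_weight[OF state_add[OF assms], of r'] weight_nonneg[of m]
    by (simp add: pairV_def)
qed

text \<open>The second term on the left is what a supersolution of the form B + \<open>pairV\<close>
  can spend on decoupling. It comes from the tops, whose value after the rise is left out here; B
  \<ge> 4 * C keeps half of B after the additive constants of the two drifts.\<close>

lemma pair_drift:
  assumes r: "0 \<notin># r" "0 \<notin># r'" and m: "state m" and B: "4 * C \<le> B"
  shows "low_sum (\<lambda>m. B + pairV r r' m) m + (1 - \<delta>) * (B / 2 + pairV r r' m)
    \<le> (weight m + weight r + weight r') * (B + pairV r r' m)"
proof -
  have k: "1 \<le> tops m" by (rule tops_ge_1[OF m])
  have one: "low_sum (\<lambda>m. V (m + r)) m \<le> (weight m + weight r - (1 - \<delta>) * tops m) * V (m + r) + C * tops m"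
    if "0 \<notin># r" for r
  proof -
    have "0 \<le> (\<Sum>i\<in>#r. \<alpha> ^ i * V (m + ring i r))"
      using wsum_mono[of r "\<lambda>_. 0" "\<lambda>i. V (m + ring i r)"] V_ge_1[OF state_add[OF m]]
      by (simp add: order_trans[OF zero_le_one])
    then have "low_sum (\<lambda>m. V (m + r)) m \<le> low_sum V (m + r)"
      unfolding low_sum_add[OF that] by (simp add: low_sum_def)
    also have "\<dots> \<le> (weight m + weight r - (1 - \<delta>) * tops m) * V (m + r) + C * tops m"
      using V_low[OF state_add[OF m], of r] by (simp add: tops_add[OF that] algebra_simps)
    finally show ?thesis .
  qed
  let ?N = "weight m + weight r + weight r'" and ?v = "pairV r r' m"
  have pos: "0 \<le> weight r' * V (m + r)" "0 \<le> weight r * V (m + r')" "0 \<le> (weight r + weight r') * B"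
    using weight_nonneg order_trans[OF zero_le_one V_ge_1[OF state_add[OF m]]] B C1
    by (auto intro!: mult_nonneg_nonneg add_nonneg_nonneg)
  have "low_sum (\<lambda>m. B + pairV r r' m) m
      = (weight m - tops m) * B + (low_sum (\<lambda>m. V (m + r)) m + low_sum (\<lambda>m. V (m + r')) m)"
    unfolding pairV_def by (simp add: low_sum_plus low_sum_const)
  also have "\<dots> \<le> (weight m - tops m) * B + (((weight m + weight r - (1 - \<delta>) * tops m) * V (m + r) + C * tops m)
      + ((weight m + weight r' - (1 - \<delta>) * tops m) * V (m + r') + C * tops m))"
    using one r by (intro add_mono order_refl) auto
  also have "\<dots> \<le> ?N * (B + ?v) - tops m * (B - 2 * C) - tops m * ((1 - \<delta>) * ?v)"
    using pos by (simp add: pairV_def algebra_simps)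
  also have "\<dots> \<le> ?N * (B + ?v) - 1 * (B - 2 * C) - 1 * ((1 - \<delta>) * ?v)"
    using k B C1 \<delta>\<gamma> \<gamma>0 pairV_ge(1)[OF m, of r r']
    by (intro diff_mono mult_right_mono order_refl mult_nonneg_nonneg) auto
  finally have "low_sum (\<lambda>m. B + pairV r r' m) m \<le> ?N * (B + ?v) - (B - 2 * C) - (1 - \<delta>) * ?v" by simp
  moreover have "(1 - \<delta>) * (B / 2) \<le> 1 * (B / 2)" using \<delta>0 B C1 by (intro mult_right_mono) auto
  moreover have "(1 - \<delta>) * (B / 2 + ?v) = (1 - \<delta>) * (B / 2) + (1 - \<delta>) * ?v" by (rule distrib_left)
  ultimately show ?thesis using B by linarith
qed

text \<open>A ring in r or r' ends the coupling. From then on the crude bound assumed for \<Phi> is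
  used, and a single ring increases V by at most the factor C.\<close>

lemma ring_terms:
  assumes r: "0 \<notin># r" "0 \<notin># r'" and m: "state m" and a: "0 \<le> a" "0 \<le> e"
    and \<Phi>: "\<And>b b'. state b \<Longrightarrow> state b' \<Longrightarrow> \<bar>\<Phi> b - \<Phi> b'\<bar> \<le> e + a * (V b + V b')"
  shows "(\<Sum>i\<in>#r. \<alpha> ^ i * \<bar>\<Phi> (m + ring i r) - \<Phi> (m + r')\<bar>)
       + (\<Sum>i\<in>#r'. \<alpha> ^ i * \<bar>\<Phi> (m + r) - \<Phi> (m + ring i r')\<bar>)
     \<le> (weight r + weight r') * (e + a * C * pairV r r' m)"
proof -
  have V_le: "V b \<le> C * V b" if "state b" for b
    using mult_right_mono[OF C1, of "V b"] V_ge_1[OF that] by simp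
  have ring: "V (m + ring i r) \<le> C * V (m + r)" if "i \<in># r" "0 \<notin># r" for i r
  proof -
    have "0 < i" using that by (cases i) auto
    then show ?thesis using V_ring[OF state_add[OF m], of i r] that(1) by (simp add: ring_add_right)
  qed
  have "(\<Sum>i\<in>#r. \<alpha> ^ i * \<bar>\<Phi> (m + ring i r) - \<Phi> (m + r')\<bar>) \<le> (\<Sum>i\<in>#r. \<alpha> ^ i * (e + a * C * pairV r r' m))"
  proof (rule wsum_mono)
    fix i assume i: "i \<in># r"
    have "\<bar>\<Phi> (m + ring i r) - \<Phi> (m + r')\<bar> \<le> e + a * (V (m + ring i r) + V (m + r'))"
      using m by (intro \<Phi> state_add)
    also have "\<dots> \<le> e + a * (C * V (m + r) + C * V (m + r'))"
      using ring[OF i r(1)] V_le[OF state_add[OF m], of r'] a by (intro add_mono mult_left_mono order_refl) auto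
    finally show "\<bar>\<Phi> (m + ring i r) - \<Phi> (m + r')\<bar> \<le> e + a * C * pairV r r' m"
      by (simp add: pairV_def algebra_simps)
  qed
  moreover have "(\<Sum>i\<in>#r'. \<alpha> ^ i * \<bar>\<Phi> (m + r) - \<Phi> (m + ring i r')\<bar>) \<le> (\<Sum>i\<in>#r'. \<alpha> ^ i * (e + a * C * pairV r r' m))"
  proof (rule wsum_mono)
    fix i assume i: "i \<in># r'"
    have "\<bar>\<Phi> (m + r) - \<Phi> (m + ring i r')\<bar> \<le> e + a * (V (m + r) + V (m + ring i r'))"
      using m by (intro \<Phi> state_add)
    also have "\<dots> \<le> e + a * (C * V (m + r) + C * V (m + r'))"
      using ring[OF i r(2)] V_le[OF state_add[OF m], of r] a by (intro add_mono mult_left_mono order_refl) auto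
    finally show "\<bar>\<Phi> (m + r) - \<Phi> (m + ring i r')\<bar> \<le> e + a * C * pairV r r' m"
      by (simp add: pairV_def algebra_simps)
  qed
  ultimately show ?thesis unfolding wsum_const by (simp add: distrib_right)
qed

text \<open>While the copies are coupled their costs differ by order \<rho> = weight r + weight r',
  and they decouple at rate \<rho>. As \<rho> is constant in between, a supersolution proportional
  to it works.\<close>

lemma level_cost_lipschitz:
  assumes c: "\<And>b. state b \<Longrightarrow> \<bar>c b\<bar> \<le> a * V b"
    and c': "\<And>m r r'. state m \<Longrightarrow> 0 \<notin># r \<Longrightarrow> 0 \<notin># r' \<Longrightarrow>
      \<bar>c (m + r) - c (m + r')\<bar> \<le> a * (weight r + weight r') * pairV r r' m"
  obtains D where "0 \<le> D" "\<And>m r r'. state m \<Longrightarrow> 0 \<notin># r \<Longrightarrow> 0 \<notin># r' \<Longrightarrow>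
      \<bar>level_cost c (\<lambda>_. 0) (m + r) - level_cost c (\<lambda>_. 0) (m + r')\<bar>
        \<le> D * ((weight r + weight r') * pairV r r' m)"
proof -
  let ?F = "level_cost c (\<lambda>_. 0)"
  have a: "0 \<le> a" using c[OF state_replicate] V_ge_1[OF state_replicate] by (smt (verit) mult_neg_pos)
  have \<delta>: "0 < 1 - \<delta>" using \<delta>\<gamma> \<gamma>0 by simp
  define c1 where "c1 = a * ((1 + C) / (1 - \<delta>))"
  have c1: "0 \<le> c1" using a C1 \<delta> by (simp add: c1_def)
  \<comment> \<open>What \<open>pair_drift\<close> has to pay: a for the running difference of the
    costs, c1 * C for the crude comparison after decoupling.\<close>
  define A where "A = (a + c1 * C) / (1 - \<delta>)"
  have A: "0 \<le> A" "A * (1 - \<delta>) = a + c1 * C" using a c1 C1 \<delta> by (auto simp: A_def)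
  show thesis
  proof (rule that[of "A * (4 * C + 1)"])
    show "0 \<le> A * (4 * C + 1)" using A C1 by simp
    fix m and r r' :: "nat multiset" assume m: "state m" and r: "0 \<notin># r" "0 \<notin># r'"
    let ?\<rho> = "weight r + weight r'"
    have \<rho>: "0 \<le> ?\<rho>" by (simp add: weight_nonneg)
    have "\<bar>?F (m + r) - ?F (m + r')\<bar> \<le> ?\<rho> * A * (4 * C + pairV r r' m)"
    proof (rule coupling[OF r m, where c = c and g = "\<lambda>_. 0"])
      fix m assume m: "state m"
      let ?v = "pairV r r' m"
      have v: "1 \<le> ?v" by (rule pairV_ge(1)[OF m])
      have rings: "(\<Sum>i\<in>#r. \<alpha> ^ i * \<bar>?F (m + ring i r) - ?F (m + r')\<bar>)
         + (\<Sum>i\<in>#r'. \<alpha> ^ i * \<bar>?F (m + r) - ?F (m + ring i r')\<bar>) \<le> ?\<rho> * (0 + c1 * C * ?v)"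
      proof (rule ring_terms[OF r m c1])
        fix b b' assume "state b" "state b'"
        then show "\<bar>?F b - ?F b'\<bar> \<le> 0 + c1 * (V b + V b')"
          using level_cost_bound[OF c, of b] level_cost_bound[OF c, of b']
          unfolding c1_def[symmetric] by (simp add: distrib_left)
      qed simp
      have "low_sum (\<lambda>m. ?\<rho> * A * (4 * C + pairV r r' m)) m
          + tops m * \<bar>0 - 0\<bar> + \<bar>c (m + r) - c (m + r')\<bar>
          + ((\<Sum>i\<in>#r. \<alpha> ^ i * \<bar>?F (m + ring i r) - ?F (m + r')\<bar>)
         + (\<Sum>i\<in>#r'. \<alpha> ^ i * \<bar>?F (m + r) - ?F (m + ring i r')\<bar>))
        \<le> ?\<rho> * A * low_sum (\<lambda>m. 4 * C + pairV r r' m) m + a * ?\<rho> * ?v + ?\<rho> * (0 + c1 * C * ?v)"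
        unfolding low_sum_cmult using c'[OF m r] rings by simp
      also have "\<dots> \<le> ?\<rho> * A * low_sum (\<lambda>m. 4 * C + pairV r r' m) m + ?\<rho> * A * ((1 - \<delta>) * (4 * C / 2 + ?v))"
      proof -
        have "(a + c1 * C) * ?v \<le> A * (1 - \<delta>) * (4 * C / 2 + ?v)" unfolding A using a c1 C1 by (intro mult_left_mono) auto
        from mult_left_mono[OF this \<rho>] show ?thesis by (simp add: algebra_simps)
      qed
      also have "\<dots> = ?\<rho> * A * (low_sum (\<lambda>m. 4 * C + pairV r r' m) m + (1 - \<delta>) * (4 * C / 2 + ?v))"
        by (rule distrib_left[symmetric])
      also have "\<dots> \<le> ?\<rho> * A * ((weight m + weight r + weight r') * (4 * C + ?v))"
        using pair_drift[OF r m order_refl] \<rho> A(1) by (intro mult_left_mono mult_nonneg_nonneg)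
      finally show "low_sum (\<lambda>m. ?\<rho> * A * (4 * C + pairV r r' m)) m
          + tops m * \<bar>0 - 0\<bar> + \<bar>c (m + r) - c (m + r')\<bar>
          + ((\<Sum>i\<in>#r. \<alpha> ^ i * \<bar>?F (m + ring i r) - ?F (m + r')\<bar>)
         + (\<Sum>i\<in>#r'. \<alpha> ^ i * \<bar>?F (m + r) - ?F (m + ring i r')\<bar>))
         \<le> (weight m + weight r + weight r') * (?\<rho> * A * (4 * C + ?v))" by (simp add: mult_ac)
    qed (rule level_cost_eq)
    also have "\<dots> \<le> ?\<rho> * A * ((4 * C + 1) * pairV r r' m)"
      using \<rho> A C1 pairV_ge(1)[OF m, of r r'] mult_left_mono[of 1 "pairV r r' m" "4 * C"]
      by (intro mult_left_mono mult_nonneg_nonneg[OF \<rho> A(1)]) (auto simp: distrib_right)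
    finally show "\<bar>?F (m + r) - ?F (m + r')\<bar> \<le> A * (4 * C + 1) * (?\<rho> * pairV r r' m)"
      by (simp add: mult_ac)
  qed
qed

text \<open>With zero running cost \<open>level_cost\<close> is an average over the profile after
  the rise. Averaging the hypothesis turns V into \<open>expV\<close>.\<close>

lemma level_cost_center:
  assumes z: "\<And>b. \<bar>g (rise b) - z\<bar> \<le> A * (x + V (rise b))" and b: "state b"
  shows "\<bar>level_cost (\<lambda>_. 0) g b - z\<bar> \<le> A * (x + expV b)"
proof -
  have e: "level_cost (\<lambda>_. 0) (\<lambda>b. A * (x + V b)) b = A * (x + expV b)"
  proof (rule level_cost_unique[OF _ b])
    fix b assume b: "state b"
    have "weight b * (A * (x + expV b)) = A * (weight b * x + weight b * expV b)"
      by (simp add: algebra_simps)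
    then show "weight b * (A * (x + expV b)) =
        0 + low_sum (\<lambda>b. A * (x + expV b)) b + tops b * (A * (x + V (rise b)))"
      unfolding expV_eq[OF b] low_sum_cmult low_sum_plus low_sum_const by (simp add: algebra_simps)
  qed
  have "level_cost (\<lambda>b. 0 - 0) (\<lambda>b. g b - z) b \<le> level_cost (\<lambda>_. 0) (\<lambda>b. A * (x + V b)) b"
    using z by (intro level_cost_mono b) (auto simp: abs_le_iff)
  moreover have "level_cost (\<lambda>b. 0 - 0) (\<lambda>b. z - g b) b \<le> level_cost (\<lambda>_. 0) (\<lambda>b. A * (x + V b)) b"
    using z by (intro level_cost_mono b) (auto simp: abs_le_iff)
  ultimately show ?thesis
    unfolding level_cost_diff[OF b] level_cost_const[OF b] e by (simp add: abs_le_iff)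
qed

text \<open>The splitting into m, r and r' is arbitrary, so a best matching of two profiles is never
  chosen. The coupling keeps a given splitting until an element of r or r' rings.\<close>

definition dist_lipschitz :: "(real \<Rightarrow> real \<Rightarrow> real) \<Rightarrow> (nat multiset \<Rightarrow> real) \<Rightarrow> real \<Rightarrow> bool" where
  "dist_lipschitz Z g A \<longleftrightarrow> (\<forall>m r r'. state m \<longrightarrow> 0 \<notin># r \<longrightarrow> 0 \<notin># r' \<longrightarrow>
     \<bar>g (m + r) - g (m + r')\<bar> \<le> A * Z (weight r + weight r') (pairV r r' m))"

lemma level_contraction:
  obtains Z \<eta> B D where "0 < \<eta>" "\<eta> < 1" "0 \<le> B" "0 \<le> D"
    "\<And>\<rho> v. 0 \<le> \<rho> \<Longrightarrow> 1 \<le> v \<Longrightarrow> 0 \<le> Z \<rho> v"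
    "\<And>\<rho> v. 0 \<le> \<rho> \<Longrightarrow> 1 \<le> v \<Longrightarrow> Z \<rho> v \<le> B + v"
    "\<And>\<rho> v. 0 \<le> \<rho> \<Longrightarrow> 1 \<le> v \<Longrightarrow> Z \<rho> v \<le> D * \<rho> * v"
    "\<And>\<rho> v. 0 \<le> \<rho> \<Longrightarrow> 1 \<le> v \<Longrightarrow> min 1 \<rho> * v \<le> D * Z \<rho> v"
    "\<And>g A. 0 \<le> A \<Longrightarrow> dist_lipschitz Z g A \<Longrightarrow> dist_lipschitz Z (level_cost (\<lambda>_. 0) g) ((1 - \<eta>) * A)"
proof -
  have \<delta>: "0 < 1 - \<delta>" using \<delta>\<gamma> \<gamma>0 by simp
  define C2 where "C2 = 2 * (1 + 2 * C) * C / (1 - \<delta>)"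
  have C2: "0 \<le> C2" "C2 * (1 - \<delta>) = 2 * (1 + 2 * C) * C" using \<delta> C1 by (auto simp: C2_def)
  obtain Z \<eta> B D where \<eta>: "0 < \<eta>" "\<eta> < 1" and B: "4 * C \<le> B" and D: "0 \<le> D"
    and Z: "\<And>\<rho> v. 0 \<le> \<rho> \<Longrightarrow> 1 \<le> v \<Longrightarrow> 0 \<le> Z \<rho> v \<and> Z \<rho> v \<le> B + v \<and> Z \<rho> v \<le> D * \<rho> * v \<and> min 1 \<rho> * v \<le> D * Z \<rho> v"
    and step: "\<And>\<rho>. 0 \<le> \<rho> \<Longrightarrow>
      (\<exists>s\<ge>0. (\<forall>v\<ge>1. Z (\<alpha> * \<rho>) v \<le> s * (B / 2 + v)) \<and>
        (\<forall>v\<ge>1. s * (B / 2 + \<kappa> * v + 4 * C) + \<rho> * C2 * (B + v) \<le> (1 - \<eta>) * Z \<rho> v)) \<or>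
      (\<exists>x. 0 \<le> x \<and> x \<le> 1 \<and> (\<forall>v\<ge>1. Z (\<alpha> * \<rho>) v \<le> B * x + v) \<and>
        (\<forall>v\<ge>1. \<rho> \<le> v \<longrightarrow> B * ((x + \<rho>) / (1 + \<rho>)) + \<kappa> * v + 4 * C \<le> (1 - \<eta>) * Z \<rho> v))"
    using contraction_weight_exists[OF al0 al1 C1 \<kappa>(1,2) C2(1)] by blast
  have B0: "0 \<le> B" using B C1 by simp
  have contr: "dist_lipschitz Z (level_cost (\<lambda>_. 0) g) ((1 - \<eta>) * A)"
    if A: "0 \<le> A" and g: "dist_lipschitz Z g A" for g A
  proof -
    let ?\<Phi> = "level_cost (\<lambda>_. 0) g"
    \<comment> \<open>After a rise any two profiles share d tops, so they are comparable with common
      part \<open>replicate_mset d 0\<close>.\<close>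
    have rise_pair: "\<exists>q q'. rise b = replicate_mset d 0 + q \<and> rise b' = replicate_mset d 0 + q' \<and> 0 \<notin># q \<and> 0 \<notin># q'" for b b'
      unfolding rise_def by (intro exI[of _ "image_mset Suc (b - {#0#})"] exI[of _ "image_mset Suc (b' - {#0#})"]) auto
    have far: "\<bar>g (rise b) - g (rise b')\<bar> \<le> A * (B + V (rise b) + V (rise b'))" for b b'
    proof -
      obtain q q' where q: "rise b = replicate_mset d 0 + q" "rise b' = replicate_mset d 0 + q'" "0 \<notin># q" "0 \<notin># q'"
        using rise_pair by blast
      let ?v = "pairV q q' (replicate_mset d 0)"
      have "\<bar>g (rise b) - g (rise b')\<bar> \<le> A * Z (weight q + weight q') ?v"
        using g q state_replicate unfolding dist_lipschitz_def by metis
      also have "\<dots> \<le> A * (B + ?v)"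
        using Z[of "weight q + weight q'" ?v] weight_nonneg[of q] weight_nonneg[of q'] A
          pairV_ge(1)[OF state_replicate, of q q'] by (intro mult_left_mono) auto
      finally show ?thesis using q by (simp add: pairV_def add.assoc)
    qed
    \<comment> \<open>By \<open>far\<close> every lower bound g - A * (B / 2 + V) lies below every
      upper bound, so one constant fits between them. Measuring both copies from this constant
      compares them after decoupling without any joint process.\<close>
    define z where "z = (SUP b. g (rise b) - A * (B / 2 + V (rise b)))"
    have z: "\<bar>g (rise b) - z\<bar> \<le> A * (B / 2 + V (rise b))" for b
    proof -
      have up: "g (rise b) - A * (B / 2 + V (rise b)) \<le> g (rise b') + A * (B / 2 + V (rise b'))" for b b'
        using far[of b b'] by (simp add: algebra_simps)
      have "z \<le> g (rise b) + A * (B / 2 + V (rise b))"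
        unfolding z_def by (rule cSUP_least) (auto intro: up)
      moreover have "g (rise b) - A * (B / 2 + V (rise b)) \<le> z"
        unfolding z_def by (rule cSUP_upper) (auto intro!: bdd_aboveI2 up)
      ultimately show ?thesis by (simp add: abs_le_iff)
    qed
    have center: "\<bar>?\<Phi> b - z\<bar> \<le> A * (B / 2 + expV b)" if "state b" for b
      using level_cost_center[OF z that] .
    have mid: "\<bar>?\<Phi> b - ?\<Phi> b'\<bar> \<le> A * (B + expV b + expV b')" if "state b" "state b'" for b b'
      using center[OF that(1)] center[OF that(2)] by (simp add: algebra_simps abs_le_iff)
    show ?thesis unfolding dist_lipschitz_def
    proof (intro allI impI)
      fix m and r r' :: "nat multiset" assume m: "state m" and r: "0 \<notin># r" "0 \<notin># r'"
      let ?\<rho> = "weight r + weight r'"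
      have \<rho>: "0 \<le> ?\<rho>" by (simp add: weight_nonneg)
      define E where "E m = expV (m + r) + expV (m + r')" for m
      \<comment> \<open>The coupling neither helps nor harms V: the sum of the two expected values
        obeys the coupled equation exactly, decoupling included. So only the part with B has to
        profit from staying coupled.\<close>
      have E_eq: "low_sum E m + tops m * pairV (image_mset Suc r) (image_mset Suc r') (rise m)
          + ((\<Sum>i\<in>#r. \<alpha> ^ i * (expV (m + ring i r) + expV (m + r')))
             + (\<Sum>i\<in>#r'. \<alpha> ^ i * (expV (m + r) + expV (m + ring i r'))))
          = (weight m + weight r + weight r') * E m" if m: "state m" for m
      proof -
        have "(weight m + weight r) * expV (m + r) = (\<Sum>i\<in>#lower m. \<alpha> ^ i * expV (ring i m + r))
            + (\<Sum>i\<in>#r. \<alpha> ^ i * expV (m + ring i r)) + tops m * V (rise m + image_mset Suc r)"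
          using expV_eq[OF state_add[OF m], of r] r state_0[OF m] by (simp add: low_sum_add tops_add rise_add)
        moreover have "(weight m + weight r') * expV (m + r') = (\<Sum>i\<in>#lower m. \<alpha> ^ i * expV (ring i m + r'))
            + (\<Sum>i\<in>#r'. \<alpha> ^ i * expV (m + ring i r')) + tops m * V (rise m + image_mset Suc r')"
          using expV_eq[OF state_add[OF m], of r'] r state_0[OF m] by (simp add: low_sum_add tops_add rise_add)
        ultimately show ?thesis unfolding E_def low_sum_def wsum_add wsum_const pairV_def by argo
      qed
      have E_le: "E m \<le> \<kappa> * pairV r r' m + 4 * C" if "state m" for m
        using expV_le[OF state_add[OF that], of r] expV_le[OF state_add[OF that], of r']
        by (simp add: E_def pairV_def algebra_simps)
      have rise_bound: "\<bar>g (rise m + image_mset Suc r) - g (rise m + image_mset Suc r')\<bar>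
          \<le> A * Z (\<alpha> * ?\<rho>) (pairV (image_mset Suc r) (image_mset Suc r') (rise m))" for m
      proof -
        have "0 \<notin># image_mset Suc r" "0 \<notin># image_mset Suc r'" by auto
        then have "\<bar>g (rise m + image_mset Suc r) - g (rise m + image_mset Suc r')\<bar>
            \<le> A * Z (weight (image_mset Suc r) + weight (image_mset Suc r'))
              (pairV (image_mset Suc r) (image_mset Suc r') (rise m))"
          using g state_rise[of m] unfolding dist_lipschitz_def by blast
        then show ?thesis by (simp add: weight_image_Suc distrib_left)
      qed
      have v': "1 \<le> pairV (image_mset Suc r) (image_mset Suc r') (rise m)" for m
        by (rule pairV_ge(1)[OF state_rise])
      have ringE: "(\<Sum>i\<in>#r. \<alpha> ^ i * \<bar>?\<Phi> (m + ring i r) - ?\<Phi> (m + r')\<bar>)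
             + (\<Sum>i\<in>#r'. \<alpha> ^ i * \<bar>?\<Phi> (m + r) - ?\<Phi> (m + ring i r')\<bar>)
          \<le> A * (?\<rho> * B + ((\<Sum>i\<in>#r. \<alpha> ^ i * (expV (m + ring i r) + expV (m + r')))
             + (\<Sum>i\<in>#r'. \<alpha> ^ i * (expV (m + r) + expV (m + ring i r')))))" if m: "state m" for m
      proof -
        have "(\<Sum>i\<in>#r. \<alpha> ^ i * \<bar>?\<Phi> (m + ring i r) - ?\<Phi> (m + r')\<bar>)
             + (\<Sum>i\<in>#r'. \<alpha> ^ i * \<bar>?\<Phi> (m + r) - ?\<Phi> (m + ring i r')\<bar>)
          \<le> (\<Sum>i\<in>#r. \<alpha> ^ i * (A * (B + (expV (m + ring i r) + expV (m + r')))))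
             + (\<Sum>i\<in>#r'. \<alpha> ^ i * (A * (B + (expV (m + r) + expV (m + ring i r')))))"
          using mid[OF state_add[OF m] state_add[OF m]] by (intro add_mono wsum_mono) (auto simp: add.assoc)
        also have "\<dots> = A * ((weight r * B + (\<Sum>i\<in>#r. \<alpha> ^ i * (expV (m + ring i r) + expV (m + r'))))
             + (weight r' * B + (\<Sum>i\<in>#r'. \<alpha> ^ i * (expV (m + r) + expV (m + ring i r')))))"
          unfolding wsum_cmult wsum_add wsum_const by (simp only: distrib_left)
        finally show ?thesis by (simp add: algebra_simps)
      qed
      consider (S) s where "0 \<le> s" "\<And>v. 1 \<le> v \<Longrightarrow> Z (\<alpha> * ?\<rho>) v \<le> s * (B / 2 + v)"
          "\<And>v. 1 \<le> v \<Longrightarrow> s * (B / 2 + \<kappa> * v + 4 * C) + ?\<rho> * C2 * (B + v) \<le> (1 - \<eta>) * Z ?\<rho> v"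
        | (L) x where "0 \<le> x" "x \<le> 1" "\<And>v. 1 \<le> v \<Longrightarrow> Z (\<alpha> * ?\<rho>) v \<le> B * x + v"
          "\<And>v. 1 \<le> v \<Longrightarrow> ?\<rho> \<le> v \<Longrightarrow> B * ((x + ?\<rho>) / (1 + ?\<rho>)) + \<kappa> * v + 4 * C \<le> (1 - \<eta>) * Z ?\<rho> v"
        using step[OF \<rho>] by blast
      then show "\<bar>?\<Phi> (m + r) - ?\<Phi> (m + r')\<bar> \<le> (1 - \<eta>) * A * Z ?\<rho> (pairV r r' m)"
      proof cases
        case L
        \<comment> \<open>Chosen for a single top, where (1 + ?\<rho>) * y = x + ?\<rho> balances
          the rise against decoupling at rate ?\<rho>. More tops only help, as x \<le> y.\<close>
        define y where "y = (x + ?\<rho>) / (1 + ?\<rho>)"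
        have y: "x \<le> y" "(1 + ?\<rho>) * y = x + ?\<rho>"
        proof -
          have "x * ?\<rho> \<le> 1 * ?\<rho>" using L(2) \<rho> by (intro mult_right_mono)
          then show "x \<le> y" "(1 + ?\<rho>) * y = x + ?\<rho>" using \<rho> by (auto simp: y_def field_simps)
        qed
        have "\<bar>?\<Phi> (m + r) - ?\<Phi> (m + r')\<bar> \<le> A * (B * y + E m)"
        proof (rule coupling[OF r m, where c = "\<lambda>_. 0" and g = g])
          fix m assume m: "state m"
          have k: "1 \<le> tops m" by (rule tops_ge_1[OF m])
          let ?R = "(\<Sum>i\<in>#r. \<alpha> ^ i * (expV (m + ring i r) + expV (m + r')))
             + (\<Sum>i\<in>#r'. \<alpha> ^ i * (expV (m + r) + expV (m + ring i r')))"
          let ?v' = "pairV (image_mset Suc r) (image_mset Suc r') (rise m)"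
          have "low_sum (\<lambda>m. A * (B * y + E m)) m = A * ((weight m - tops m) * (B * y) + low_sum E m)"
            unfolding low_sum_cmult low_sum_plus low_sum_const by (simp add: mult.left_commute)
          moreover have "tops m * \<bar>g (rise m + image_mset Suc r) - g (rise m + image_mset Suc r')\<bar>
              \<le> tops m * (A * (B * x + ?v'))"
            using rise_bound[of m] mult_left_mono[OF L(3)[OF v'[of m]] A] k by (intro mult_left_mono) linarith+
          ultimately have "low_sum (\<lambda>m. A * (B * y + E m)) m
              + tops m * \<bar>g (rise m + image_mset Suc r) - g (rise m + image_mset Suc r')\<bar> + \<bar>0 - 0\<bar>
              + ((\<Sum>i\<in>#r. \<alpha> ^ i * \<bar>?\<Phi> (m + ring i r) - ?\<Phi> (m + r')\<bar>)
             + (\<Sum>i\<in>#r'. \<alpha> ^ i * \<bar>?\<Phi> (m + r) - ?\<Phi> (m + ring i r')\<bar>))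
             \<le> A * ((weight m - tops m) * (B * y) + low_sum E m) + tops m * (A * (B * x + ?v')) + A * (?\<rho> * B + ?R)"
            using ringE[OF m] by simp
          also have "\<dots> = A * B * ((weight m - tops m) * y + tops m * x + ?\<rho>) + A * (low_sum E m + tops m * ?v' + ?R)"
            by (simp add: algebra_simps)
          also have "low_sum E m + tops m * ?v' + ?R = (weight m + weight r + weight r') * E m"
            by (rule E_eq[OF m])
          also have "(weight m - tops m) * y + tops m * x + ?\<rho> \<le> (weight m + ?\<rho>) * y"
          proof -
            have "0 \<le> (tops m - 1) * (y - x)" using k y by simp
            then show ?thesis using y(2) by (simp add: algebra_simps)
          qed
          then have "A * B * ((weight m - tops m) * y + tops m * x + ?\<rho>) \<le> A * B * ((weight m + ?\<rho>) * y)"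
            using A B0 by (intro mult_left_mono) auto
          finally show "low_sum (\<lambda>m. A * (B * y + E m)) m
              + tops m * \<bar>g (rise m + image_mset Suc r) - g (rise m + image_mset Suc r')\<bar> + \<bar>0 - 0\<bar>
              + ((\<Sum>i\<in>#r. \<alpha> ^ i * \<bar>?\<Phi> (m + ring i r) - ?\<Phi> (m + r')\<bar>)
             + (\<Sum>i\<in>#r'. \<alpha> ^ i * \<bar>?\<Phi> (m + r) - ?\<Phi> (m + ring i r')\<bar>))
             \<le> (weight m + weight r + weight r') * (A * (B * y + E m))" by (simp add: algebra_simps)
        qed (rule level_cost_eq)
        also have "\<dots> \<le> A * (B * y + (\<kappa> * pairV r r' m + 4 * C))"
          using A E_le[OF m] by (intro mult_left_mono add_left_mono)
        also have "\<dots> \<le> A * ((1 - \<eta>) * Z ?\<rho> (pairV r r' m))"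
          using A L(4)[OF pairV_ge[OF m]] unfolding y_def by (intro mult_left_mono) auto
        finally show ?thesis by (simp add: mult_ac)
      next
        case S
        \<comment> \<open>The first summand is the value on remaining coupled, the second pays for
          decoupling. C2 * (1 - \<delta>) is the factor from \<open>expV_le_V\<close> and
          \<open>ring_terms\<close>, doubled because \<open>pair_drift\<close> offers only B /
          2.\<close>
        have "\<bar>?\<Phi> (m + r) - ?\<Phi> (m + r')\<bar> \<le> A * (s * (B / 2 + E m) + ?\<rho> * C2 * (B + pairV r r' m))"
        proof (rule coupling[OF r m, where c = "\<lambda>_. 0" and g = g])
          fix m assume m: "state m"
          have k: "1 \<le> tops m" by (rule tops_ge_1[OF m])
          let ?N = "weight m + weight r + weight r'"
          let ?v' = "pairV (image_mset Suc r) (image_mset Suc r') (rise m)" and ?v = "pairV r r' m"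
          let ?ring = "(\<Sum>i\<in>#r. \<alpha> ^ i * \<bar>?\<Phi> (m + ring i r) - ?\<Phi> (m + r')\<bar>)
             + (\<Sum>i\<in>#r'. \<alpha> ^ i * \<bar>?\<Phi> (m + r) - ?\<Phi> (m + ring i r')\<bar>)"
          have rings: "?ring \<le> ?\<rho> * (A * B + A * (1 + 2 * C) * C * ?v)"
          proof (rule ring_terms[OF r m])
            fix b b' assume b: "state b" "state b'"
            have "A * (B + expV b + expV b') \<le> A * (B + (1 + 2 * C) * V b + (1 + 2 * C) * V b')"
              using A expV_le_V b by (intro mult_left_mono add_mono) auto
            then show "\<bar>?\<Phi> b - ?\<Phi> b'\<bar> \<le> A * B + A * (1 + 2 * C) * (V b + V b')"
              using mid[OF b] by (simp add: algebra_simps)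
          qed (use A B0 C1 in auto)
          have E': "low_sum E m + tops m * ?v' \<le> ?N * E m"
          proof -
            have "0 \<le> (\<Sum>i\<in>#r. \<alpha> ^ i * (expV (m + ring i r) + expV (m + r')))"
              using wsum_mono[of r "\<lambda>_. 0" "\<lambda>i. expV (m + ring i r) + expV (m + r')"]
                order_trans[OF zero_le_one expV_ge_1[OF state_add[OF m]]] by simp
            moreover have "0 \<le> (\<Sum>i\<in>#r'. \<alpha> ^ i * (expV (m + r) + expV (m + ring i r')))"
              using wsum_mono[of r' "\<lambda>_. 0" "\<lambda>i. expV (m + r) + expV (m + ring i r')"]
                order_trans[OF zero_le_one expV_ge_1[OF state_add[OF m]]] by simp
            ultimately show ?thesis using E_eq[OF m] by linarith
          qed
          have low: "low_sum (\<lambda>m. A * (s * (B / 2 + E m) + ?\<rho> * C2 * (B + pairV r r' m))) m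
              = A * (s * ((weight m - tops m) * (B / 2) + low_sum E m)
                 + ?\<rho> * C2 * low_sum (\<lambda>m. B + pairV r r' m) m)"
            unfolding low_sum_cmult low_sum_plus low_sum_const ..
          have factor: "A * s * (N * h) + A * s * (N * e) + A * \<rho> * (C2 * (N * w)) = N * (A * (s * (h + e) + \<rho> * C2 * w))"
            for N h e \<rho> w by algebra
          have "tops m * \<bar>g (rise m + image_mset Suc r) - g (rise m + image_mset Suc r')\<bar>
              \<le> tops m * (A * (s * (B / 2 + ?v')))"
            using rise_bound[of m] mult_left_mono[OF S(2)[OF v'[of m]] A] k by (intro mult_left_mono) linarith+
          then have "low_sum (\<lambda>m. A * (s * (B / 2 + E m) + ?\<rho> * C2 * (B + pairV r r' m))) m
              + tops m * \<bar>g (rise m + image_mset Suc r) - g (rise m + image_mset Suc r')\<bar> + \<bar>0 - 0\<bar> + ?ring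
             \<le> A * (s * ((weight m - tops m) * (B / 2) + low_sum E m)
                 + ?\<rho> * C2 * low_sum (\<lambda>m. B + pairV r r' m) m) + tops m * (A * (s * (B / 2 + ?v')))
                + ?\<rho> * (A * B + A * (1 + 2 * C) * C * ?v)"
            unfolding low using rings by simp
          also have "\<dots> = A * s * (weight m * (B / 2)) + A * s * (low_sum E m + tops m * ?v')
              + A * ?\<rho> * (C2 * low_sum (\<lambda>m. B + pairV r r' m) m + (B + (1 + 2 * C) * C * ?v))"
            by (simp add: algebra_simps)
          also have "\<dots> \<le> A * s * (?N * (B / 2)) + A * s * (?N * E m) + A * ?\<rho> * (C2 * (?N * (B + ?v)))"
          proof (intro add_mono mult_left_mono)
            show "weight m * (B / 2) \<le> ?N * (B / 2)"
              using B0 weight_nonneg[of r] weight_nonneg[of r'] by (intro mult_right_mono) auto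
            have c: "2 \<le> 2 * (1 + 2 * C) * C" using C1 mult_mono[of 1 "1 + 2 * C" 1 C] by argo
            have "B + (1 + 2 * C) * C * ?v \<le> 2 * (1 + 2 * C) * C * (B / 2 + ?v)"
            proof -
              have "2 * (B / 2) \<le> 2 * (1 + 2 * C) * C * (B / 2)" using c B0 by (intro mult_right_mono) auto
              moreover have "1 * ((1 + 2 * C) * C * ?v) \<le> 2 * ((1 + 2 * C) * C * ?v)"
                using C1 pairV_ge(1)[OF m, of r r'] by (intro mult_right_mono mult_nonneg_nonneg) auto
              moreover have "2 * (1 + 2 * C) * C * ?v = 2 * ((1 + 2 * C) * C * ?v)" by (simp only: mult.assoc)
              ultimately show ?thesis unfolding distrib_left by linarith
            qed
            also have "\<dots> = C2 * ((1 - \<delta>) * (B / 2 + ?v))" unfolding C2(2)[symmetric] by simp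
            finally have "C2 * low_sum (\<lambda>m. B + pairV r r' m) m + (B + (1 + 2 * C) * C * ?v)
                \<le> C2 * (low_sum (\<lambda>m. B + pairV r r' m) m + (1 - \<delta>) * (B / 2 + ?v))" by (simp add: distrib_left)
            also have "\<dots> \<le> C2 * (?N * (B + ?v))" using pair_drift[OF r m B] C2 by (intro mult_left_mono)
            finally show "C2 * low_sum (\<lambda>m. B + pairV r r' m) m + (B + (1 + 2 * C) * C * ?v)
                \<le> C2 * (?N * (B + ?v))" .
          qed (use A S(1) \<rho> E' in auto)
          finally show "low_sum (\<lambda>m. A * (s * (B / 2 + E m) + ?\<rho> * C2 * (B + pairV r r' m))) m
              + tops m * \<bar>g (rise m + image_mset Suc r) - g (rise m + image_mset Suc r')\<bar> + \<bar>0 - 0\<bar> + ?ring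
             \<le> ?N * (A * (s * (B / 2 + E m) + ?\<rho> * C2 * (B + pairV r r' m)))" unfolding factor .
        qed (rule level_cost_eq)
        also have "\<dots> \<le> A * (s * (B / 2 + (\<kappa> * pairV r r' m + 4 * C)) + ?\<rho> * C2 * (B + pairV r r' m))"
          using A S(1) E_le[OF m] by (intro mult_left_mono add_mono order_refl)
        also have "\<dots> \<le> A * ((1 - \<eta>) * Z ?\<rho> (pairV r r' m))"
          using A S(3)[OF pairV_ge(1)[OF m], of r r'] by (intro mult_left_mono) (auto simp: add.assoc)
        finally show ?thesis by (simp add: mult_ac)
      qed
    qed
  qed
  show thesis
    by (rule that[of \<eta> B D Z]) (use \<eta> B0 D Z contr in auto)
qed

end

section \<open>The Poisson equation\<close>

lemma geometric_limit:
  fixes a :: "nat \<Rightarrow> real"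
  assumes step: "\<And>j. \<bar>a (Suc j) - a j\<bar> \<le> D * q ^ j" and q: "0 \<le> q" "q < 1"
  obtains L where "a \<longlonglongrightarrow> L" "\<And>j. \<bar>a j - L\<bar> \<le> D / (1 - q) * q ^ j"
proof -
  define f where "f j = a (Suc j) - a j" for j
  have geo: "summable (\<lambda>j. D * q ^ j)" using q by (intro summable_mult summable_geometric) simp
  have f: "summable (\<lambda>j. \<bar>f j\<bar>)"
    by (rule summable_comparison_test'[OF geo, of 0]) (use step in \<open>simp add: f_def\<close>)
  have a: "a (n + j) = a j + (\<Sum>i<n. f (i + j))" for n j
    by (induction n) (auto simp: f_def)
  have fs: "summable f" by (rule summable_rabs_cancel[OF f])
  define L where "L = a 0 + suminf f"
  have "a = (\<lambda>n. a 0 + (\<Sum>i<n. f i))" 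
  proof
    show "a n = a 0 + (\<Sum>i<n. f i)" for n using a[of n 0] unfolding add_0_right .
  qed
  moreover have "(\<lambda>n. a 0 + (\<Sum>i<n. f i)) \<longlonglongrightarrow> L"
    unfolding L_def by (intro tendsto_add tendsto_const summable_LIMSEQ fs)
  ultimately have lim: "a \<longlonglongrightarrow> L" by metis
  show thesis
  proof (rule that[OF lim])
    fix j
    have "(\<lambda>n. a (n + j) - a j) \<longlonglongrightarrow> L - a j"
      by (intro tendsto_diff tendsto_const LIMSEQ_ignore_initial_segment lim)
    then have "(\<lambda>n. \<bar>a (n + j) - a j\<bar>) \<longlonglongrightarrow> \<bar>L - a j\<bar>" by (rule tendsto_rabs)
    moreover have "\<bar>a (n + j) - a j\<bar> \<le> D / (1 - q) * q ^ j" for n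
    proof -
      have "\<bar>a (n + j) - a j\<bar> \<le> (\<Sum>i<n. D * q ^ (i + j))"
        unfolding a using step by (auto simp: f_def intro!: order_trans[OF sum_abs] sum_mono)
      also have "\<dots> = D * q ^ j * (\<Sum>i<n. q ^ i)" by (simp add: sum_distrib_left power_add mult_ac)
      also have "\<dots> = D * q ^ j * ((1 - q ^ n) / (1 - q))" using q by (simp add: sum_gp_strict)
      also have "\<dots> \<le> D * q ^ j * (1 / (1 - q))"
        using q step[of 0] by (intro mult_left_mono divide_right_mono mult_nonneg_nonneg) auto
      finally show ?thesis by simp
    qed
    ultimately have "\<bar>L - a j\<bar> \<le> D / (1 - q) * q ^ j"
      by (intro LIMSEQ_le_const2) auto
    then show "\<bar>a j - L\<bar> \<le> D / (1 - q) * q ^ j" by (simp add: abs_minus_commute)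
  qed
qed

context lyapunov_profile
begin

text \<open>Iterating the level average on the cost of one level, F j b is the expected cost of the
  level reached after j rises. By contraction it tends geometrically to a constant x, the mean cost
  per level, and u sums the deviations from x. If each step costs at least 1, so does each level,
  whence 1 \<le> x.\<close>

lemma poisson_V:
  assumes c: "\<And>b. state b \<Longrightarrow> \<bar>c b\<bar> \<le> a * V b"
    and c': "\<And>m r r'. state m \<Longrightarrow> 0 \<notin># r \<Longrightarrow> 0 \<notin># r' \<Longrightarrow>
      \<bar>c (m + r) - c (m + r')\<bar> \<le> a * (weight r + weight r') * pairV r r' m"
  obtains u x D where
    "\<And>b. state b \<Longrightarrow> weight b * u b = c b - tops b * x + low_sum u b + tops b * u (rise b)"
    "\<And>b. state b \<Longrightarrow> \<bar>u b\<bar> \<le> D * V b"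
    "\<And>m r r'. state m \<Longrightarrow> 0 \<notin># r \<Longrightarrow> 0 \<notin># r' \<Longrightarrow>
      \<bar>u (m + r) - u (m + r')\<bar> \<le> D * (weight r + weight r') * pairV r r' m"
    "(\<And>b. state b \<Longrightarrow> weight b \<le> c b) \<Longrightarrow> 1 \<le> x"
proof (rule level_contraction)
  fix Z \<eta> B D
  assume \<eta>: "0 < \<eta>" "\<eta> < 1" and B: "0 \<le> B" and D: "0 \<le> D"
    and Z0: "\<And>\<rho> v. 0 \<le> \<rho> \<Longrightarrow> 1 \<le> v \<Longrightarrow> 0 \<le> Z \<rho> v"
    and Z1: "\<And>\<rho> v. 0 \<le> \<rho> \<Longrightarrow> 1 \<le> v \<Longrightarrow> Z \<rho> v \<le> B + v"
    and Z2: "\<And>\<rho> v. 0 \<le> \<rho> \<Longrightarrow> 1 \<le> v \<Longrightarrow> Z \<rho> v \<le> D * \<rho> * v"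
    and Z3: "\<And>\<rho> v. 0 \<le> \<rho> \<Longrightarrow> 1 \<le> v \<Longrightarrow> min 1 \<rho> * v \<le> D * Z \<rho> v"
    and contr: "\<And>g A. 0 \<le> A \<Longrightarrow> dist_lipschitz Z g A \<Longrightarrow> dist_lipschitz Z (level_cost (\<lambda>_. 0) g) ((1 - \<eta>) * A)"
  obtain D0 where D0: "0 \<le> D0" and F_lip: "\<And>m r r'. state m \<Longrightarrow> 0 \<notin># r \<Longrightarrow> 0 \<notin># r' \<Longrightarrow>
      \<bar>level_cost c (\<lambda>_. 0) (m + r) - level_cost c (\<lambda>_. 0) (m + r')\<bar>
        \<le> D0 * ((weight r + weight r') * pairV r r' m)"
    using level_cost_lipschitz[OF c c'] by blast
  define c1 where "c1 = a * ((1 + C) / (1 - \<delta>))"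
  have F_bound: "\<bar>level_cost c (\<lambda>_. 0) b\<bar> \<le> c1 * V b" if "state b" for b
    unfolding c1_def by (rule level_cost_bound[OF c that])
  have c1: "0 \<le> c1"
    using order_trans[OF abs_ge_zero F_bound[OF state_replicate]] V_ge_1[OF state_replicate]
    by (simp add: zero_le_mult_iff)
  define q where "q = 1 - \<eta>"
  have q: "0 < q" "q < 1" using \<eta> by (auto simp: q_def)
  define F where "F j = (level_cost (\<lambda>_. 0) ^^ j) (level_cost c (\<lambda>_. 0))" for j
  have F_Suc: "F (Suc j) = level_cost (\<lambda>_. 0) (F j)" for j by (simp add: F_def)
  have F_0: "F 0 = level_cost c (\<lambda>_. 0)" by (simp add: F_def)
  \<comment> \<open>The first level cost has a crude bound of order v and a Lipschitz bound of order
    \<rho> * v; together they give min 1 \<rho> * v, which Z dominates up to the factor D.\<close>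
  define A where "A = max D0 c1 * D"
  have A: "0 \<le> A" using D D0 by (simp add: A_def)
  have lip: "dist_lipschitz Z (F j) (q ^ j * A)" for j
  proof (induction j)
    case 0
    show ?case unfolding dist_lipschitz_def F_0
    proof (intro allI impI)
      fix m and r r' :: "nat multiset" assume m: "state m" and r: "0 \<notin># r" "0 \<notin># r'"
      let ?\<rho> = "weight r + weight r'" and ?v = "pairV r r' m"
      have \<rho>: "0 \<le> ?\<rho>" by (simp add: weight_nonneg)
      have v: "1 \<le> ?v" by (rule pairV_ge(1)[OF m])
      let ?x = "\<bar>level_cost c (\<lambda>_. 0) (m + r) - level_cost c (\<lambda>_. 0) (m + r')\<bar>"
      have "?x \<le> c1 * ?v"
        using F_bound[OF state_add[OF m], of r] F_bound[OF state_add[OF m], of r'] by (simp add: pairV_def distrib_left)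
      also have "\<dots> \<le> max D0 c1 * ?v" using v by (intro mult_right_mono) auto
      finally have 1: "?x \<le> max D0 c1 * (1 * ?v)" by simp
      have "D0 * (?\<rho> * ?v) \<le> max D0 c1 * (?\<rho> * ?v)" using \<rho> v by (intro mult_right_mono mult_nonneg_nonneg) auto
      then have "?x \<le> max D0 c1 * (?\<rho> * ?v)" using F_lip[OF m r] by linarith
      then have "?x \<le> max D0 c1 * (min 1 ?\<rho> * ?v)" using 1 by (cases "1 \<le> ?\<rho>") (auto simp: min_def)
      also have "\<dots> \<le> max D0 c1 * (D * Z ?\<rho> ?v)" using D0 Z3[OF \<rho> v] by (intro mult_left_mono) auto
      finally show "?x \<le> q ^ 0 * A * Z ?\<rho> ?v" by (simp add: A_def mult_ac)
    qed
  next
    case (Suc j)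
    have "dist_lipschitz Z (F (Suc j)) ((1 - \<eta>) * (q ^ j * A))"
      unfolding F_Suc using q A by (intro contr Suc) auto
    then show ?case by (simp add: q_def mult_ac)
  qed
  \<comment> \<open>Reference state for the limit: every profile after a rise has the form ?e + r,
    so one further level brings the iterates near their value at ?e.\<close>
  let ?e = "replicate_mset d 0"
  have e: "state ?e" by (rule state_replicate)
  have near: "\<bar>F (Suc j) b - F j ?e\<bar> \<le> q ^ j * A * (B + V ?e + expV b)" if b: "state b" for j b
    unfolding F_Suc
  proof (rule level_cost_center[OF _ b])
    fix b
    define r where "r = image_mset Suc (b - {#0#})"
    have r: "rise b = ?e + r" "0 \<notin># r" by (auto simp: rise_def r_def)
    have "\<bar>F j (?e + r) - F j (?e + {#})\<bar> \<le> q ^ j * A * Z (weight r + weight {#}) (pairV r {#} ?e)"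
      using lip[of j] e r unfolding dist_lipschitz_def by (metis empty_iff set_mset_empty)
    also have "\<dots> \<le> q ^ j * A * (B + pairV r {#} ?e)"
      using q A weight_nonneg[of r] pairV_ge(1)[OF e, of r "{#}"] by (intro mult_left_mono Z1) auto
    finally show "\<bar>F j (rise b) - F j ?e\<bar> \<le> q ^ j * A * (B + V ?e + V (rise b))"
      by (simp add: r pairV_def add_ac)
  qed
  define D1 where "D1 = A * (B + V ?e + expV ?e)"
  have Ve: "1 \<le> V ?e" "1 \<le> expV ?e" using V_ge_1[OF e] expV_ge_1[OF e] .
  have D1: "0 \<le> D1" unfolding D1_def using A B Ve by (intro mult_nonneg_nonneg) auto
  obtain x where x_lim: "(\<lambda>j. F j ?e) \<longlonglongrightarrow> x" and x: "\<And>j. \<bar>F j ?e - x\<bar> \<le> D1 / (1 - q) * q ^ j"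
  proof (rule geometric_limit[of "\<lambda>j. F j ?e" D1 q])
    show "\<bar>F (Suc j) ?e - F j ?e\<bar> \<le> D1 * q ^ j" for j using near[OF e, of j] by (simp add: D1_def mult_ac)
  qed (use q in auto)
  define D2 where "D2 = (A * (B + V ?e + (1 + 2 * C)) + D1 / (1 - q)) / q + c1 + \<bar>x\<bar>"
  have D2: "0 \<le> D2" unfolding D2_def using A B Ve C1 D1 c1 q by auto
  have F_x: "\<bar>F j b - x\<bar> \<le> D2 * V b * q ^ j" if b: "state b" for j b
  proof -
    have Vb: "1 \<le> V b" by (rule V_ge_1[OF b])
    define G where "G = A * (B + V ?e + (1 + 2 * C)) + D1 / (1 - q)"
    have G: "0 \<le> G" unfolding G_def using A B Ve C1 D1 q by auto
    show ?thesis
    proof (cases j)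
      case 0
      have "\<bar>F 0 b - x\<bar> \<le> c1 * V b + \<bar>x\<bar>" using F_bound[OF b] unfolding F_0 by linarith
      also have "\<dots> \<le> c1 * V b + \<bar>x\<bar> * V b" using mult_left_mono[OF Vb, of "\<bar>x\<bar>"] by simp
      also have "\<dots> = (c1 + \<bar>x\<bar>) * V b" by (simp add: distrib_right)
      also have "\<dots> \<le> D2 * V b" using G q Vb unfolding D2_def G_def by (intro mult_right_mono) auto
      finally show ?thesis by (simp add: 0)
    next
      case (Suc i)
      have "B + V ?e + expV b \<le> (B + V ?e + (1 + 2 * C)) * V b"
        using expV_le_V[OF b] mult_left_mono[OF Vb, of "B + V ?e"] B Ve by (simp add: distrib_right)
      then have "q ^ i * A * (B + V ?e + expV b) \<le> q ^ i * A * ((B + V ?e + (1 + 2 * C)) * V b)"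
        using q A by (intro mult_left_mono) auto
      moreover have "D1 / (1 - q) * q ^ i * 1 \<le> D1 / (1 - q) * q ^ i * V b"
        using D1 q Vb by (intro mult_left_mono) auto
      ultimately have "\<bar>F (Suc i) b - x\<bar> \<le> q ^ i * A * ((B + V ?e + (1 + 2 * C)) * V b) + D1 / (1 - q) * q ^ i * V b"
        using near[OF b, of i] x[of i] by linarith
      also have "\<dots> = (G / q) * (V b * q ^ Suc i)" using q by (simp add: G_def field_simps)
      also have "\<dots> \<le> D2 * (V b * q ^ Suc i)"
        using c1 q Vb unfolding D2_def G_def by (intro mult_right_mono) auto
      finally show ?thesis by (simp add: Suc mult_ac)
    qed
  qed
  define U where "U n b = (\<Sum>j<n. F j b - x)" for n b
  define u where "u b = (\<Sum>j. F j b - x)" for b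
  have geo: "summable (\<lambda>j. y * q ^ j)" for y using q by (intro summable_mult summable_geometric) simp
  have geo_sum: "(\<Sum>j. y * q ^ j) = y / (1 - q)" for y using q by (subst suminf_mult) (auto simp: suminf_geometric intro!: summable_geometric)
  have summ: "summable (\<lambda>j. \<bar>F j b - x\<bar>)" if "state b" for b
    by (rule summable_comparison_test'[OF geo, of 0]) (use F_x[OF that] in auto)
  have U_lim: "(\<lambda>n. U n b) \<longlonglongrightarrow> u b" if "state b" for b
    unfolding U_def u_def by (rule summable_LIMSEQ[OF summable_rabs_cancel[OF summ[OF that]]])
  \<comment> \<open>The level operator shifts each summand to the next level and adds the cost of
    the current one; the sum then has one summand more, and the x subtracted there reappears on the
    right.\<close>
  have U_step: "level_cost c (U n) b = U (Suc n) b + x" if b: "state b" for n b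
  proof (induction n)
    case 0
    have "U 0 = (\<lambda>_. 0)" by (auto simp: U_def)
    then show ?case by (simp add: U_def F_0)
  next
    case (Suc n)
    have "level_cost (\<lambda>b. c b - c b) (\<lambda>b. U (Suc n) b - U n b) b = level_cost (\<lambda>b. 0 - 0) (\<lambda>b. F n b - x) b"
      by (simp add: U_def)
    then have "level_cost c (U (Suc n)) b - level_cost c (U n) b = F (Suc n) b - x"
      unfolding level_cost_diff[OF b] level_cost_const[OF b] F_Suc .
    moreover have "U (Suc (Suc n)) b = U (Suc n) b + (F (Suc n) b - x)" by (simp add: U_def)
    ultimately show ?case using Suc by linarith
  qed
  have u_eq: "level_cost c u b = u b + x" if b: "state b" for b
  proof -
    have "(\<lambda>n. level_cost c (U n) b) \<longlonglongrightarrow> level_cost c u b"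
      by (rule level_cost_tendsto[OF U_lim b])
    moreover have "(\<lambda>n. level_cost c (U n) b) \<longlonglongrightarrow> u b + x"
      unfolding U_step[OF b] by (intro tendsto_intros LIMSEQ_Suc U_lim b)
    ultimately show ?thesis by (rule LIMSEQ_unique)
  qed
  define D3 where "D3 = D2 / (1 - q) + A / (1 - q) * D"
  have D3: "D2 / (1 - q) \<le> D3" "A / (1 - q) * D \<le> D3" using A D D2 q by (auto simp: D3_def)
  show thesis
  proof (rule that[of u x D3])
    fix b assume b: "state b"
    \<comment> \<open>Back from levels to single steps. The constant x is charged once per level, at
      the rise, and so appears with rate tops b.\<close>
    have "weight b * (u b + x) = c b + low_sum (level_cost c u) b + tops b * u (rise b)"
      using level_cost_eq[OF b, of c u] u_eq[OF b] by simp
    also have "low_sum (level_cost c u) b = low_sum (\<lambda>b. u b + x) b"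
      by (intro antisym low_sum_mono) (auto simp: u_eq state_ring b)
    finally show "weight b * u b = c b - tops b * x + low_sum u b + tops b * u (rise b)"
      by (simp add: low_sum_plus low_sum_const algebra_simps)
    have "\<bar>u b\<bar> \<le> (\<Sum>j. \<bar>F j b - x\<bar>)" unfolding u_def by (rule summable_rabs[OF summ[OF b]])
    also have "\<dots> \<le> (\<Sum>j. D2 * V b * q ^ j)" by (intro suminf_le summ[OF b] geo F_x[OF b])
    also have "\<dots> = D2 / (1 - q) * V b" unfolding geo_sum by simp
    also have "\<dots> \<le> D3 * V b" using D3 V_ge_1[OF b] by (intro mult_right_mono) auto
    finally show "\<bar>u b\<bar> \<le> D3 * V b" .
  next
    fix m and r r' :: "nat multiset" assume m: "state m" and r: "0 \<notin># r" "0 \<notin># r'"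
    let ?\<rho> = "weight r + weight r'" and ?v = "pairV r r' m"
    have \<rho>: "0 \<le> ?\<rho>" by (simp add: weight_nonneg)
    have v: "1 \<le> ?v" by (rule pairV_ge(1)[OF m])
    have "\<bar>U n (m + r) - U n (m + r')\<bar> \<le> A / (1 - q) * Z ?\<rho> ?v" for n
    proof -
      have "\<bar>U n (m + r) - U n (m + r')\<bar> = \<bar>\<Sum>j<n. F j (m + r) - F j (m + r')\<bar>"
        by (simp add: U_def sum_subtractf)
      also have "\<dots> \<le> (\<Sum>j<n. A * Z ?\<rho> ?v * q ^ j)"
        using lip m r unfolding dist_lipschitz_def by (intro order_trans[OF sum_abs] sum_mono) (auto simp: mult_ac)
      also have "\<dots> \<le> (\<Sum>j. A * Z ?\<rho> ?v * q ^ j)"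
        using A Z0[OF \<rho> v] q by (intro sum_le_suminf geo) auto
      finally show ?thesis unfolding geo_sum by simp
    qed
    then have "\<bar>u (m + r) - u (m + r')\<bar> \<le> A / (1 - q) * Z ?\<rho> ?v"
      by (intro LIMSEQ_le_const2[OF tendsto_rabs[OF tendsto_diff[OF U_lim[OF state_add[OF m]] U_lim[OF state_add[OF m]]]]]) auto
    also have "\<dots> \<le> A / (1 - q) * (D * ?\<rho> * ?v)" using A q Z2[OF \<rho> v] by (intro mult_left_mono) auto
    also have "\<dots> = A / (1 - q) * D * (?\<rho> * ?v)" by simp
    also have "\<dots> \<le> D3 * (?\<rho> * ?v)" using D3 \<rho> v by (intro mult_right_mono mult_nonneg_nonneg) auto
    finally show "\<bar>u (m + r) - u (m + r')\<bar> \<le> D3 * ?\<rho> * ?v" by simp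
  next
    assume cw: "\<And>b. state b \<Longrightarrow> weight b \<le> c b"
    have "1 \<le> F j b" if "state b" for j b
      using that
    proof (induction j arbitrary: b)
      case 0
      show ?case unfolding F_0
      proof (rule level_cost_ge[OF _ 0])
        fix b assume b: "state b"
        show "weight b * 1 \<le> c b + low_sum (\<lambda>_. 1) b + tops b * 0"
          using cw[OF b] weight_ge_tops[of b] by (simp add: low_sum_const)
      qed
    next
      case (Suc j)
      show ?case unfolding F_Suc
        using level_cost_mono[of "\<lambda>_. 0" "\<lambda>_. 0" "\<lambda>_. 1" "F j" b] Suc state_rise
        by (simp add: level_cost_const)
    qed
    then show "1 \<le> x" by (intro LIMSEQ_le_const[OF x_lim]) (use e in auto)
  qed
qed

end

section \<open>Correctors for the mean and for the variance\<close>

context boundary_profile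
begin

text \<open>Eliminates V, which is comparable to weight ^ p. The combined weight of m, r and r' is
  at most twice the larger of the weights of m + r and m + r', whence the factor 2 ^ p.\<close>

lemma poisson:
  assumes p: "1 \<le> p"
    and c: "\<And>b. state b \<Longrightarrow> \<bar>c b\<bar> \<le> a * weight b ^ p"
    and c': "\<And>m r r'. state m \<Longrightarrow> 0 \<notin># r \<Longrightarrow> 0 \<notin># r' \<Longrightarrow>
      \<bar>c (m + r) - c (m + r')\<bar> \<le> a * (weight r + weight r') * (weight m + weight r + weight r') ^ p"
  obtains u x D where "0 \<le> D"
    "\<And>b. state b \<Longrightarrow> weight b * u b = c b - tops b * x + low_sum u b + tops b * u (rise b)"
    "\<And>b. state b \<Longrightarrow> \<bar>u b\<bar> \<le> D * weight b ^ p"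
    "\<And>m r r'. state m \<Longrightarrow> 0 \<notin># r \<Longrightarrow> 0 \<notin># r' \<Longrightarrow>
      \<bar>u (m + r) - u (m + r')\<bar> \<le> D * (weight r + weight r') * (weight m + weight r + weight r') ^ p"
    "(\<And>b. state b \<Longrightarrow> weight b \<le> c b) \<Longrightarrow> 1 \<le> x"
proof (rule lyapunov[OF p])
  fix V C \<delta> \<gamma>
  assume V: "0 \<le> \<delta>" "0 \<le> \<gamma>" "\<delta> + \<gamma> < 1" "1 \<le> C"
    "\<And>b. weight b ^ p \<le> V b" "\<And>b. V b \<le> 2 * weight b ^ p"
    "\<And>b. state b \<Longrightarrow> low_sum V b \<le> (weight b - tops b + \<delta> * tops b) * V b + C * tops b"
    "\<And>b. state b \<Longrightarrow> V (rise b) \<le> \<gamma> * V b + C"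
    "\<And>b i. state b \<Longrightarrow> i \<in># b \<Longrightarrow> 0 < i \<Longrightarrow> V (ring i b) \<le> C * V b"
  have wV: "weight b \<le> V b" if "state b" for b
    using V(5)[of b] power_increasing[OF p weight_ge_1[OF that]] by simp
  interpret lyapunov_profile d \<alpha> V C \<delta> \<gamma>
    by (rule lyapunov_profile.intro[OF boundary_profile_axioms], rule lyapunov_profile_axioms.intro)
      (fact V wV)+
  have a: "0 \<le> a"
  proof -
    have "1 \<le> weight (replicate_mset d 0) ^ p" using weight_ge_1[OF state_replicate] by simp
    moreover have "0 \<le> a * weight (replicate_mset d 0) ^ p"
      using abs_ge_zero c[OF state_replicate] by (rule order_trans)
    ultimately show ?thesis by (simp add: zero_le_mult_iff)
  qed
  have cV: "\<bar>c b\<bar> \<le> a * 2 ^ p * V b" if b: "state b" for b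
  proof -
    have "a * 1 * weight b ^ p \<le> a * 2 ^ p * V b"
      using a V(5)[of b] weight_nonneg[of b] by (intro mult_mono) auto
    then show ?thesis using c[OF b] by simp
  qed
  have cV': "\<bar>c (m + r) - c (m + r')\<bar> \<le> a * 2 ^ p * (weight r + weight r') * pairV r r' m"
    if m: "state m" and r: "0 \<notin># r" "0 \<notin># r'" for m r r'
  proof -
    let ?x = "weight (m + r)" and ?y = "weight (m + r')"
    have xy: "0 \<le> ?x" "0 \<le> ?y" by (rule weight_nonneg)+
    have nn: "0 \<le> weight m" "0 \<le> weight r" "0 \<le> weight r'" by (rule weight_nonneg)+
    have "m1 + r1 + r2 \<le> 2 * M" if "m1 + r1 \<le> M" "m1 + r2 \<le> M" "0 \<le> m1" for m1 r1 r2 M :: real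
      using that by linarith
    from this[of "weight m" "weight r" "max ?x ?y" "weight r'"] nn
    have "weight m + weight r + weight r' \<le> 2 * max ?x ?y" by simp
    then have "(weight m + weight r + weight r') ^ p \<le> (2 * max ?x ?y) ^ p"
      using nn by (intro power_mono) auto
    also have "\<dots> = 2 ^ p * max ?x ?y ^ p" by (simp add: power_mult_distrib)
    also have "max ?x ?y ^ p \<le> ?x ^ p + ?y ^ p" using xy by (auto simp: max_def)
    also have "\<dots> \<le> pairV r r' m" unfolding pairV_def by (intro add_mono V(5))
    finally have "(weight m + weight r + weight r') ^ p \<le> 2 ^ p * pairV r r' m" by simp
    then have "a * (weight r + weight r') * (weight m + weight r + weight r') ^ p
        \<le> a * (weight r + weight r') * (2 ^ p * pairV r r' m)"
      using a weight_nonneg[of r] weight_nonneg[of r'] by (intro mult_left_mono mult_nonneg_nonneg add_nonneg_nonneg)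
    then show ?thesis using c'[OF m r] by (simp add: mult_ac)
  qed
  show thesis
  proof (rule poisson_V[of c "a * 2 ^ p", OF cV cV'])
  fix u x D
  assume
    u: "\<And>b. state b \<Longrightarrow> weight b * u b = c b - tops b * x + low_sum u b + tops b * u (rise b)"
    and D: "\<And>b. state b \<Longrightarrow> \<bar>u b\<bar> \<le> D * V b"
    and L: "\<And>m r r'. state m \<Longrightarrow> 0 \<notin># r \<Longrightarrow> 0 \<notin># r' \<Longrightarrow>
      \<bar>u (m + r) - u (m + r')\<bar> \<le> D * (weight r + weight r') * pairV r r' m"
    and x: "(\<And>b. state b \<Longrightarrow> weight b \<le> c b) \<Longrightarrow> 1 \<le> x"
  have D0: "0 \<le> D"
    using order_trans[OF abs_ge_zero D[OF state_replicate]] V_ge_1[OF state_replicate]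
    by (simp add: zero_le_mult_iff)
  show thesis
  proof (rule that[of "4 * D" u x])
    fix b assume b: "state b"
    have "D * V b \<le> D * (4 * weight b ^ p)"
      using D0 V(6)[of b] weight_nonneg[of b] by (intro mult_left_mono) (auto intro: order_trans)
    then show "\<bar>u b\<bar> \<le> 4 * D * weight b ^ p" using D[OF b] by simp
  next
    fix m and r r' :: "nat multiset" assume m: "state m" and r: "0 \<notin># r" "0 \<notin># r'"
    let ?w = "(weight m + weight r + weight r') ^ p"
    have "weight (m + r) ^ p \<le> ?w" "weight (m + r') ^ p \<le> ?w"
      using weight_nonneg[of m] weight_nonneg[of r] weight_nonneg[of r'] by (auto intro!: power_mono)
    then have "pairV r r' m \<le> 4 * ?w"
      using V(6)[of "m + r"] V(6)[of "m + r'"] unfolding pairV_def by linarith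
    then have "D * (weight r + weight r') * pairV r r' m \<le> D * (weight r + weight r') * (4 * ?w)"
      using D0 weight_nonneg[of r] weight_nonneg[of r'] by (intro mult_left_mono mult_nonneg_nonneg add_nonneg_nonneg)
    then show "\<bar>u (m + r) - u (m + r')\<bar> \<le> 4 * D * (weight r + weight r') * ?w"
      using L[OF m r] by simp
  qed (use D0 u x in auto)
  qed
qed


text \<open>Bounds the factor by which one step can increase the weight: 1 + gain suffices for
  rings, 1 + d for rises.\<close>

definition spread :: real where "spread = 1 + gain + real d"

lemma spread_ge_1: "1 \<le> spread" using gain_nonneg by (simp add: spread_def)

lemma weight_ring_le: "state b \<Longrightarrow> i \<in># b \<Longrightarrow> 0 < i \<Longrightarrow> weight (ring i b) \<le> spread * weight b"
proof -
  assume b: "state b" and i: "i \<in># b" "0 < i"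
  have w: "1 \<le> weight b" by (rule weight_ge_1[OF b])
  have "gain * \<alpha> ^ i \<le> gain * 1" using gain_nonneg al0 al1 by (intro mult_left_mono) (auto simp: power_le_one)
  moreover have "gain * 1 \<le> gain * weight b" using gain_nonneg w by (intro mult_left_mono)
  moreover have "0 \<le> real d * weight b" using w by simp
  ultimately show ?thesis using weight_ring[OF i] by (simp add: gain_def[symmetric] spread_def algebra_simps)
qed

lemma weight_rise_le': "state b \<Longrightarrow> weight (rise b) \<le> \<alpha> * weight b + real d"
  using weight_rise[OF state_0, of b] al0 by (simp add: algebra_simps)

lemma weight_rise_le: "state b \<Longrightarrow> weight (rise b) \<le> spread * weight b"
proof -
  assume b: "state b"
  have w: "1 \<le> weight b" by (rule weight_ge_1[OF b])
  have "\<alpha> * weight b \<le> 1 * weight b" using al1 w by (intro mult_right_mono) auto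
  moreover have "real d * 1 \<le> real d * weight b" using w by (intro mult_left_mono) auto
  moreover have "0 \<le> gain * weight b" using w gain_nonneg by simp
  ultimately show ?thesis using weight_rise_le'[OF b] by (simp add: spread_def algebra_simps)
qed

definition variance_rate :: "(nat multiset \<Rightarrow> real) \<Rightarrow> real \<Rightarrow> nat multiset \<Rightarrow> real" where
  "variance_rate v \<mu> b =
     low_sum (\<lambda>b'. (v b' - v b - \<mu>) ^ 2) b + tops b * (1 + v (rise b) - v b - \<mu>) ^ 2"

lemma abs_square_diff_le:
  fixes x y :: real
  assumes "\<bar>x\<bar> \<le> A" "\<bar>y\<bar> \<le> A" "\<bar>x - y\<bar> \<le> B"
  shows "\<bar>x\<^sup>2 - y\<^sup>2\<bar> \<le> B * (2 * A)"
proof -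
  have "\<bar>x\<^sup>2 - y\<^sup>2\<bar> = \<bar>x - y\<bar> * \<bar>x + y\<bar>"
    by (simp add: power2_eq_square abs_mult[symmetric] algebra_simps)
  also have "\<dots> \<le> B * (2 * A)" using assms by (intro mult_mono) auto
  finally show ?thesis .
qed

text \<open>Increments of v are of the order of the weight and occur at total rate weight, hence the
  cube. In the difference, rings in m and rises are compared one by one through the Lipschitz bound;
  rings in r and r' are bounded separately, by their rates.\<close>

lemma variance_rate_bounds:
  assumes D: "0 \<le> D" and \<mu>: "0 \<le> \<mu>" "\<mu> \<le> 1"
    and v: "\<And>b. state b \<Longrightarrow> \<bar>v b\<bar> \<le> D * weight b"
    and v': "\<And>m r r'. state m \<Longrightarrow> 0 \<notin># r \<Longrightarrow> 0 \<notin># r' \<Longrightarrow>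
      \<bar>v (m + r) - v (m + r')\<bar> \<le> D * (weight r + weight r') * (weight m + weight r + weight r')"
  obtains a where
    "\<And>b. state b \<Longrightarrow> \<bar>variance_rate v \<mu> b\<bar> \<le> a * weight b ^ 3"
    "\<And>m r r'. state m \<Longrightarrow> 0 \<notin># r \<Longrightarrow> 0 \<notin># r' \<Longrightarrow>
      \<bar>variance_rate v \<mu> (m + r) - variance_rate v \<mu> (m + r')\<bar>
        \<le> a * (weight r + weight r') * (weight m + weight r + weight r') ^ 3"
proof -
  define D' where "D' = 2 * D * spread + 2"
  have D': "0 \<le> D'" using D spread_ge_1 by (simp add: D'_def)
  have incr: "\<bar>v b' - v b - \<mu>\<bar> \<le> D' * x" "\<bar>1 + v b' - v b - \<mu>\<bar> \<le> D' * x"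
    if b: "state b" "state b'" and w: "weight b' \<le> spread * x" "weight b \<le> x" for b b' x
  proof -
    have x: "1 \<le> x" using weight_ge_1[OF b(1)] w by linarith
    have "\<bar>v b'\<bar> \<le> D * (spread * x)" using v[OF b(2)] mult_left_mono[OF w(1) D] by linarith
    moreover have "\<bar>v b\<bar> \<le> D * (spread * x)"
    proof -
      have "1 * x \<le> spread * x" using spread_ge_1 x by (intro mult_right_mono) auto
      then have "D * weight b \<le> D * (spread * x)" using w D by (intro mult_left_mono) auto
      then show ?thesis using v[OF b(1)] by linarith
    qed
    moreover have "D' * x = D * (spread * x) + D * (spread * x) + 2 * x" by (simp add: D'_def algebra_simps)
    ultimately show "\<bar>v b' - v b - \<mu>\<bar> \<le> D' * x" "\<bar>1 + v b' - v b - \<mu>\<bar> \<le> D' * x"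
      using \<mu> x by linarith+
  qed
  define a where "a = D'\<^sup>2 + 2 * D'\<^sup>2 + 4 * D * spread * D'"
  have a: "D'\<^sup>2 \<le> a" "2 * D'\<^sup>2 + 4 * D * spread * D' \<le> a"
    using D D' spread_ge_1 by (auto simp: a_def)
  have sq: "x\<^sup>2 \<le> D'\<^sup>2 * y\<^sup>2" if "\<bar>x\<bar> \<le> D' * y" for x y
    using abs_le_square_iff[of x "D' * y"] that by (simp add: power_mult_distrib)
  show thesis
  proof (rule that[of a])
    fix b assume b: "state b"
    have w: "1 \<le> weight b" by (rule weight_ge_1[OF b])
    have low: "low_sum (\<lambda>b'. (v b' - v b - \<mu>) ^ 2) b \<le> low_sum (\<lambda>_. D'\<^sup>2 * (weight b)\<^sup>2) b"
      using weight_ring_le[OF b] state_ring[OF b] by (intro low_sum_mono sq incr b) auto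
    have top: "tops b * (1 + v (rise b) - v b - \<mu>) ^ 2 \<le> tops b * (D'\<^sup>2 * (weight b)\<^sup>2)"
      using weight_rise_le[OF b] tops_ge_1[OF b] by (intro mult_left_mono sq incr b state_rise) auto
    have "0 \<le> variance_rate v \<mu> b"
      unfolding variance_rate_def using tops_ge_1[OF b] by (intro add_nonneg_nonneg low_sum_nonneg) auto
    moreover have "variance_rate v \<mu> b \<le> weight b * (D'\<^sup>2 * (weight b)\<^sup>2)"
      using low top unfolding variance_rate_def low_sum_const by (simp add: algebra_simps)
    moreover have "weight b * (D'\<^sup>2 * (weight b)\<^sup>2) = D'\<^sup>2 * weight b ^ 3"
      by (simp add: power3_eq_cube power2_eq_square)
    moreover have "D'\<^sup>2 * weight b ^ 3 \<le> a * weight b ^ 3" using a w by (intro mult_right_mono) auto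
    ultimately show "\<bar>variance_rate v \<mu> b\<bar> \<le> a * weight b ^ 3" by linarith
  next
    fix m and r r' :: "nat multiset" assume m: "state m" and r: "0 \<notin># r" "0 \<notin># r'"
    let ?\<rho> = "weight r + weight r'" and ?W = "weight m + weight r + weight r'"
    have nn: "1 \<le> weight m" "0 \<le> weight r" "0 \<le> weight r'" using weight_ge_1[OF m] weight_nonneg by auto
    have \<rho>: "0 \<le> ?\<rho>" using nn by simp
    have W: "1 \<le> ?W" using nn by simp
    have sp: "weight b + \<rho>' \<le> spread * ?W" if "weight b \<le> spread * weight m" "\<rho>' \<le> ?\<rho>" for b \<rho>'
    proof -
      have "1 * ?\<rho> \<le> spread * ?\<rho>" using spread_ge_1 \<rho> by (intro mult_right_mono) auto
      then show ?thesis using that by (simp add: algebra_simps)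
    qed
    have common: "\<bar>(x + v (b' + q) - v (m + r) - \<mu>)\<^sup>2 - (x + v (b' + q') - v (m + r') - \<mu>)\<^sup>2\<bar>
        \<le> 4 * D * spread * D' * ?\<rho> * ?W\<^sup>2"
      if b': "state b'" "weight b' \<le> spread * weight m" and q: "0 \<notin># q" "0 \<notin># q'"
        "weight q \<le> weight r" "weight q' \<le> weight r'" and x: "x = 0 \<or> x = 1" for b' q q' x
    proof -
      have nq: "0 \<le> weight q" "0 \<le> weight q'" by (rule weight_nonneg)+
      have W1: "weight b' + (weight q + weight q') \<le> spread * ?W" using b' q by (intro sp) auto
      have "\<bar>v (b' + q) - v (b' + q')\<bar> \<le> D * (weight q + weight q') * (weight b' + weight q + weight q')"
        by (rule v'[OF b'(1) q(1,2)])
      also have "\<dots> \<le> D * ?\<rho> * (spread * ?W)"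
        using W1 D q nq b' weight_nonneg[of b'] spread_ge_1 W by (intro mult_mono mult_left_mono mult_nonneg_nonneg) auto
      finally have 1: "\<bar>v (b' + q) - v (b' + q')\<bar> \<le> D * ?\<rho> * (spread * ?W)" .
      have "1 * ?W \<le> spread * ?W" using spread_ge_1 W by (intro mult_right_mono) auto
      then have "D * ?\<rho> * ?W \<le> D * ?\<rho> * (spread * ?W)" using D \<rho> by (intro mult_left_mono mult_nonneg_nonneg) auto
      then have 2: "\<bar>v (m + r) - v (m + r')\<bar> \<le> D * ?\<rho> * (spread * ?W)" using v'[OF m r] by linarith
      have "weight (b' + q) \<le> spread * ?W" "weight (b' + q') \<le> spread * ?W" using W1 nq by auto
      then have "\<bar>x + v (b' + q) - v (m + r) - \<mu>\<bar> \<le> D' * ?W" "\<bar>x + v (b' + q') - v (m + r') - \<mu>\<bar> \<le> D' * ?W"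
        using x nn incr[OF state_add[OF m] state_add[OF b'(1)], of q ?W r]
          incr[OF state_add[OF m] state_add[OF b'(1)], of q' ?W r'] by auto
      then have "\<bar>(x + v (b' + q) - v (m + r) - \<mu>)\<^sup>2 - (x + v (b' + q') - v (m + r') - \<mu>)\<^sup>2\<bar>
          \<le> (2 * (D * ?\<rho> * (spread * ?W))) * (2 * (D' * ?W))"
        using 1 2 by (intro abs_square_diff_le) linarith+
      moreover have "(2 * (D * \<rho> * (spread * W))) * (2 * (D' * W)) = 4 * D * spread * D' * \<rho> * W\<^sup>2" for \<rho> W
        by (simp add: power2_eq_square)
      ultimately show ?thesis by simp
    qed
    define X where "X i = (v (ring i m + r) - v (m + r) - \<mu>)\<^sup>2" for i
    define X' where "X' i = (v (ring i m + r') - v (m + r') - \<mu>)\<^sup>2" for i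
    define Y where "Y i = (v (m + ring i r) - v (m + r) - \<mu>)\<^sup>2" for i
    define Y' where "Y' i = (v (m + ring i r') - v (m + r') - \<mu>)\<^sup>2" for i
    define T where "T = (1 + v (rise m + image_mset Suc r) - v (m + r) - \<mu>)\<^sup>2"
    define T' where "T' = (1 + v (rise m + image_mset Suc r') - v (m + r') - \<mu>)\<^sup>2"
    have m0: "0 \<in># m" by (rule state_0[OF m])
    have eq: "variance_rate v \<mu> (m + r) = (\<Sum>i\<in>#lower m. \<alpha> ^ i * X i) + (\<Sum>i\<in>#r. \<alpha> ^ i * Y i) + tops m * T"
      unfolding variance_rate_def low_sum_add[OF r(1)] tops_add[OF r(1)] rise_add[OF m0]
      by (simp add: X_def Y_def T_def)
    have eq': "variance_rate v \<mu> (m + r') = (\<Sum>i\<in>#lower m. \<alpha> ^ i * X' i) + (\<Sum>i\<in>#r'. \<alpha> ^ i * Y' i) + tops m * T'"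
      unfolding variance_rate_def low_sum_add[OF r(2)] tops_add[OF r(2)] rise_add[OF m0]
      by (simp add: X'_def Y'_def T'_def)
    let ?K = "4 * D * spread * D' * ?\<rho> * ?W\<^sup>2"
    have "\<bar>(\<Sum>i\<in>#lower m. \<alpha> ^ i * X i) - (\<Sum>i\<in>#lower m. \<alpha> ^ i * X' i)\<bar> \<le> (\<Sum>i\<in>#lower m. \<alpha> ^ i * ?K)"
      unfolding wsum_diff[symmetric]
    proof (rule order_trans[OF wsum_abs wsum_mono])
      fix i assume "i \<in># lower m"
      then have i: "i \<in># m" "0 < i" by (auto simp: lower_mem)
      show "\<bar>X i - X' i\<bar> \<le> ?K"
        using common[OF state_ring[OF m i(2)] weight_ring_le[OF m i] r order_refl order_refl, of 0]
        by (simp add: X_def X'_def)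
    qed
    then have 1: "\<bar>(\<Sum>i\<in>#lower m. \<alpha> ^ i * X i) - (\<Sum>i\<in>#lower m. \<alpha> ^ i * X' i)\<bar> \<le> (weight m - tops m) * ?K"
      unfolding wsum_const using weight_split[of m] by simp
    have "\<bar>T - T'\<bar> \<le> ?K"
    proof -
      have "\<alpha> * weight q \<le> weight q" for q using al1 weight_nonneg[of q] mult_right_mono[of \<alpha> 1 "weight q"] by simp
      then show ?thesis
        using common[OF state_rise weight_rise_le[OF m], of "image_mset Suc r" "image_mset Suc r'" 1]
        by (simp add: T_def T'_def weight_image_Suc)
    qed
    then have 2: "\<bar>tops m * T - tops m * T'\<bar> \<le> tops m * ?K"
      using tops_ge_1[OF m] by (simp add: right_diff_distrib[symmetric] abs_mult)
    have Y_le: "0 \<le> (\<Sum>i\<in>#q. \<alpha> ^ i * (v (m + ring i q) - v (m + q) - \<mu>)\<^sup>2) \<and>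
        (\<Sum>i\<in>#q. \<alpha> ^ i * (v (m + ring i q) - v (m + q) - \<mu>)\<^sup>2) \<le> weight q * (D'\<^sup>2 * ?W\<^sup>2)"
      if q: "0 \<notin># q" "weight q \<le> ?\<rho>" for q
    proof
      show "0 \<le> (\<Sum>i\<in>#q. \<alpha> ^ i * (v (m + ring i q) - v (m + q) - \<mu>)\<^sup>2)"
        using wsum_mono[of q "\<lambda>_. 0" "\<lambda>i. (v (m + ring i q) - v (m + q) - \<mu>)\<^sup>2"] by simp
      have "(\<Sum>i\<in>#q. \<alpha> ^ i * (v (m + ring i q) - v (m + q) - \<mu>)\<^sup>2) \<le> (\<Sum>i\<in>#q. \<alpha> ^ i * (D'\<^sup>2 * ?W\<^sup>2))"
      proof (rule wsum_mono)
        fix i assume i: "i \<in># q"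
        then have i0: "0 < i" using q by (cases i) auto
        have iq: "i \<in># m + q" using i by simp
        have mq: "weight (m + q) \<le> ?W" using q by simp
        have "spread * weight (m + q) \<le> spread * ?W" using mq spread_ge_1 by (intro mult_left_mono) auto
        then have "weight (m + ring i q) \<le> spread * ?W"
          using weight_ring_le[OF state_add[OF m] iq i0] unfolding ring_add_right[OF i] by linarith
        then show "(v (m + ring i q) - v (m + q) - \<mu>)\<^sup>2 \<le> D'\<^sup>2 * ?W\<^sup>2"
          using mq by (intro sq incr state_add m)
      qed
      then show "(\<Sum>i\<in>#q. \<alpha> ^ i * (v (m + ring i q) - v (m + q) - \<mu>)\<^sup>2) \<le> weight q * (D'\<^sup>2 * ?W\<^sup>2)"
        unfolding wsum_const .
    qed
    have 3: "\<bar>(\<Sum>i\<in>#r. \<alpha> ^ i * Y i) - (\<Sum>i\<in>#r'. \<alpha> ^ i * Y' i)\<bar> \<le> ?\<rho> * (D'\<^sup>2 * ?W\<^sup>2)"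
      using Y_le[OF r(1)] Y_le[OF r(2)] nn unfolding Y_def Y'_def distrib_right by auto
    have "\<bar>variance_rate v \<mu> (m + r) - variance_rate v \<mu> (m + r')\<bar> \<le> weight m * ?K + ?\<rho> * (D'\<^sup>2 * ?W\<^sup>2)"
      using 1 2 3 unfolding eq eq' left_diff_distrib by linarith
    also have "weight m * ?K \<le> ?W * ?K"
      using nn D D' spread_ge_1 by (intro mult_right_mono mult_nonneg_nonneg) auto
    also have "?\<rho> * (D'\<^sup>2 * ?W\<^sup>2) \<le> ?\<rho> * (D'\<^sup>2 * ?W\<^sup>2) * (2 * ?W)"
    proof -
      have "0 \<le> ?\<rho> * (D'\<^sup>2 * ?W\<^sup>2)" using \<rho> by simp
      from mult_left_mono[OF _ this, of 1 "2 * ?W"] W show ?thesis by simp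
    qed
    also have "?W * ?K + ?\<rho> * (D'\<^sup>2 * ?W\<^sup>2) * (2 * ?W) = (2 * D'\<^sup>2 + 4 * D * spread * D') * (?\<rho> * ?W ^ 3)"
      by (simp add: power3_eq_cube power2_eq_square algebra_simps)
    also have "\<dots> \<le> a * (?\<rho> * ?W ^ 3)" using a \<rho> W by (intro mult_right_mono mult_nonneg_nonneg) auto
    finally show "\<bar>variance_rate v \<mu> (m + r) - variance_rate v \<mu> (m + r')\<bar> \<le> a * ?\<rho> * ?W ^ 3" by simp
  qed
qed

text \<open>The equations say that \<open>h + v - n * \<mu>\<close> is a martingale and that \<open>w\<close> corrects its conditional
  variance \<open>variance_rate v \<mu> b / weight b\<close> to the constant \<open>\<sigma>2\<close>.\<close>

lemma correctors:
  obtains \<mu> v w \<sigma>2 D where "0 < \<mu>" "\<mu> \<le> 1" "0 \<le> D"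
    "\<And>b. state b \<Longrightarrow> \<bar>v b\<bar> \<le> D * weight b"
    "\<And>m r r'. state m \<Longrightarrow> 0 \<notin># r \<Longrightarrow> 0 \<notin># r' \<Longrightarrow>
      \<bar>v (m + r) - v (m + r')\<bar> \<le> D * (weight r + weight r') * (weight m + weight r + weight r')"
    "\<And>b. state b \<Longrightarrow> weight b * (v b + \<mu>) = low_sum v b + tops b * (1 + v (rise b))"
    "\<And>b. state b \<Longrightarrow> \<bar>w b\<bar> \<le> D * weight b ^ 3"
    "\<And>b. state b \<Longrightarrow>
      weight b * (w b + \<sigma>2) = variance_rate v \<mu> b + low_sum w b + tops b * w (rise b)"
proof (rule poisson[of 1 weight 1])
  show "\<bar>weight b\<bar> \<le> 1 * weight b ^ 1" if "state b" for b using weight_ge_1[OF that] by simp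
  show "\<bar>weight (m + r) - weight (m + r')\<bar> \<le> 1 * (weight r + weight r') * (weight m + weight r + weight r') ^ 1"
    if m: "state m" for m r r'
  proof -
    have nn: "1 \<le> weight m" "0 \<le> weight r" "0 \<le> weight r'" using weight_ge_1[OF m] weight_nonneg by auto
    have "(weight r + weight r') * 1 \<le> (weight r + weight r') * (weight m + weight r + weight r')"
      using nn by (intro mult_left_mono) auto
    then show ?thesis using nn by simp
  qed
  fix u x D1
  assume D1: "0 \<le> D1"
    and u_eq: "\<And>b. state b \<Longrightarrow> weight b * u b = weight b - tops b * x + low_sum u b + tops b * u (rise b)"
    and u_le: "\<And>b. state b \<Longrightarrow> \<bar>u b\<bar> \<le> D1 * weight b ^ 1"
    and u_lip: "\<And>m r r'. state m \<Longrightarrow> 0 \<notin># r \<Longrightarrow> 0 \<notin># r' \<Longrightarrow>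
      \<bar>u (m + r) - u (m + r')\<bar> \<le> D1 * (weight r + weight r') * (weight m + weight r + weight r') ^ 1"
    and x: "(\<And>b. state b \<Longrightarrow> weight b \<le> weight b) \<Longrightarrow> 1 \<le> x"
  have x1: "1 \<le> x" using x by blast
  \<comment> \<open>u belongs to unit cost per step, so x is the mean number of steps per level and
    1 / x the speed of the height.\<close>
  define \<mu> where "\<mu> = 1 / x"
  have \<mu>: "0 < \<mu>" "\<mu> \<le> 1" using x1 by (auto simp: \<mu>_def)
  \<comment> \<open>The factor - \<mu> turns steps minus x per level into levels minus \<mu> per
    step.\<close>
  define v where "v b = - \<mu> * u b" for b
  have v_le: "\<bar>v b\<bar> \<le> D1 * weight b" if "state b" for b
  proof -
    have "\<mu> * \<bar>u b\<bar> \<le> 1 * (D1 * weight b ^ 1)" using \<mu> u_le[OF that] by (intro mult_mono) auto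
    then show ?thesis using \<mu> by (simp add: v_def abs_mult)
  qed
  have v_lip: "\<bar>v (m + r) - v (m + r')\<bar> \<le> D1 * (weight r + weight r') * (weight m + weight r + weight r')"
    if "state m" "0 \<notin># r" "0 \<notin># r'" for m r r'
  proof -
    have "\<mu> * \<bar>u (m + r) - u (m + r')\<bar> \<le> 1 * (D1 * (weight r + weight r') * (weight m + weight r + weight r') ^ 1)"
      using \<mu> u_lip[OF that] by (intro mult_mono) auto
    moreover have "v (m + r) - v (m + r') = - \<mu> * (u (m + r) - u (m + r'))" by (simp add: v_def algebra_simps)
    ultimately show ?thesis using \<mu> by (simp add: abs_mult)
  qed
  have v_eq: "weight b * (v b + \<mu>) = low_sum v b + tops b * (1 + v (rise b))" if "state b" for b
  proof -
    have "weight b * (v b + \<mu>) = \<mu> * (weight b - weight b * u b)" by (simp add: v_def algebra_simps)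
    also have "\<dots> = tops b * (\<mu> * x) - \<mu> * low_sum u b - \<mu> * tops b * u (rise b)"
      unfolding u_eq[OF that] by (simp add: algebra_simps)
    also have "\<mu> * x = 1" using x1 by (simp add: \<mu>_def)
    also have "tops b * 1 - \<mu> * low_sum u b - \<mu> * tops b * u (rise b) = low_sum v b + tops b * (1 + v (rise b))"
      unfolding v_def low_sum_cmult by (simp add: algebra_simps)
    finally show ?thesis .
  qed
  show thesis
  proof (rule variance_rate_bounds[OF D1 less_imp_le[OF \<mu>(1)] \<mu>(2), of v])
    fix a
    assume a: "\<And>b. state b \<Longrightarrow> \<bar>variance_rate v \<mu> b\<bar> \<le> a * weight b ^ 3"
      and a': "\<And>m r r'. state m \<Longrightarrow> 0 \<notin># r \<Longrightarrow> 0 \<notin># r' \<Longrightarrow>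
      \<bar>variance_rate v \<mu> (m + r) - variance_rate v \<mu> (m + r')\<bar>
        \<le> a * (weight r + weight r') * (weight m + weight r + weight r') ^ 3"
    show thesis
    proof (rule poisson[of 3 "variance_rate v \<mu>" a])
      fix u' y D2
      assume D2: "0 \<le> D2"
        and u'_eq: "\<And>b. state b \<Longrightarrow>
          weight b * u' b = variance_rate v \<mu> b - tops b * y + low_sum u' b + tops b * u' (rise b)"
        and u'_le: "\<And>b. state b \<Longrightarrow> \<bar>u' b\<bar> \<le> D2 * weight b ^ 3"
      \<comment> \<open>y is the mean variance per level. Subtracting a multiple of u, which
        converts levels into steps, makes it y / x = y * \<mu> per step.\<close>
      define w where "w b = u' b + (y * \<mu>) * (- 1 * u b)" for b
      show thesis
      proof (rule that[of \<mu> "D1 + D2 + \<bar>y * \<mu>\<bar> * D1" v w "y * \<mu>", OF \<mu>])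
        let ?D = "D1 + D2 + \<bar>y * \<mu>\<bar> * D1"
        show "0 \<le> ?D" using D1 D2 by simp
        have D1_le: "D1 \<le> ?D" using D1 D2 by simp
        fix b assume b: "state b"
        have w1: "1 \<le> weight b" by (rule weight_ge_1[OF b])
        show "\<bar>v b\<bar> \<le> ?D * weight b"
          using v_le[OF b] mult_right_mono[OF D1_le, of "weight b"] w1 by linarith
        have "weight b ^ 1 \<le> weight b ^ 3" using w1 by (intro power_increasing) auto
        then have "\<bar>u b\<bar> \<le> D1 * weight b ^ 3" using u_le[OF b] D1 mult_left_mono by fastforce
        then have "\<bar>y * \<mu>\<bar> * \<bar>u b\<bar> \<le> \<bar>y * \<mu>\<bar> * (D1 * weight b ^ 3)" by (intro mult_left_mono) auto
        moreover have "\<bar>w b\<bar> \<le> \<bar>u' b\<bar> + \<bar>y * \<mu>\<bar> * \<bar>u b\<bar>"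
          unfolding w_def abs_mult[symmetric] by simp
        moreover have "0 \<le> D1 * weight b ^ 3" using D1 w1 by simp
        ultimately show "\<bar>w b\<bar> \<le> ?D * weight b ^ 3"
          using u'_le[OF b] by (simp add: distrib_right mult.assoc)
        show "weight b * (v b + \<mu>) = low_sum v b + tops b * (1 + v (rise b))" by (rule v_eq[OF b])
        have "\<mu> * x = 1" using x1 by (simp add: \<mu>_def)
        have "weight b * w b = weight b * u' b - y * \<mu> * (weight b * u b)" by (simp add: w_def algebra_simps)
        also have "\<dots> = variance_rate v \<mu> b - y * \<mu> * weight b + (low_sum u' b - y * \<mu> * low_sum u b)
            + tops b * (u' (rise b) - y * \<mu> * u (rise b)) + tops b * y * (\<mu> * x - 1)"
          unfolding u_eq[OF b] u'_eq[OF b] by (simp add: algebra_simps)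
        also have "low_sum u' b - y * \<mu> * low_sum u b = low_sum w b"
          unfolding w_def low_sum_plus low_sum_cmult by simp
        finally show "weight b * (w b + y * \<mu>) = variance_rate v \<mu> b + low_sum w b + tops b * w (rise b)"
          by (simp add: \<open>\<mu> * x = 1\<close> w_def algebra_simps)
      next
        fix m and r r' :: "nat multiset" assume m: "state m" and r: "0 \<notin># r" "0 \<notin># r'"
        have "D1 * ((weight r + weight r') * (weight m + weight r + weight r'))
            \<le> (D1 + D2 + \<bar>y * \<mu>\<bar> * D1) * ((weight r + weight r') * (weight m + weight r + weight r'))"
          using D1 D2 weight_nonneg[of m] weight_nonneg[of r] weight_nonneg[of r']
          by (intro mult_right_mono mult_nonneg_nonneg) auto
        then show "\<bar>v (m + r) - v (m + r')\<bar>
            \<le> (D1 + D2 + \<bar>y * \<mu>\<bar> * D1) * (weight r + weight r') * (weight m + weight r + weight r')"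
          using v_lip[OF m r] by (simp add: mult.assoc)
      qed
    qed (use a a' in auto)
  qed (use v_le v_lip in auto)
qed auto


section \<open>The chain of heights and profiles\<close>

definition step :: "(nat \<Rightarrow> nat multiset \<Rightarrow> real) \<Rightarrow> nat \<Rightarrow> nat multiset \<Rightarrow> real" where
  "step f h b = (low_sum (f h) b + tops b * f (Suc h) (rise b)) / weight b"

lemma step_rise_le:
  assumes b: "state b" and f: "\<And>h b. state b \<Longrightarrow> 0 \<le> f h b"
  shows "f (Suc h) (rise b) / weight b \<le> step f h b"
proof -
  have "0 \<le> low_sum (f h) b" using f b by (intro low_sum_nonneg) (auto intro: state_ring)
  moreover have "1 * f (Suc h) (rise b) \<le> tops b * f (Suc h) (rise b)"
    using f[OF state_rise] tops_ge_1[OF b] by (intro mult_right_mono)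
  ultimately show ?thesis
    unfolding step_def using weight_ge_1[OF b] by (intro divide_right_mono) auto
qed

lemma state_iterate_rise: "state b \<Longrightarrow> state ((rise ^^ n) b)"
  by (induction n) (auto intro: state_rise)

lemma weight_iterate_rise:
  assumes "state b" "weight b \<le> R" "real d \<le> (1 - \<alpha>) * R"
  shows "weight ((rise ^^ n) b) \<le> R"
proof (induction n)
  case (Suc n)
  have "weight (rise ((rise ^^ n) b)) \<le> \<alpha> * weight ((rise ^^ n) b) + real d"
    by (rule weight_rise_le'[OF state_iterate_rise[OF assms(1)]])
  also have "\<dots> \<le> \<alpha> * R + (1 - \<alpha>) * R" using Suc al0 assms by (intro add_mono mult_left_mono) auto
  also have "\<dots> = R" by (simp add: algebra_simps)
  finally show ?case by simp
qed (use assms in simp)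

lemma iterate_step_nonneg:
  assumes "state b" "\<And>h b. state b \<Longrightarrow> 0 \<le> f h b"
  shows "0 \<le> (step ^^ n) f h b"
  using assms(1)
proof (induction n arbitrary: h b)
  case (Suc n)
  then show ?case
    using weight_ge_1[OF Suc.prems] tops_ge_1[OF Suc.prems]
    by (auto simp: step_def intro!: divide_nonneg_nonneg add_nonneg_nonneg low_sum_nonneg mult_nonneg_nonneg
        intro: state_ring state_rise)
qed (use assms in simp)

text \<open>A lower bound along one path: each of n consecutive rises has probability at least 1 /
  R, since the weight never exceeds R on the way.\<close>

lemma iterate_step_rise:
  assumes b: "state b" "weight b \<le> R" and R: "real d \<le> (1 - \<alpha>) * R"
    and f: "\<And>h b. state b \<Longrightarrow> 0 \<le> f h b" "\<And>h b. f h b = f 0 b"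
  shows "(1 / R) ^ n * f 0 ((rise ^^ n) b) \<le> (step ^^ n) f h b"
  using b
proof (induction n arbitrary: h b)
  case 0
  then show ?case using f(2)[of h b] by simp
next
  case (Suc n)
  have w: "1 \<le> weight b" by (rule weight_ge_1[OF Suc.prems(1)])
  have "weight (rise b) \<le> R" using weight_iterate_rise[OF Suc.prems R, of 1] by simp
  then have IH: "(1 / R) ^ n * f 0 ((rise ^^ n) (rise b)) \<le> (step ^^ n) f (Suc h) (rise b)"
    by (rule Suc.IH[OF state_rise])
  have "(1 / R) ^ Suc n * f 0 ((rise ^^ Suc n) b) = (1 / R) * ((1 / R) ^ n * f 0 ((rise ^^ n) (rise b)))"
    by (simp add: funpow_swap1)
  also have "\<dots> \<le> (1 / weight b) * (step ^^ n) f (Suc h) (rise b)"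
    using IH w Suc.prems f(1)[OF state_iterate_rise[OF state_rise]]
    by (intro mult_mono) (auto simp: frac_le intro!: mult_nonneg_nonneg)
  also have "\<dots> \<le> step ((step ^^ n) f) h b"
    using step_rise_le[of b "(step ^^ n) f" h] Suc.prems(1) iterate_step_nonneg f(1) by auto
  finally show ?case by simp
qed

lemma le_threshold_plus_power4:
  fixes x T :: real
  assumes "0 \<le> x" "0 < T"
  shows "x \<le> T + x ^ 4 / T ^ 3"
proof (cases "x \<le> T")
  case True
  then show ?thesis using assms by (simp add: add_increasing2)
next
  case False
  then have "x * T ^ 3 \<le> x * x ^ 3" using assms by (intro mult_left_mono power_mono) auto
  then have "x \<le> x ^ 4 / T ^ 3" using assms by (simp add: pos_le_divide_eq power_Suc[symmetric] del: power_Suc)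
  then show ?thesis using assms by simp
qed

end

text \<open>The Markov property enters through expectations at single times,
  \<open>chain_step\<close>; the joint behaviour of different times enters through
  \<open>chain_mono\<close>, for the strong law. Finitely many values at each time make all
  functions integrable.\<close>

locale profile_chain = boundary_profile d \<alpha> + prob_space M
  for d :: nat and \<alpha> :: real and M :: "'w measure"
    and H :: "nat \<Rightarrow> 'w \<Rightarrow> nat" and X :: "nat \<Rightarrow> 'w \<Rightarrow> nat multiset" +
  assumes chain_measurable: "\<And>n. (\<lambda>\<omega>. (H n \<omega>, X n \<omega>)) \<in> M \<rightarrow>\<^sub>M count_space UNIV"
    and chain_finite: "\<And>n. \<exists>S. finite S \<and> (AE \<omega> in M. (H n \<omega>, X n \<omega>) \<in> S)"
    and chain_state: "\<And>n. AE \<omega> in M. state (X n \<omega>)"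
    and chain_start: "AE \<omega> in M. H 0 \<omega> = 0 \<and> X 0 \<omega> = replicate_mset d 0"
    and chain_mono: "\<And>n. AE \<omega> in M. H n \<omega> \<le> H (Suc n) \<omega>"
    and chain_step: "\<And>n f. (\<integral>\<omega>. f (H (Suc n) \<omega>) (X (Suc n) \<omega>) \<partial>M) = (\<integral>\<omega>. step f (H n \<omega>) (X n \<omega>) \<partial>M)"
begin

section \<open>Expectations, moments and long-run averages\<close>

definition ex :: "nat \<Rightarrow> (nat \<Rightarrow> nat multiset \<Rightarrow> real) \<Rightarrow> real" where
  "ex n f = (\<integral>\<omega>. f (H n \<omega>) (X n \<omega>) \<partial>M)"

lemma borel_chain: "(\<lambda>\<omega>. f (H n \<omega>) (X n \<omega>)) \<in> borel_measurable M"
  for f :: "nat \<Rightarrow> nat multiset \<Rightarrow> 'b :: topological_space"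
proof -
  have "(\<lambda>\<omega>. (\<lambda>(h, b). f h b) (H n \<omega>, X n \<omega>)) \<in> borel_measurable M"
    by (rule measurable_compose[OF chain_measurable]) simp
  then show ?thesis by simp
qed

lemma integrable_chain: "integrable M (\<lambda>\<omega>. f (H n \<omega>) (X n \<omega>))"
  for f :: "nat \<Rightarrow> nat multiset \<Rightarrow> 'b :: {banach, second_countable_topology}"
proof -
  obtain S where S: "finite S" "AE \<omega> in M. (H n \<omega>, X n \<omega>) \<in> S" using chain_finite by blast
  have "AE \<omega> in M. norm (f (H n \<omega>) (X n \<omega>)) \<le> (\<Sum>(h, b)\<in>S. norm (f h b))"
    using S(2)
  proof eventually_elim
    case (elim \<omega>)
    then show ?case
      using member_le_sum[OF elim, of "\<lambda>(h, b). norm (f h b)"] S(1) by auto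
  qed
  then show ?thesis by (rule integrable_const_bound[OF _ borel_chain])
qed

lemma ex_mono:
  assumes "\<And>h b. state b \<Longrightarrow> f h b \<le> g h b"
  shows "ex n f \<le> ex n g"
  unfolding ex_def
  by (rule integral_mono_AE[OF integrable_chain integrable_chain])
    (use chain_state[of n] assms in \<open>auto elim!: eventually_mono\<close>)

lemma ex_cong:
  assumes "\<And>h b. state b \<Longrightarrow> f h b = g h b"
  shows "ex n f = ex n g"
  by (intro antisym ex_mono) (auto simp: assms)

lemma ex_add: "ex n (\<lambda>h b. f h b + g h b) = ex n f + ex n g"
  unfolding ex_def by (rule Bochner_Integration.integral_add[OF integrable_chain integrable_chain])

lemma ex_diff: "ex n (\<lambda>h b. f h b - g h b) = ex n f - ex n g"
  unfolding ex_def by (rule Bochner_Integration.integral_diff[OF integrable_chain integrable_chain])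

lemma ex_cmult: "ex n (\<lambda>h b. c * f h b) = c * ex n f"
  unfolding ex_def by simp

lemma ex_const: "ex n (\<lambda>_ _. c) = c"
  unfolding ex_def by (simp add: prob_space)

lemma ex_nonneg: "(\<And>h b. state b \<Longrightarrow> 0 \<le> f h b) \<Longrightarrow> 0 \<le> ex n f"
  using ex_mono[of "\<lambda>_ _. 0" f n] by (simp add: ex_const)

lemma ex_Suc: "ex (Suc n) f = ex n (step f)"
  unfolding ex_def by (rule chain_step)

lemma ex_shift: "ex (j + n) f = ex j ((step ^^ n) f)"
  by (induction n arbitrary: f) (auto simp: ex_Suc funpow_swap1)

lemma ex_0: "ex 0 f = f 0 (replicate_mset d 0)"
proof -
  have "ex 0 f = (\<integral>\<omega>. f 0 (replicate_mset d 0) \<partial>M)"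
    unfolding ex_def
  proof (rule integral_cong_AE[OF borel_chain])
    show "AE \<omega> in M. f (H 0 \<omega>) (X 0 \<omega>) = f 0 (replicate_mset d 0)"
      using chain_start by eventually_elim simp
  qed simp
  then show ?thesis by (simp add: prob_space)
qed

text \<open>Up to a constant, one step lowers V on average by at least (1 - \<delta> - \<gamma>) *
  tops b * V b / weight b, which is at least of order weight ^ (p - 1). Hence the sums of these
  moments are linear in time, and V itself grows at most linearly.\<close>

lemma moment_bound:
  assumes p: "1 \<le> p"
  obtains K where "0 \<le> K" "\<And>n. (\<Sum>j<n. ex j (\<lambda>_ b. weight b ^ (p - 1))) \<le> K * (real n + 1)"
    "\<And>n. ex n (\<lambda>_ b. weight b ^ p) \<le> K * (real n + 1)"
proof (rule lyapunov[OF p])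
  fix V C \<delta> \<gamma>
  assume par: "0 \<le> \<delta>" "0 \<le> \<gamma>" "\<delta> + \<gamma> < 1" "1 \<le> C"
    and V: "\<And>b. weight b ^ p \<le> V b"
    and low: "\<And>b. state b \<Longrightarrow> low_sum V b \<le> (weight b - tops b + \<delta> * tops b) * V b + C * tops b"
    and top: "\<And>b. state b \<Longrightarrow> V (rise b) \<le> \<gamma> * V b + C"
  define \<epsilon> where "\<epsilon> = 1 - \<delta> - \<gamma>"
  have \<epsilon>: "0 < \<epsilon>" "\<epsilon> \<le> 1" using par by (auto simp: \<epsilon>_def)
  have drift: "step (\<lambda>_. V) h b \<le> V b - \<epsilon> * weight b ^ (p - 1) + 2 * C" if b: "state b" for h b
  proof -
    have w: "1 \<le> weight b" and k: "1 \<le> tops b" using b weight_ge_1 tops_ge_1 by auto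
    have "weight b * weight b ^ (p - 1) = weight b ^ p" using p by (cases p) auto
    also have "\<dots> \<le> tops b * V b" using mult_mono[OF k V[of b]] w k by simp
    finally have 1: "\<epsilon> * (weight b * weight b ^ (p - 1)) \<le> \<epsilon> * (tops b * V b)" using \<epsilon> by (intro mult_left_mono) auto
    have 2: "2 * C * tops b \<le> 2 * C * weight b" using par weight_ge_tops[of b] by (intro mult_left_mono) auto
    have "low_sum V b + tops b * V (rise b)
        \<le> ((weight b - tops b + \<delta> * tops b) * V b + C * tops b) + tops b * (\<gamma> * V b + C)"
      using low[OF b] top[OF b] k by (intro add_mono mult_left_mono) auto
    also have "\<dots> = weight b * V b - \<epsilon> * (tops b * V b) + 2 * C * tops b"
      by (simp add: \<epsilon>_def algebra_simps)
    also have "\<dots> \<le> weight b * (V b - \<epsilon> * weight b ^ (p - 1) + 2 * C)"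
      using 1 2 by (simp add: algebra_simps)
    finally show ?thesis unfolding step_def using w by (simp add: pos_divide_le_eq mult.commute)
  qed
  have sum: "ex n (\<lambda>_. V) + \<epsilon> * (\<Sum>j<n. ex j (\<lambda>_ b. weight b ^ (p - 1))) \<le> V (replicate_mset d 0) + 2 * C * real n" for n
  proof (induction n)
    case (Suc n)
    have "ex (Suc n) (\<lambda>_. V) \<le> ex n (\<lambda>_ b. V b - \<epsilon> * weight b ^ (p - 1) + 2 * C)"
      unfolding ex_Suc using drift by (intro ex_mono)
    also have "\<dots> = ex n (\<lambda>_. V) - \<epsilon> * ex n (\<lambda>_ b. weight b ^ (p - 1)) + 2 * C"
      by (simp add: ex_add ex_diff ex_cmult ex_const)
    finally show ?case using Suc by (simp add: algebra_simps)
  qed (simp add: ex_0)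
  have V0: "0 \<le> V b" for b using V[of b] weight_nonneg[of b] by (meson order_trans zero_le_power)
  define K where "K = (V (replicate_mset d 0) + 2 * C) / \<epsilon>"
  have K: "V (replicate_mset d 0) + 2 * C * real n \<le> \<epsilon> * (K * (real n + 1))" for n
  proof -
    have "0 \<le> V (replicate_mset d 0) * real n" "0 \<le> 2 * C" using V0 par by auto
    moreover have "\<epsilon> * (K * (real n + 1)) = (V (replicate_mset d 0) + 2 * C) * (real n + 1)"
      using \<epsilon> by (simp add: K_def)
    ultimately show ?thesis by (simp add: algebra_simps)
  qed
  have K0: "0 \<le> K" using \<epsilon> V0 par by (simp add: K_def)
  show thesis
  proof (rule that[OF K0])
    fix n
    have "0 \<le> ex n (\<lambda>_. V)" by (intro ex_nonneg V0)
    then have "\<epsilon> * (\<Sum>j<n. ex j (\<lambda>_ b. weight b ^ (p - 1))) \<le> \<epsilon> * (K * (real n + 1))"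
      using sum[of n] K[of n] by linarith
    then show "(\<Sum>j<n. ex j (\<lambda>_ b. weight b ^ (p - 1))) \<le> K * (real n + 1)" using \<epsilon> by simp
    have "ex n (\<lambda>_ b. weight b ^ p) \<le> ex n (\<lambda>_. V)" by (intro ex_mono V)
    also have "0 \<le> (\<Sum>j<n. ex j (\<lambda>_ b. weight b ^ (p - 1)))" by (intro sum_nonneg ex_nonneg) (auto simp: weight_nonneg)
    then have "ex n (\<lambda>_. V) \<le> \<epsilon> * (K * (real n + 1))"
      using sum[of n] K[of n] \<epsilon> by (smt (verit) mult_nonneg_nonneg)
    also have "\<dots> \<le> 1 * (K * (real n + 1))" using \<epsilon> K0 by (intro mult_right_mono) auto
    finally show "ex n (\<lambda>_ b. weight b ^ p) \<le> K * (real n + 1)" by simp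
  qed
qed

text \<open>Interpolation with the linear bound for the moment of order 4 * p, through x \<le> T + x
  ^ 4 / T ^ 3 at T = (n + 1) ^ (1 / 4). A growth of order n ^ (1 / 4) is negligible at scale sqrt
  n.\<close>

lemma moment_growth:
  assumes p: "1 \<le> p"
  shows "\<exists>K\<ge>0. \<forall>n. ex n (\<lambda>_ b. weight b ^ p) \<le> K * sqrt (sqrt (real n + 1))"
proof (rule moment_bound[of "p * 4"])
  show "1 \<le> p * 4" using p by simp
  fix K
  assume K: "0 \<le> K" and le: "\<And>n. ex n (\<lambda>_ b. weight b ^ (p * 4)) \<le> K * (real n + 1)"
  show ?thesis
  proof (intro exI[of _ "1 + K"] conjI allI)
    fix n
    define T where "T = sqrt (sqrt (real n + 1))"
    have T: "0 < T" by (simp add: T_def)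
    have T4: "T ^ 4 = real n + 1"
      using power_mult[of T 2 2] by (simp add: T_def real_sqrt_pow2)
    have "ex n (\<lambda>_ b. weight b ^ p) \<le> ex n (\<lambda>_ b. T + (1 / T ^ 3) * weight b ^ (p * 4))"
      using le_threshold_plus_power4[OF _ T] weight_nonneg
      by (intro ex_mono) (simp add: power_mult)
    also have "\<dots> \<le> T + (1 / T ^ 3) * (K * (real n + 1))"
      unfolding ex_add ex_cmult ex_const using T le by (intro add_mono mult_left_mono) auto
    also have "\<dots> = (1 + K) * T"
      unfolding T4[symmetric] using T by (simp add: field_simps power_numeral_reduce)
    finally show "ex n (\<lambda>_ b. weight b ^ p) \<le> (1 + K) * sqrt (sqrt (real n + 1))" by (simp add: T_def)
  qed (use K in simp)
qed

text \<open>The mean weight is bounded on average in time, so a positive fraction of time is spent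
  at weight at most R, and from there f has mean at least c after N more steps.\<close>

lemma average_positive:
  assumes f: "\<And>h b. state b \<Longrightarrow> 0 \<le> f h b"
    and pos: "\<And>R. \<exists>n c. 0 < c \<and> (\<forall>h b. state b \<longrightarrow> weight b \<le> R \<longrightarrow> c \<le> (step ^^ n) f h b)"
  shows "\<exists>c N. 0 < c \<and> (\<forall>n. c * (real n - 1) \<le> (\<Sum>j<n + N. ex j f))"
proof -
  obtain K where K: "0 \<le> K" "\<And>n. (\<Sum>j<n. ex j (\<lambda>_ b. weight b ^ 1)) \<le> K * (real n + 1)"
    by (rule moment_bound[of 2]) auto
  define R where "R = 2 * (K + 1)"
  have R: "0 < R" using K by (simp add: R_def)
  obtain N c where c: "0 < c" "\<And>h b. state b \<Longrightarrow> weight b \<le> R \<Longrightarrow> c \<le> (step ^^ N) f h b"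
    using pos[of R] by blast
  \<comment> \<open>A linear minorant of c times the indicator of weight b \<le> R, so that only the
    first moment of the weight enters.\<close>
  have lower: "c * (1 - weight b / R) \<le> (step ^^ N) f h b" if b: "state b" for h b
  proof (cases "weight b \<le> R")
    case True
    have "c * (1 - weight b / R) \<le> c * 1" using c R weight_nonneg[of b] by (intro mult_left_mono) auto
    then show ?thesis using c(2)[OF b True, of h] by linarith
  next
    case False
    then have "c * (1 - weight b / R) \<le> 0" using c R by (intro mult_nonneg_nonpos) auto
    moreover have "0 \<le> (step ^^ N) f h b" by (rule iterate_step_nonneg[OF b f])
    ultimately show ?thesis by linarith
  qed
  have "c / 2 * (real n - 1) \<le> (\<Sum>j<n + N. ex j f)" for n
  proof -
    have "(\<Sum>j<n. c * (1 - ex j (\<lambda>_ b. weight b ^ 1) / R)) \<le> (\<Sum>j<n. ex (j + N) f)"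
    proof (rule sum_mono)
      fix j
      have "c * (1 - ex j (\<lambda>_ b. weight b ^ 1) / R) = ex j (\<lambda>_ b. c * (1 - (1 / R) * weight b ^ 1))"
        by (simp only: ex_cmult ex_diff ex_const) simp
      also have "\<dots> \<le> ex j ((step ^^ N) f)" using lower by (intro ex_mono) simp
      finally show "c * (1 - ex j (\<lambda>_ b. weight b ^ 1) / R) \<le> ex (j + N) f" by (simp add: ex_shift)
    qed
    also have "(\<Sum>j<n. ex (j + N) f) = (\<Sum>j=N..<n + N. ex j f)"
      using sum.shift_bounds_nat_ivl[of "\<lambda>j. ex j f" 0 N n] by (simp only: add_0 atLeast0LessThan)
    also have "\<dots> \<le> (\<Sum>j<n + N. ex j f)" using f by (intro sum_mono2 ex_nonneg) auto
    finally have 1: "(\<Sum>j<n. c * (1 - ex j (\<lambda>_ b. weight b ^ 1) / R)) \<le> (\<Sum>j<n + N. ex j f)" .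
    have "(\<Sum>j<n. c * (1 - ex j (\<lambda>_ b. weight b ^ 1) / R)) = c * (real n - (\<Sum>j<n. ex j (\<lambda>_ b. weight b ^ 1)) / R)"
      by (simp add: sum_distrib_left[symmetric] sum_subtractf sum_divide_distrib)
    moreover have "(\<Sum>j<n. ex j (\<lambda>_ b. weight b ^ 1)) / R \<le> (real n + 1) / 2"
    proof -
      have "(\<Sum>j<n. ex j (\<lambda>_ b. weight b ^ 1)) \<le> (K + 1) * (real n + 1)"
        using K(2)[of n] K(1) by (simp add: algebra_simps)
      then show ?thesis using R K(1) by (simp add: R_def field_simps)
    qed
    then have "c * ((real n - 1) / 2) \<le> c * (real n - (\<Sum>j<n. ex j (\<lambda>_ b. weight b ^ 1)) / R)"
      using c by (intro mult_left_mono) (auto simp: field_simps)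
    moreover have "c / 2 * (real n - 1) = c * ((real n - 1) / 2)" by simp
    ultimately show ?thesis using 1 by linarith
  qed
  then show ?thesis using c by (intro exI[of _ "c / 2"] exI[of _ N]) auto
qed

end

section \<open>Non-degeneracy of speed and variance, second moment of the height\<close>

lemma tendsto_sqrt_sqrt_over_sqrt: "(\<lambda>n. sqrt (sqrt (real n + 1)) / sqrt (real n)) \<longlonglongrightarrow> 0"
proof -
  have "(\<lambda>n. sqrt (sqrt (1 / real n + 1 / real n * (1 / real n)))) \<longlonglongrightarrow> sqrt (sqrt (0 + 0 * 0))"
    by (intro tendsto_intros)
  moreover have eq: "sqrt (sqrt (real n + 1)) / sqrt (real n) = sqrt (sqrt (1 / real n + 1 / real n * (1 / real n)))"
    if "0 < n" for n
  proof -
    have "1 / real n + 1 / real n * (1 / real n) = (real n + 1) / (real n)\<^sup>2"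
      using that by (simp add: power2_eq_square field_simps)
    then show ?thesis using that by (simp add: real_sqrt_divide)
  qed
  have "eventually (\<lambda>n. sqrt (sqrt (real n + 1)) / sqrt (real n) =
      sqrt (sqrt (1 / real n + 1 / real n * (1 / real n)))) sequentially"
    by (rule eventually_mono[OF eventually_gt_at_top[of 0]]) (rule eq)
  ultimately show ?thesis by (simp add: tendsto_cong)
qed

lemma tendsto_sqrt_sqrt_over: "(\<lambda>n. sqrt (sqrt (real n + 1)) / real n) \<longlonglongrightarrow> 0"
proof -
  have "(\<lambda>n. sqrt (sqrt (real n + 1)) / sqrt (real n) * sqrt (1 / real n)) \<longlonglongrightarrow> 0 * sqrt 0"
    by (intro tendsto_intros tendsto_sqrt_sqrt_over_sqrt)
  moreover have "x / sqrt (real n) * sqrt (1 / real n) = x / real n" for x n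
    by (simp add: real_sqrt_divide)
  ultimately show ?thesis by simp
qed

locale corrected_profile = boundary_profile +
  fixes \<mu> \<sigma>2 D :: real and v w :: "nat multiset \<Rightarrow> real"
  assumes \<mu>0: "0 < \<mu>" and \<mu>1: "\<mu> \<le> 1" and D0: "0 \<le> D"
    and v_le: "\<And>b. state b \<Longrightarrow> \<bar>v b\<bar> \<le> D * weight b"
    and v_lipschitz: "\<And>m r r'. state m \<Longrightarrow> 0 \<notin># r \<Longrightarrow> 0 \<notin># r' \<Longrightarrow>
      \<bar>v (m + r) - v (m + r')\<bar> \<le> D * (weight r + weight r') * (weight m + weight r + weight r')"
    and v_eq: "\<And>b. state b \<Longrightarrow> weight b * (v b + \<mu>) = low_sum v b + tops b * (1 + v (rise b))"
    and w_le: "\<And>b. state b \<Longrightarrow> \<bar>w b\<bar> \<le> D * weight b ^ 3"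
    and w_eq: "\<And>b. state b \<Longrightarrow>
      weight b * (w b + \<sigma>2) = variance_rate v \<mu> b + low_sum w b + tops b * w (rise b)"

locale corrected_chain = corrected_profile d \<alpha> \<mu> \<sigma>2 D v w + profile_chain d \<alpha> M H X
  for d \<alpha> \<mu> \<sigma>2 D v w and M :: "'w measure" and H X
begin

lemma ex_drift: "ex n (\<lambda>h b. real h + v b) = \<mu> * real n + v (replicate_mset d 0)"
proof (induction n)
  case (Suc n)
  have "step (\<lambda>h b. real h + v b) h b = (real h + v b) + \<mu>" if b: "state b" for h b
  proof -
    have "low_sum (\<lambda>b. real h + v b) b + tops b * (real (Suc h) + v (rise b)) = weight b * ((real h + v b) + \<mu>)"
      using v_eq[OF b] by (simp add: low_sum_plus low_sum_const algebra_simps)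
    then show ?thesis using weight_ge_1[OF b] by (simp add: step_def field_simps)
  qed
  then have "ex (Suc n) (\<lambda>h b. real h + v b) = ex n (\<lambda>h b. (real h + v b) + \<mu>)"
    unfolding ex_Suc by (intro ex_cong)
  then show ?case using Suc by (simp only: ex_add ex_const) (simp add: algebra_simps)
qed (simp add: ex_0)

lemma ex_abs_le:
  assumes "\<And>h b. state b \<Longrightarrow> \<bar>f h b\<bar> \<le> K * weight b ^ p" "1 \<le> p"
  shows "\<exists>K. \<forall>n. \<bar>ex n f\<bar> \<le> K * sqrt (sqrt (real n + 1))"
proof -
  obtain K' where K': "0 \<le> K'" "\<And>n. ex n (\<lambda>_ b. weight b ^ p) \<le> K' * sqrt (sqrt (real n + 1))"
    using moment_growth[OF assms(2)] by blast
  have "\<bar>ex n f\<bar> \<le> \<bar>K\<bar> * K' * sqrt (sqrt (real n + 1))" for n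
  proof -
    have f: "\<bar>f h b\<bar> \<le> \<bar>K\<bar> * weight b ^ p" if "state b" for h b
      using assms(1)[OF that, of h] mult_right_mono[of K "\<bar>K\<bar>" "weight b ^ p"] weight_nonneg[of b] by fastforce
    have "ex n f \<le> ex n (\<lambda>_ b. \<bar>K\<bar> * weight b ^ p)"
      using f by (intro ex_mono) (auto simp: abs_le_iff)
    moreover have "ex n (\<lambda>_ b. - \<bar>K\<bar> * weight b ^ p) \<le> ex n f"
      using f by (intro ex_mono) (simp add: abs_le_iff minus_le_iff)
    ultimately have "\<bar>ex n f\<bar> \<le> \<bar>K\<bar> * ex n (\<lambda>_ b. weight b ^ p)"
      unfolding ex_cmult by (simp add: abs_le_iff)
    also have "\<dots> \<le> \<bar>K\<bar> * (K' * sqrt (sqrt (real n + 1)))" using K' by (intro mult_left_mono) auto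
    finally show ?thesis by simp
  qed
  then show ?thesis by blast
qed

lemma ex_over_n:
  assumes "\<And>h b. state b \<Longrightarrow> \<bar>f h b\<bar> \<le> K * weight b ^ p" "1 \<le> p"
  shows "(\<lambda>n. ex n f / real n) \<longlonglongrightarrow> 0"
proof -
  obtain K where K: "\<And>n. \<bar>ex n f\<bar> \<le> K * sqrt (sqrt (real n + 1))" 
    using ex_abs_le[of f K p] assms by blast
  have "(\<lambda>n. K * (sqrt (sqrt (real n + 1)) / real n)) \<longlonglongrightarrow> K * 0"
    by (intro tendsto_mult tendsto_const tendsto_sqrt_sqrt_over)
  then show ?thesis
    using K by (intro Lim_null_comparison[of "\<lambda>n. ex n f / real n" "\<lambda>n. K * (sqrt (sqrt (real n + 1)) / real n)"])
      (auto intro!: always_eventually divide_right_mono)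
qed

text \<open>1 - \<mu> is the long-run frequency of steps that leave the height unchanged. It is
  positive because after a rise a vertex of depth 1 is present and competes with the tops.\<close>

lemma mu_less_1: "\<mu> < 1"
proof -
  define f where "f h b = 1 - tops b / weight b" for h :: nat and b
  have f0: "0 \<le> f h b" if "state b" for h b
    using weight_ge_tops[of b] weight_ge_1[OF that] by (simp add: f_def)
  have pos: "\<exists>n c. 0 < c \<and> (\<forall>h b. state b \<longrightarrow> weight b \<le> R \<longrightarrow> c \<le> (step ^^ n) f h b)" for R
  proof -
    define R' where "R' = max R (real d / (1 - \<alpha>))"
    have "real d / (1 - \<alpha>) \<le> R'" by (simp add: R'_def)
    then have R': "real d \<le> (1 - \<alpha>) * R'" using al1 by (simp add: field_simps)
    have "0 < real d / (1 - \<alpha>)" using al1 d_pos by simp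
    then have R'0: "0 < R'" by (simp add: R'_def)
    have "\<alpha> / R' / R' \<le> (step ^^ 1) f h b" if b: "state b" "weight b \<le> R" for h b
    proof -
      have bR': "weight b \<le> R'" using b by (simp add: R'_def)
      have wr: "1 \<le> weight (rise b)" "weight (rise b) \<le> R'"
        using weight_ge_1[OF state_rise, of b] weight_iterate_rise[OF b(1) bR' R', of 1] by auto
      \<comment> \<open>Here d \<ge> 2 enters: a second top survives the rise and becomes a vertex
        of depth 1.\<close>
      have "0 \<in># b - {#0#}" using b(1) d2 by (simp add: state_def flip: count_greater_zero_iff)
      then have "1 \<in># lower (rise b)" by (auto simp: lower_mem rise_def)
      then obtain q where "lower (rise b) = add_mset 1 q" by (auto dest: multi_member_split)
      then have "\<alpha> \<le> weight (lower (rise b))" using weight_nonneg[of q] by (simp add: weight_def)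
      moreover have "f 0 (rise b) = weight (lower (rise b)) / weight (rise b)"
        using wr weight_split[of "rise b"] by (simp add: f_def field_simps)
      ultimately have "\<alpha> / R' \<le> f 0 (rise b)"
        using wr al0 by (simp add: frac_le)
      then have "(1 / R') * (\<alpha> / R') \<le> (1 / R') ^ 1 * f 0 ((rise ^^ 1) b)"
        using mult_left_mono[of "\<alpha> / R'" "f 0 (rise b)" "1 / R'"] R'0 by simp
      also have "\<dots> \<le> (step ^^ 1) f h b"
        by (rule iterate_step_rise[OF b(1) bR' R']) (auto simp: f0, auto simp: f_def)
      finally show ?thesis by simp
    qed
    moreover have "0 < \<alpha> / R' / R'" using al0 R'0 by simp
    ultimately show ?thesis by blast
  qed
  obtain c N where c: "0 < c" "\<And>n. c * (real n - 1) \<le> (\<Sum>j<n + N. ex j f)"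
    using average_positive[of f, OF f0 pos] by blast
  have sum: "(\<Sum>j<n. ex j f) = real n - ex n (\<lambda>h _. real h)" for n
  proof (induction n)
    case (Suc n)
    have "ex (Suc n) (\<lambda>h _. real h) = ex n (\<lambda>h b. real h + (1 - f h b))"
      unfolding ex_Suc
    proof (rule ex_cong)
      fix h b assume b: "state b"
      show "step (\<lambda>h _. real h) h b = real h + (1 - f h b)"
        using weight_ge_1[OF b] by (simp add: step_def low_sum_const f_def field_simps)
    qed
    then show ?case using Suc by (simp only: ex_add ex_diff ex_const) simp
  qed (simp add: ex_0)
  have lim: "(\<lambda>n. ex n (\<lambda>_. v) / real n) \<longlonglongrightarrow> 0"
    by (rule ex_over_n[of _ D 1]) (use v_le in auto)
  have le: "c * (real n - 1) / real n - real N / real n \<le> 1 - \<mu> - v (replicate_mset d 0) / real n + ex n (\<lambda>_. v) / real n"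
    if n: "N < n" for n
  proof -
    obtain l where l: "n = l + N" using n by (metis add.commute le_add_diff_inverse less_imp_le)
    \<comment> \<open>Absorbs the shift by N in time through c * N \<le> N. It holds because f is at
      most 1.\<close>
    have "c \<le> 1"
    proof (rule ccontr)
      assume "\<not> c \<le> 1"
      have "(\<Sum>j<m + N. ex j f) \<le> real (m + N)" for m
        using sum_mono[of "{..<m + N}" "\<lambda>j. ex j f" "\<lambda>_. 1"] ex_mono[of f "\<lambda>_ _. 1"] weight_nonneg
        by (simp add: ex_const f_def tops_def)
      then have a: "c * (real m - 1) \<le> real m + real N" for m using c(2)[of m] by (metis of_nat_add order_trans)
      obtain m :: nat where "(real N + c) / (c - 1) < real m" using reals_Archimedean2 by blast
      then have "real N + c < real m * (c - 1)" using \<open>\<not> c \<le> 1\<close> by (simp add: pos_divide_less_eq)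
      then show False using a[of m] by (simp add: algebra_simps)
    qed
    have "c * (real n - 1) - real N \<le> c * (real l - 1)"
      using \<open>c \<le> 1\<close> mult_right_mono[of c 1 "real N"] by (simp add: l algebra_simps)
    also have "\<dots> \<le> real n - ex n (\<lambda>h _. real h)" using c(2)[of l] unfolding l sum .
    also have "ex n (\<lambda>h _. real h) = \<mu> * real n + v (replicate_mset d 0) - ex n (\<lambda>_. v)"
      using ex_drift[of n] by (simp only: ex_add)
    finally have "(c * (real n - 1) - real N) / real n
        \<le> (real n - (\<mu> * real n + v (replicate_mset d 0) - ex n (\<lambda>_. v))) / real n"
      by (rule divide_right_mono) simp
    then show ?thesis using n by (simp add: diff_divide_distrib add_divide_distrib)
  qed
  have "(\<lambda>n. c * (real n - 1) / real n - real N / real n) \<longlonglongrightarrow> c"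
  proof -
    have "(\<lambda>n. c * (1 - 1 / real n) - real N / real n) \<longlonglongrightarrow> c * (1 - 0) - 0"
      by (intro tendsto_intros lim_const_over_n)
    then have "(\<lambda>n. c * (1 - 1 / real n) - real N / real n) \<longlonglongrightarrow> c" by simp
    moreover have "eventually (\<lambda>n. c * (real n - 1) / real n - real N / real n = c * (1 - 1 / real n) - real N / real n) sequentially"
      using eventually_gt_at_top[of 0] by eventually_elim (simp add: field_simps)
    ultimately show ?thesis by (simp only: tendsto_cong)
  qed
  moreover have "(\<lambda>n. 1 - \<mu> - v (replicate_mset d 0) / real n + ex n (\<lambda>_. v) / real n) \<longlonglongrightarrow> 1 - \<mu> - 0 + 0"
    by (intro tendsto_intros lim lim_const_over_n)
  ultimately have "c \<le> 1 - \<mu> - 0 + 0"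
    by (rule LIMSEQ_le) (use le in \<open>auto intro!: exI[of _ "Suc N"]\<close>)
  then show ?thesis using c by simp
qed

text \<open>Choosing a very deep vertex takes one unit of time but barely changes \<open>v\<close>, so the martingale moves
  by nearly \<open>- \<mu>\<close>; after sufficiently many consecutive rises such a vertex exists.\<close>

lemma sigma2_pos: "0 < \<sigma>2"
proof -
  define f where "f h b = variance_rate v \<mu> b / weight b" for h :: nat and b
  have rate0: "0 \<le> variance_rate v \<mu> b" if "state b" for b
    unfolding variance_rate_def using tops_ge_1[OF that]
    by (intro add_nonneg_nonneg low_sum_nonneg) auto
  have f0: "0 \<le> f h b" if "state b" for h b
    using rate0[OF that] weight_ge_1[OF that] by (simp add: f_def)
  have pos: "\<exists>n c. 0 < c \<and> (\<forall>h b. state b \<longrightarrow> weight b \<le> R \<longrightarrow> c \<le> (step ^^ n) f h b)" for R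
  proof -
    define R' where "R' = max R (real d / (1 - \<alpha>))"
    have "real d / (1 - \<alpha>) \<le> R'" by (simp add: R'_def)
    then have R': "real d \<le> (1 - \<alpha>) * R'" using al1 by (simp add: field_simps)
    have "0 < real d / (1 - \<alpha>)" using al1 d_pos by simp
    then have R'0: "0 < R'" by (simp add: R'_def)
    \<comment> \<open>On weights at most R', a ring at depth n0 + 2 changes v by at most K *
      \<alpha> ^ n0. With n0 making this at most \<mu> / 2, the martingale increment has size at
      least \<mu> / 2.\<close>
    define K where "K = (D + 1) * (1 + real d) * (R' + real d)"
    have K: "0 < K" using D0 R'0 by (simp add: K_def)
    obtain n0 where n0: "\<alpha> ^ n0 < \<mu> / 2 / K"
      using real_arch_pow_inv[of "\<mu> / 2 / K" \<alpha>] \<mu>0 K al1 by auto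
    define n where "n = Suc (Suc n0)"
    define c where "c = (1 / R') ^ n * (\<alpha> ^ n * (\<mu>\<^sup>2 / 4) / R')"
    have "c \<le> (step ^^ n) f h b" if b: "state b" "weight b \<le> R" for h b
    proof -
      have bR': "weight b \<le> R'" using b by (simp add: R'_def)
      define b' where "b' = (rise ^^ n) b"
      have b': "state b'" "weight b' \<le> R'"
        using state_iterate_rise[OF b(1)] weight_iterate_rise[OF b(1) bR' R'] by (auto simp: b'_def)
      \<comment> \<open>A second top survives the first rise, again by d \<ge> 2, and sinks by one
        with every rise.\<close>
      have "Suc j \<in># (rise ^^ Suc j) b" for j
      proof (induction j)
        case 0
        have "0 \<in># b - {#0#}" using b(1) d2 by (simp add: state_def flip: count_greater_zero_iff)
        then show ?case by (auto simp: rise_def)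
      next
        case (Suc j)
        then have "Suc j \<in># (rise ^^ Suc j) b - {#0#}" by (simp add: in_diff_count count_greater_zero_iff)
        then have "Suc (Suc j) \<in># rise ((rise ^^ Suc j) b)" unfolding rise_def by auto
        then show ?case by simp
      qed
      from this[of "Suc n0"] have n: "n \<in># b'" "0 < n" by (auto simp: b'_def n_def)
      then obtain m where m: "b' = m + {#n#}" by (auto dest: multi_member_split)
      have sm: "state m" using b'(1) n(2) by (simp add: m state_def)
      have ring: "ring n b' = m + replicate_mset d (Suc n0)" by (simp add: ring_def m n_def)
      have wm: "0 \<le> weight m" "weight m + \<alpha> ^ n \<le> R'"
        using b'(2) weight_nonneg[of m] by (auto simp: m weight_def)
      have p: "\<alpha> ^ n \<le> \<alpha> ^ n0" "\<alpha> ^ Suc n0 \<le> \<alpha> ^ n0" "\<alpha> ^ Suc n0 \<le> 1"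
        unfolding n_def using al0 al1 by (intro power_decreasing power_le_one; simp)+
      have "\<bar>v (ring n b') - v b'\<bar> \<le> D * (real d * \<alpha> ^ Suc n0 + \<alpha> ^ n) * (weight m + real d * \<alpha> ^ Suc n0 + \<alpha> ^ n)"
        using v_lipschitz[OF sm, of "replicate_mset d (Suc n0)" "{#n#}"] n(2) d_pos
        unfolding ring unfolding m by (simp add: weight_def[of "{#n#}"])
      also have "\<dots> \<le> (D + 1) * (real d * \<alpha> ^ n0 + 1 * \<alpha> ^ n0) * (R' + real d)"
      proof -
        have A: "weight m + real d * \<alpha> ^ Suc n0 + \<alpha> ^ n \<le> R' + real d"
          using wm mult_left_mono[OF p(3), of "real d"] by simp
        have B: "real d * \<alpha> ^ Suc n0 + \<alpha> ^ n \<le> real d * \<alpha> ^ n0 + 1 * \<alpha> ^ n0"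
          using p by (intro add_mono mult_left_mono) auto
        show ?thesis
          by (rule mult_mono[OF mult_mono[OF _ B] A])
            (use D0 wm al0 in \<open>auto intro!: mult_nonneg_nonneg add_nonneg_nonneg\<close>)
      qed
      also have "\<dots> = K * \<alpha> ^ n0" by (simp add: K_def algebra_simps)
      also have "\<dots> \<le> \<mu> / 2" using n0 K by (simp add: field_simps)
      finally have "\<mu> / 2 \<le> \<bar>v (ring n b') - v b' - \<mu>\<bar>" using \<mu>0 by linarith
      then have "(\<mu> / 2)\<^sup>2 \<le> (v (ring n b') - v b' - \<mu>)\<^sup>2"
        using \<mu>0 abs_le_square_iff[of "\<mu> / 2" "v (ring n b') - v b' - \<mu>"] by simp
      then have "\<alpha> ^ n * (\<mu>\<^sup>2 / 4) \<le> \<alpha> ^ n * (v (ring n b') - v b' - \<mu>)\<^sup>2"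
        using al0 by (intro mult_left_mono) (auto simp: power_divide)
      also have "\<dots> \<le> low_sum (\<lambda>b''. (v b'' - v b' - \<mu>)\<^sup>2) b'"
      proof -
        have "n \<in># lower b'" using n by (simp add: lower_mem)
        then obtain q where q: "lower b' = add_mset n q" by (auto dest: multi_member_split)
        have "0 \<le> (\<Sum>i\<in>#q. \<alpha> ^ i * (v (ring i b') - v b' - \<mu>)\<^sup>2)"
          using wsum_mono[of q "\<lambda>_. 0" "\<lambda>i. (v (ring i b') - v b' - \<mu>)\<^sup>2"] by simp
        then show ?thesis by (simp add: low_sum_def q)
      qed
      also have "\<dots> \<le> variance_rate v \<mu> b'"
        unfolding variance_rate_def using tops_ge_1[OF b'(1)] by simp
      finally have "\<alpha> ^ n * (\<mu>\<^sup>2 / 4) \<le> variance_rate v \<mu> b'" .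
      then have "\<alpha> ^ n * (\<mu>\<^sup>2 / 4) / R' \<le> f 0 b'"
        unfolding f_def using b'(2) weight_ge_1[OF b'(1)] rate0[OF b'(1)] by (intro frac_le) auto
      then have "c \<le> (1 / R') ^ n * f 0 ((rise ^^ n) b)"
        unfolding c_def b'_def using R'0 by (intro mult_left_mono) auto
      also have "\<dots> \<le> (step ^^ n) f h b"
        by (rule iterate_step_rise[OF b(1) bR' R']) (auto simp: f0, auto simp: f_def)
      finally show ?thesis .
    qed
    moreover have "0 < c" unfolding c_def using R'0 al0 \<mu>0 by simp
    ultimately show ?thesis by blast
  qed
  obtain c N where c: "0 < c" "\<And>n. c * (real n - 1) \<le> (\<Sum>j<n + N. ex j f)"
    using average_positive[of f, OF f0 pos] by blast
  \<comment> \<open>Sums \<open>w_eq\<close> over time: the average conditional variance is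
    \<sigma>2 up to boundary terms of w, which \<open>ex_over_n\<close> shows to be of smaller
    order.\<close>
  have sum: "(\<Sum>j<n. ex j f) = \<sigma>2 * real n + w (replicate_mset d 0) - ex n (\<lambda>_. w)" for n
  proof (induction n)
    case (Suc n)
    have "ex (Suc n) (\<lambda>_. w) = ex n (\<lambda>h b. w b + \<sigma>2 - f h b)"
      unfolding ex_Suc
    proof (rule ex_cong)
      fix h b assume b: "state b"
      have "low_sum w b + tops b * w (rise b) = weight b * (w b + \<sigma>2) - variance_rate v \<mu> b"
        using w_eq[OF b] by simp
      then show "step (\<lambda>_. w) h b = w b + \<sigma>2 - f h b"
        using weight_ge_1[OF b] by (simp add: step_def f_def diff_divide_distrib)
    qed
    then show ?case using Suc by (simp only: ex_add ex_diff ex_const) (simp add: algebra_simps)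
  qed (simp add: ex_0)
  have lim: "(\<lambda>n. ex n (\<lambda>_. w) / real n) \<longlonglongrightarrow> 0"
    by (rule ex_over_n[of _ D 3]) (use w_le in auto)
  have le: "c * (real n - real N - 1) / real n \<le> \<sigma>2 + w (replicate_mset d 0) / real n - ex n (\<lambda>_. w) / real n"
    if n: "N < n" for n
  proof -
    obtain l where l: "n = l + N" using n by (metis add.commute le_add_diff_inverse less_imp_le)
    have "c * (real n - real N - 1) / real n \<le> (\<sigma>2 * real n + w (replicate_mset d 0) - ex n (\<lambda>_. w)) / real n"
      using c(2)[of l] unfolding sum l by (intro divide_right_mono) auto
    then show ?thesis using n by (simp add: diff_divide_distrib add_divide_distrib)
  qed
  have "(\<lambda>n. c * (real n - real N - 1) / real n) \<longlonglongrightarrow> c"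
  proof -
    have "(\<lambda>n. c * (1 - (real N + 1) / real n)) \<longlonglongrightarrow> c * (1 - 0)"
      by (intro tendsto_intros lim_const_over_n)
    moreover have "eventually (\<lambda>n. c * (real n - real N - 1) / real n = c * (1 - (real N + 1) / real n)) sequentially"
      using eventually_gt_at_top[of 0] by eventually_elim (simp add: field_simps)
    ultimately show ?thesis by (simp add: tendsto_cong)
  qed
  moreover have "(\<lambda>n. \<sigma>2 + w (replicate_mset d 0) / real n - ex n (\<lambda>_. w) / real n) \<longlonglongrightarrow> \<sigma>2 + 0 - 0"
    by (intro tendsto_intros lim lim_const_over_n)
  ultimately have "c \<le> \<sigma>2 + 0 - 0"
    by (rule LIMSEQ_le) (use le in \<open>auto intro!: exI[of _ "Suc N"]\<close>)
  then show ?thesis using c by simp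
qed

text \<open>By \<open>v_eq\<close> the mixed term of the martingale h + v - n * \<mu> vanishes, so
  its second moment accumulates \<open>variance_rate\<close> / \<open>weight\<close>, at most of
  order weight ^ 2, whose sums are linear in n. Removing v costs a second moment of the
  weight.\<close>

lemma second_moment: "\<exists>K. \<forall>n. ex n (\<lambda>h b. (real h - real n * \<mu>)\<^sup>2) \<le> K * (real n + 1)"
proof (rule variance_rate_bounds[OF D0 less_imp_le[OF \<mu>0] \<mu>1 v_le v_lipschitz])
  fix a
  assume a: "\<And>b. state b \<Longrightarrow> \<bar>variance_rate v \<mu> b\<bar> \<le> a * weight b ^ 3"
  let ?Y = "\<lambda>n h b. (real h + v b - real n * \<mu>)\<^sup>2"
  have "step (?Y (Suc n)) h b \<le> ?Y n h b + a * weight b ^ (3 - 1)" if b: "state b" for n h b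
  proof -
    have w: "1 \<le> weight b" by (rule weight_ge_1[OF b])
    define y where "y = real h + v b - real n * \<mu>"
    have sq: "?Y (Suc n) h b' = y\<^sup>2 + ((2 * y) * v b' - (2 * y) * (v b + \<mu>) + (v b' - v b - \<mu>)\<^sup>2)" for b'
      by (simp add: y_def power2_eq_square algebra_simps)
    have sq': "?Y (Suc n) (Suc h) b' = y\<^sup>2 + ((2 * y) * (1 + v b' - v b - \<mu>) + (1 + v b' - v b - \<mu>)\<^sup>2)" for b'
      by (simp add: y_def power2_eq_square algebra_simps)
    have "low_sum (?Y (Suc n) h) b + tops b * ?Y (Suc n) (Suc h) (rise b)
        = weight b * y\<^sup>2 + 2 * y * (low_sum v b + tops b * (1 + v (rise b)) - weight b * (v b + \<mu>)) + variance_rate v \<mu> b"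
      unfolding sq sq' low_sum_plus low_sum_diff low_sum_cmult low_sum_const variance_rate_def
      by (simp add: algebra_simps)
    also have "\<dots> = weight b * y\<^sup>2 + variance_rate v \<mu> b" using v_eq[OF b] by simp
    also have "\<dots> \<le> weight b * (y\<^sup>2 + a * weight b ^ (3 - 1))"
      using a[OF b] by (simp add: power3_eq_cube power2_eq_square distrib_left mult.left_commute)
    finally have "low_sum (?Y (Suc n) h) b + tops b * ?Y (Suc n) (Suc h) (rise b)
        \<le> weight b * (?Y n h b + a * weight b ^ (3 - 1))" unfolding y_def .
    then show ?thesis unfolding step_def using w by (simp add: pos_divide_le_eq mult.commute)
  qed
  then have step: "ex (Suc n) (?Y (Suc n)) \<le> ex n (?Y n) + a * ex n (\<lambda>_ b. weight b ^ (3 - 1))" for n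
    unfolding ex_Suc ex_add[symmetric] ex_cmult[symmetric] by (intro ex_mono)
  have Y: "ex n (?Y n) \<le> (v (replicate_mset d 0))\<^sup>2 + a * (\<Sum>j<n. ex j (\<lambda>_ b. weight b ^ (3 - 1)))" for n
  proof (induction n)
    case (Suc n)
    then show ?case using step[of n] by (simp add: algebra_simps)
  qed (simp add: ex_0)
  have a0: "0 \<le> a"
  proof -
    have "1 \<le> weight (replicate_mset d 0) ^ 3" using weight_ge_1[OF state_replicate] by simp
    moreover have "0 \<le> a * weight (replicate_mset d 0) ^ 3"
      using abs_ge_zero a[OF state_replicate] by (rule order_trans)
    ultimately show ?thesis using d_pos by (simp add: zero_le_mult_iff)
  qed
  have dom: "ex n (\<lambda>h b. (real h - real n * \<mu>)\<^sup>2) \<le> 2 * ex n (?Y n) + 2 * D\<^sup>2 * ex n (\<lambda>_ b. weight b ^ 2)" for n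
    unfolding ex_add[symmetric] ex_cmult[symmetric]
  proof (rule ex_mono)
    fix h b assume b: "state b"
    have "(v b)\<^sup>2 \<le> D\<^sup>2 * weight b ^ 2"
      using v_le[OF b] abs_le_square_iff[of "v b" "D * weight b"] by (simp add: power_mult_distrib)
    moreover have "(real h - real n * \<mu>)\<^sup>2 \<le> 2 * ?Y n h b + 2 * (v b)\<^sup>2"
      using zero_le_power2[of "real h + v b - real n * \<mu> + v b"] by (simp add: power2_eq_square algebra_simps)
    ultimately show "(real h - real n * \<mu>)\<^sup>2 \<le> 2 * ?Y n h b + 2 * D\<^sup>2 * weight b ^ 2" by simp
  qed
  show ?thesis
  proof (rule moment_bound[of 3], simp)
    fix K3 assume K3: "\<And>n. (\<Sum>j<n. ex j (\<lambda>_ b. weight b ^ (3 - 1))) \<le> K3 * (real n + 1)"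
    show ?thesis
    proof (rule moment_bound[of 2], simp)
      fix K2 assume K2: "\<And>n. ex n (\<lambda>_ b. weight b ^ 2) \<le> K2 * (real n + 1)"
      let ?K = "2 * ((v (replicate_mset d 0))\<^sup>2 + a * K3) + 2 * D\<^sup>2 * K2"
      show ?thesis
      proof (intro exI[of _ ?K] allI)
        fix n
        have 1: "a * (\<Sum>j<n. ex j (\<lambda>_ b. weight b ^ (3 - 1))) \<le> a * (K3 * (real n + 1))"
          using K3 a0 by (intro mult_left_mono)
        have 2: "2 * D\<^sup>2 * ex n (\<lambda>_ b. weight b ^ 2) \<le> 2 * D\<^sup>2 * (K2 * (real n + 1))"
          using K2 by (intro mult_left_mono) auto
        have 3: "(v (replicate_mset d 0))\<^sup>2 \<le> (v (replicate_mset d 0))\<^sup>2 * (real n + 1)"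
          using mult_left_mono[of 1 "real n + 1" "(v (replicate_mset d 0))\<^sup>2"] by simp
        have 4: "ex n (?Y n) \<le> (v (replicate_mset d 0))\<^sup>2 * (real n + 1) + a * (K3 * (real n + 1))"
          by (rule order_trans[OF Y add_mono[OF 3 1]])
        have "ex n (\<lambda>h b. (real h - real n * \<mu>)\<^sup>2)
            \<le> 2 * ((v (replicate_mset d 0))\<^sup>2 * (real n + 1) + a * (K3 * (real n + 1))) + 2 * D\<^sup>2 * (K2 * (real n + 1))"
          by (rule order_trans[OF dom add_mono[OF mult_left_mono[OF 4] 2]]) simp
        then show "ex n (\<lambda>h b. (real h - real n * \<mu>)\<^sup>2) \<le> ?K * (real n + 1)" by (simp add: algebra_simps)
      qed
    qed
  qed
qed

end

context boundary_profile
begin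

section \<open>Characteristic functions\<close>

definition low_csum :: "(nat multiset \<Rightarrow> complex) \<Rightarrow> nat multiset \<Rightarrow> complex" where
  "low_csum f b = (\<Sum>i\<in>#lower b. of_real (\<alpha> ^ i) * f (ring i b))"

definition cstep :: "(nat \<Rightarrow> nat multiset \<Rightarrow> complex) \<Rightarrow> nat \<Rightarrow> nat multiset \<Rightarrow> complex" where
  "cstep f h b = (low_csum (f h) b + of_real (tops b) * f (Suc h) (rise b)) / of_real (weight b)"

lemma csum_Re: "Re (\<Sum>i\<in>#M. f i) = (\<Sum>i\<in>#M. Re (f i))"
  by (induction M) auto

lemma csum_Im: "Im (\<Sum>i\<in>#M. f i) = (\<Sum>i\<in>#M. Im (f i))"
  by (induction M) auto

lemma Re_cstep: "Re (cstep f h b) = step (\<lambda>h b. Re (f h b)) h b"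
  by (simp add: cstep_def step_def low_csum_def low_sum_def csum_Re complex_eq_iff Re_divide_of_real del: of_real_power)

lemma Im_cstep: "Im (cstep f h b) = step (\<lambda>h b. Im (f h b)) h b"
  by (simp add: cstep_def step_def low_csum_def low_sum_def csum_Im complex_eq_iff Im_divide_of_real del: of_real_power)

lemma cstep_add: "cstep (\<lambda>h b. f h b + g h b) h b = cstep f h b + cstep g h b"
  by (simp add: cstep_def low_csum_def distrib_left sum_mset.distrib add_divide_distrib)

lemma cstep_cmult: "cstep (\<lambda>h b. c * f h b) h b = c * cstep f h b"
proof -
  have sum: "(\<Sum>i\<in>#M. of_real (\<alpha> ^ i) * (c * g i)) = c * (\<Sum>i\<in>#M. of_real (\<alpha> ^ i) * g i)" for M g
    by (induction M) (auto simp: algebra_simps)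
  have "(c * s + t * (c * x)) / y = c * ((s + t * x) / y)" for s t x y :: complex
    by (simp add: distrib_left mult.left_commute)
  then show ?thesis unfolding cstep_def low_csum_def sum .
qed

lemma cstep_of_real: "cstep (\<lambda>h b. of_real (f h b)) h b = of_real (step f h b)"
  by (simp add: complex_eq_iff Re_cstep Im_cstep) (simp add: step_def low_sum_def)

lemma norm_cstep_le:
  assumes b: "state b" and low: "\<And>i. i \<in># b \<Longrightarrow> 0 < i \<Longrightarrow> cmod (f h (ring i b)) \<le> B"
    and top: "cmod (f (Suc h) (rise b)) \<le> B"
  shows "cmod (cstep f h b) \<le> B"
proof -
  have w: "1 \<le> weight b" and k: "1 \<le> tops b" using weight_ge_1 tops_ge_1 b by auto
  have "cmod (\<Sum>i\<in>#M. of_real (\<alpha> ^ i) * f h (ring i b)) \<le> weight M * B" if "M \<subseteq># lower b" for M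
    using that
  proof (induction M)
    case (add x M)
    then have "x \<in># lower b" "M \<subseteq># lower b"
      by (auto dest: mset_subset_eq_insertD mset_subset_eqD subset_mset.less_imp_le)
    then have "cmod (f h (ring x b)) \<le> B" "cmod (\<Sum>i\<in>#M. of_real (\<alpha> ^ i) * f h (ring i b)) \<le> weight M * B"
      using low[of x] add.IH by (auto simp: lower_mem)
    moreover have "cmod (of_real (\<alpha> ^ x) * f h (ring x b)) \<le> \<alpha> ^ x * B"
      using calculation(1) al0 by (simp add: norm_mult norm_power mult_left_mono)
    ultimately show ?case
      by (simp add: weight_def distrib_right) (smt (verit) norm_triangle_ineq)
  qed (simp add: weight_def)
  then have "cmod (low_csum (f h) b) \<le> weight (lower b) * B" by (simp add: low_csum_def)
  moreover have "cmod (of_real (tops b) * f (Suc h) (rise b)) \<le> tops b * B"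
    using top k by (simp add: norm_mult mult_left_mono)
  ultimately have "cmod (low_csum (f h) b + of_real (tops b) * f (Suc h) (rise b)) \<le> weight b * B"
    unfolding weight_split[of b] distrib_right by (intro order_trans[OF norm_triangle_ineq]) linarith
  then show ?thesis using w by (simp add: cstep_def norm_divide pos_divide_le_eq mult.commute)
qed

end

text \<open>The exponential is expanded to second order where it stands alone and to order zero
  where it multiplies z; all that is left over is of third order in \<theta>.\<close>

lemma iexp_corrected_error:
  fixes \<theta> \<Delta> z :: real
  shows "cmod (iexp (\<theta> * \<Delta>) * (1 - \<theta>\<^sup>2 / 2 * z) - (1 + \<i> * (\<theta> * \<Delta>) - \<theta>\<^sup>2 / 2 * (\<Delta>\<^sup>2 + z)))
    \<le> \<bar>\<theta>\<bar> ^ 3 * (\<bar>\<Delta>\<bar> ^ 3 + \<bar>z\<bar> * \<bar>\<Delta>\<bar>)"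
proof -
  let ?x = "\<theta> * \<Delta>"
  define A where "A = iexp ?x - (\<Sum>k\<le>2. (\<i> * ?x) ^ k / fact k)"
  define B where "B = iexp ?x - (\<Sum>k\<le>0. (\<i> * ?x) ^ k / fact k)"
  have A: "cmod A \<le> \<bar>?x\<bar> ^ 3"
  proof -
    have "cmod A \<le> \<bar>?x\<bar> ^ Suc 2 / fact (Suc 2)" unfolding A_def by (rule iexp_approx1)
    also have "\<dots> \<le> \<bar>?x\<bar> ^ Suc 2 / 1" by (rule divide_left_mono) (auto intro: fact_ge_1)
    also have "\<dots> = \<bar>?x\<bar> ^ 3" by (simp only: div_by_1 eval_nat_numeral)
    finally show ?thesis .
  qed
  have B: "cmod B \<le> \<bar>?x\<bar>" using iexp_approx1[of ?x 0] by (simp add: B_def)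
  have sA: "(\<Sum>k\<le>2. (\<i> * ?x) ^ k / fact k) = 1 + \<i> * ?x - \<theta>\<^sup>2 / 2 * \<Delta>\<^sup>2"
    by (simp add: numeral_2_eq_2 atMost_Suc power2_eq_square algebra_simps)
  have "iexp ?x * (1 - \<theta>\<^sup>2 / 2 * z) - (1 + \<i> * ?x - \<theta>\<^sup>2 / 2 * (\<Delta>\<^sup>2 + z)) = A - of_real (\<theta>\<^sup>2 / 2 * z) * B"
    unfolding A_def B_def sA by (simp add: algebra_simps add_divide_distrib diff_divide_distrib)
  then have "cmod (iexp ?x * (1 - \<theta>\<^sup>2 / 2 * z) - (1 + \<i> * ?x - \<theta>\<^sup>2 / 2 * (\<Delta>\<^sup>2 + z)))
      \<le> cmod A + cmod (of_real (\<theta>\<^sup>2 / 2 * z)) * cmod B"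
    by (metis norm_triangle_ineq4 norm_mult)
  also have "cmod (of_real (\<theta>\<^sup>2 / 2 * z)) = \<theta>\<^sup>2 / 2 * \<bar>z\<bar>" by (simp only: norm_of_real abs_mult) simp
  also have "cmod A + \<theta>\<^sup>2 / 2 * \<bar>z\<bar> * cmod B \<le> \<bar>?x\<bar> ^ 3 + \<theta>\<^sup>2 * \<bar>z\<bar> * \<bar>?x\<bar>"
    using A B by (intro add_mono mult_mono) auto
  also have "\<dots> = \<bar>\<theta>\<bar> ^ 3 * (\<bar>\<Delta>\<bar> ^ 3 + \<bar>z\<bar> * \<bar>\<Delta>\<bar>)"
    by (simp add: abs_mult power3_eq_cube power2_eq_square[of "\<bar>\<theta>\<bar>", unfolded power2_abs] algebra_simps)
  finally show ?thesis by simp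
qed

section \<open>Mean of the corrected exponential\<close>

context corrected_chain
begin

definition cex :: "nat \<Rightarrow> (nat \<Rightarrow> nat multiset \<Rightarrow> complex) \<Rightarrow> complex" where
  "cex n f = (\<integral>\<omega>. f (H n \<omega>) (X n \<omega>) \<partial>M)"

lemma cex_Suc: "cex (Suc n) f = cex n (cstep f)"
proof (rule complex_eqI)
  have "Re (cex n f) = ex n (\<lambda>h b. Re (f h b))" "Im (cex n f) = ex n (\<lambda>h b. Im (f h b))" for n f
    unfolding cex_def ex_def using integral_Re[OF integrable_chain] integral_Im[OF integrable_chain] by metis+
  then show "Re (cex (Suc n) f) = Re (cex n (cstep f))" "Im (cex (Suc n) f) = Im (cex n (cstep f))"
    by (simp_all add: ex_Suc Re_cstep Im_cstep)
qed

lemma cex_diff: "cex n (\<lambda>h b. f h b - g h b) = cex n f - cex n g"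
  unfolding cex_def by (rule Bochner_Integration.integral_diff[OF integrable_chain integrable_chain])

lemma cex_cmult: "cex n (\<lambda>h b. c * f h b) = c * cex n f"
  unfolding cex_def by simp

lemma norm_cex_le:
  assumes "\<And>h b. state b \<Longrightarrow> cmod (f h b) \<le> g h b"
  shows "cmod (cex n f) \<le> ex n g"
proof -
  have "cmod (cex n f) \<le> ex n (\<lambda>h b. cmod (f h b))" unfolding cex_def ex_def by (rule integral_norm_bound)
  also have "\<dots> \<le> ex n g" by (intro ex_mono assms)
  finally show ?thesis .
qed

lemma cex_0: "cex 0 f = f 0 (replicate_mset d 0)"
proof -
  have "cex 0 f = (\<integral>\<omega>. f 0 (replicate_mset d 0) \<partial>M)"
    unfolding cex_def
  proof (rule integral_cong_AE[OF borel_chain])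
    show "AE \<omega> in M. f (H 0 \<omega>) (X 0 \<omega>) = f 0 (replicate_mset d 0)"
      using chain_start by eventually_elim simp
  qed simp
  then show ?thesis by (simp add: prob_space)
qed

text \<open>The factor involving \<open>w\<close> makes one step multiply the mean by \<open>1 - \<theta>\<^sup>2 / 2 * \<sigma>2\<close> up to an error of
  order \<open>\<theta>\<^sup>3\<close>.\<close>

definition wave :: "real \<Rightarrow> nat \<Rightarrow> nat \<Rightarrow> nat multiset \<Rightarrow> complex" where
  "wave \<theta> n h b = iexp (\<theta> * (real h - real n * \<mu> + v b)) * of_real (1 - \<theta>\<^sup>2 / 2 * w b)"

text \<open>The linear Taylor term has mean 0 by \<open>v_eq\<close>, and the quadratic one together
  with w has mean w + \<sigma>2 by \<open>w_eq\<close>. The worst remainder is w times an increment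
  of v, whence the fourth power of the weight.\<close>

lemma wave_step:
  obtains K where "0 \<le> K" "\<And>\<theta> n h b. \<bar>\<theta>\<bar> \<le> 1 \<Longrightarrow> state b \<Longrightarrow>
    cmod (cstep (wave \<theta> (Suc n)) h b - of_real (1 - \<theta>\<^sup>2 / 2 * \<sigma>2) * wave \<theta> n h b) \<le> K * \<bar>\<theta>\<bar> ^ 3 * weight b ^ 4"
proof -
  define D' where "D' = 2 * D * spread + 2"
  define E where "E = D * spread ^ 3"
  have DE: "0 \<le> D'" "0 \<le> E" using D0 spread_ge_1 by (auto simp: D'_def E_def)
  define K where "K = (D' ^ 3 + E * D') + \<bar>\<sigma>2\<bar> * D"
  show thesis
  proof (rule that[of K])
    show "0 \<le> K" using DE D0 by (simp add: K_def)
    fix \<theta> n h b assume \<theta>: "\<bar>\<theta>\<bar> \<le> (1::real)" and b: "state b"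
    let ?W = "weight b"
    have W: "1 \<le> ?W" by (rule weight_ge_1[OF b])
    define c where "c = iexp (\<theta> * (real h - real n * \<mu> + v b))"
    have c: "cmod c = 1" by (simp add: c_def)
    define \<Delta> where "\<Delta> h' b' = real h' - real h + v b' - v b - \<mu>" for h' b'
    define P where "P h' b' = 1 + \<i> * (\<theta> * \<Delta> h' b') - \<theta>\<^sup>2 / 2 * ((\<Delta> h' b')\<^sup>2 + w b')" for h' b'
    define Q where "Q h' b' = iexp (\<theta> * \<Delta> h' b') * (1 - \<theta>\<^sup>2 / 2 * w b') - P h' b'" for h' b'
    have wave: "wave \<theta> (Suc n) h' b' = c * (P h' b' + Q h' b')" for h' b'
    proof -
      have "\<theta> * (real h' - real (Suc n) * \<mu> + v b') = \<theta> * (real h - real n * \<mu> + v b) + \<theta> * \<Delta> h' b'"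
        by (simp add: \<Delta>_def algebra_simps)
      then show ?thesis
        by (simp add: wave_def c_def Q_def exp_add[symmetric] distrib_left mult.assoc[symmetric])
    qed
    have near: "cmod (Q h' b') \<le> \<bar>\<theta>\<bar> ^ 3 * ((D' ^ 3 + E * D') * ?W ^ 4)"
      if b': "state b'" "weight b' \<le> spread * ?W" and h': "h' = h \<or> h' = Suc h" for h' b'
    proof -
      have "\<bar>v b'\<bar> \<le> D * (spread * ?W)" using v_le[OF b'(1)] mult_left_mono[OF b'(2) D0] by linarith
      moreover have "\<bar>v b\<bar> \<le> D * (spread * ?W)"
      proof -
        have "1 * ?W \<le> spread * ?W" using spread_ge_1 W by (intro mult_right_mono) auto
        then show ?thesis using v_le[OF b] mult_left_mono[of ?W "spread * ?W" D] D0 by linarith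
      qed
      moreover have "D' * ?W = D * (spread * ?W) + D * (spread * ?W) + 2 * ?W" by (simp add: D'_def algebra_simps)
      moreover have "\<bar>real h' - real h\<bar> \<le> 1" using h' by auto
      ultimately have \<Delta>: "\<bar>\<Delta> h' b'\<bar> \<le> D' * ?W" using \<mu>0 \<mu>1 W unfolding \<Delta>_def by linarith
      have "weight b' ^ 3 \<le> (spread * ?W) ^ 3" using b'(2) weight_nonneg by (intro power_mono)
      then have z: "\<bar>w b'\<bar> \<le> E * ?W ^ 3"
        using w_le[OF b'(1)] mult_left_mono[of "weight b' ^ 3" "(spread * ?W) ^ 3" D] D0
        by (simp add: E_def power_mult_distrib)
      have "cmod (Q h' b') \<le> \<bar>\<theta>\<bar> ^ 3 * (\<bar>\<Delta> h' b'\<bar> ^ 3 + \<bar>w b'\<bar> * \<bar>\<Delta> h' b'\<bar>)"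
        using iexp_corrected_error[of \<theta> "\<Delta> h' b'" "w b'"] unfolding Q_def P_def by simp
      also have "\<dots> \<le> \<bar>\<theta>\<bar> ^ 3 * ((D' * ?W) ^ 3 + (E * ?W ^ 3) * (D' * ?W))"
        using \<Delta> z DE W by (intro mult_left_mono add_mono power_mono mult_mono) auto
      also have "(D' * ?W) ^ 3 + (E * ?W ^ 3) * (D' * ?W) = D' ^ 3 * ?W ^ 3 + E * D' * ?W ^ 4"
        by (simp add: power_mult_distrib power_numeral_reduce)
      also have "D' ^ 3 * ?W ^ 3 \<le> D' ^ 3 * ?W ^ 4" using DE W by (intro mult_left_mono power_increasing) auto
      finally show ?thesis by (simp add: distrib_right mult_left_mono)
    qed
    have Q: "cmod (cstep Q h b) \<le> \<bar>\<theta>\<bar> ^ 3 * ((D' ^ 3 + E * D') * ?W ^ 4)"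
      using b by (intro norm_cstep_le near) (auto intro: state_ring state_rise weight_ring_le weight_rise_le)
    have \<Delta>0: "step \<Delta> h b = 0"
    proof -
      have "\<Delta> h = (\<lambda>b'. v b' - (v b + \<mu>))" by (simp add: \<Delta>_def fun_eq_iff)
      then have "low_sum (\<Delta> h) b + tops b * \<Delta> (Suc h) (rise b)
          = low_sum v b + tops b * (1 + v (rise b)) - ?W * (v b + \<mu>)"
        by (simp add: \<Delta>_def low_sum_diff low_sum_const algebra_simps)
      then show ?thesis using v_eq[OF b] by (simp add: step_def)
    qed
    have sq: "step (\<lambda>h' b'. (\<Delta> h' b')\<^sup>2 + w b') h b = w b + \<sigma>2"
    proof -
      have "low_sum (\<lambda>b'. (\<Delta> h b')\<^sup>2 + w b') b + tops b * ((\<Delta> (Suc h) (rise b))\<^sup>2 + w (rise b))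
          = ?W * (w b + \<sigma>2)"
        unfolding w_eq[OF b] by (simp add: \<Delta>_def low_sum_plus variance_rate_def algebra_simps)
      then show ?thesis using W by (simp add: step_def)
    qed
    have one: "step (\<lambda>_ _. 1) h b = 1" using W by (simp add: step_def low_sum_const)
    have P: "cstep P h b = of_real (1 - \<theta>\<^sup>2 / 2 * (w b + \<sigma>2))"
    proof -
      have "cstep P h b = cstep (\<lambda>h b. of_real 1 + ((\<i> * \<theta>) * of_real (\<Delta> h b)
          + of_real (- \<theta>\<^sup>2 / 2) * of_real ((\<Delta> h b)\<^sup>2 + w b))) h b"
        by (rule arg_cong[of _ _ "\<lambda>f. cstep f h b"]) (auto simp: P_def fun_eq_iff)
      also have "\<dots> = of_real 1 + ((\<i> * \<theta>) * of_real 0 + of_real (- \<theta>\<^sup>2 / 2) * of_real (w b + \<sigma>2))"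
        unfolding cstep_add cstep_cmult cstep_of_real \<Delta>0 sq one ..
      finally show ?thesis by simp
    qed
    have "cstep (wave \<theta> (Suc n)) h b = c * (cstep P h b + cstep Q h b)"
      unfolding cstep_add[symmetric] cstep_cmult[symmetric]
      by (rule arg_cong[of _ _ "\<lambda>f. cstep f h b"]) (auto simp: wave fun_eq_iff)
    moreover have "of_real (1 - \<theta>\<^sup>2 / 2 * \<sigma>2) * wave \<theta> n h b = c * of_real ((1 - \<theta>\<^sup>2 / 2 * \<sigma>2) * (1 - \<theta>\<^sup>2 / 2 * w b))"
      by (simp add: wave_def c_def)
    \<comment> \<open>The product of the two corrections leaves one term of order \<theta> ^ 4; for
      \<bar>\<theta>\<bar> \<le> 1 it joins the cubic error.\<close>
    moreover have "(1 - \<theta>\<^sup>2 / 2 * \<sigma>2) * (1 - \<theta>\<^sup>2 / 2 * w b) = (1 - \<theta>\<^sup>2 / 2 * (w b + \<sigma>2)) + \<theta> ^ 4 / 4 * \<sigma>2 * w b"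
      by (simp add: field_simps power_numeral_reduce)
    moreover have "c * (x + q) - c * (x + y) = c * (q - y)" for x q y :: complex
      by (simp add: algebra_simps)
    ultimately have "cstep (wave \<theta> (Suc n)) h b - of_real (1 - \<theta>\<^sup>2 / 2 * \<sigma>2) * wave \<theta> n h b
        = c * (cstep Q h b - of_real (\<theta> ^ 4 / 4 * \<sigma>2 * w b))"
      by (simp only: P of_real_add)
    then have "cmod (cstep (wave \<theta> (Suc n)) h b - of_real (1 - \<theta>\<^sup>2 / 2 * \<sigma>2) * wave \<theta> n h b)
        = cmod (cstep Q h b - of_real (\<theta> ^ 4 / 4 * \<sigma>2 * w b))"
      by (simp add: norm_mult c)
    also have "\<dots> \<le> cmod (cstep Q h b) + \<bar>\<theta> ^ 4 / 4 * \<sigma>2 * w b\<bar>"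
      by (metis norm_triangle_ineq4 norm_of_real)
    also have "\<bar>\<theta> ^ 4 / 4 * \<sigma>2 * w b\<bar> \<le> \<bar>\<theta>\<bar> ^ 3 * (\<bar>\<sigma>2\<bar> * D * ?W ^ 4)"
    proof -
      have "\<bar>w b\<bar> \<le> D * ?W ^ 4"
        using w_le[OF b] D0 W mult_left_mono[of "?W ^ 3" "?W ^ 4" D] power_increasing[of 3 4 ?W] by linarith
      moreover have "\<bar>\<theta>\<bar> ^ 4 / 4 \<le> \<bar>\<theta>\<bar> ^ 3"
      proof -
        have "\<bar>\<theta>\<bar> ^ 4 \<le> \<bar>\<theta>\<bar> ^ 3" using \<theta> by (intro power_decreasing) auto
        moreover have "0 \<le> \<bar>\<theta>\<bar> ^ 4" by simp
        ultimately show ?thesis by linarith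
      qed
      ultimately have "\<bar>\<theta>\<bar> ^ 4 / 4 * (\<bar>\<sigma>2\<bar> * \<bar>w b\<bar>) \<le> \<bar>\<theta>\<bar> ^ 3 * (\<bar>\<sigma>2\<bar> * (D * ?W ^ 4))"
        by (intro mult_mono) auto
      then show ?thesis by (simp add: abs_mult power_abs mult.assoc)
    qed
    finally show "cmod (cstep (wave \<theta> (Suc n)) h b - of_real (1 - \<theta>\<^sup>2 / 2 * \<sigma>2) * wave \<theta> n h b)
        \<le> K * \<bar>\<theta>\<bar> ^ 3 * weight b ^ 4"
      using Q by (simp add: K_def algebra_simps)
  qed
qed

text \<open>A recursion whose multiplier has modulus at most 1 merely adds up its errors, and the
  sum of the fourth moments of the weight is linear in n.\<close>

lemma wave_mean:
  obtains K where "0 \<le> K" "\<And>\<theta> n. \<bar>\<theta>\<bar> \<le> 1 \<Longrightarrow> \<bar>1 - \<theta>\<^sup>2 / 2 * \<sigma>2\<bar> \<le> 1 \<Longrightarrow>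
    cmod (cex n (wave \<theta> n) - of_real (1 - \<theta>\<^sup>2 / 2 * \<sigma>2) ^ n * wave \<theta> 0 0 (replicate_mset d 0))
      \<le> K * \<bar>\<theta>\<bar> ^ 3 * (real n + 1)"
proof (rule wave_step)
  fix K
  assume K: "0 \<le> K" and step: "\<And>\<theta> n h b. \<bar>\<theta>\<bar> \<le> 1 \<Longrightarrow> state b \<Longrightarrow>
    cmod (cstep (wave \<theta> (Suc n)) h b - of_real (1 - \<theta>\<^sup>2 / 2 * \<sigma>2) * wave \<theta> n h b) \<le> K * \<bar>\<theta>\<bar> ^ 3 * weight b ^ 4"
  show thesis
  proof (rule moment_bound[of 5], simp)
    fix K' assume K': "0 \<le> K'" and mom: "\<And>n. (\<Sum>j<n. ex j (\<lambda>_ b. weight b ^ (5 - 1))) \<le> K' * (real n + 1)"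
    show thesis
    proof (rule that[of "K * K'"])
      show "0 \<le> K * K'" using K K' by simp
      fix \<theta> n assume \<theta>: "\<bar>\<theta>\<bar> \<le> 1" and \<beta>: "\<bar>1 - \<theta>\<^sup>2 / 2 * \<sigma>2\<bar> \<le> 1"
      let ?\<beta> = "complex_of_real (1 - \<theta>\<^sup>2 / 2 * \<sigma>2)"
      have \<beta>1: "cmod ?\<beta> \<le> 1" using \<beta> by (simp only: norm_of_real)
      have one: "cmod (cex (Suc n) (wave \<theta> (Suc n)) - ?\<beta> * cex n (wave \<theta> n))
          \<le> K * \<bar>\<theta>\<bar> ^ 3 * ex n (\<lambda>_ b. weight b ^ (5 - 1))" for n
        unfolding cex_Suc cex_cmult[symmetric] cex_diff[symmetric] ex_cmult[symmetric]
        using step[OF \<theta>] by (intro norm_cex_le) simp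
      have "cmod (cex n (wave \<theta> n) - ?\<beta> ^ n * wave \<theta> 0 0 (replicate_mset d 0))
          \<le> K * \<bar>\<theta>\<bar> ^ 3 * (\<Sum>j<n. ex j (\<lambda>_ b. weight b ^ (5 - 1)))"
      proof (induction n)
        case (Suc n)
        let ?z = "cex n (wave \<theta> n) - ?\<beta> ^ n * wave \<theta> 0 0 (replicate_mset d 0)"
        have "cex (Suc n) (wave \<theta> (Suc n)) - ?\<beta> ^ Suc n * wave \<theta> 0 0 (replicate_mset d 0)
            = (cex (Suc n) (wave \<theta> (Suc n)) - ?\<beta> * cex n (wave \<theta> n)) + ?\<beta> * ?z"
          by (simp add: algebra_simps)
        then have "cmod (cex (Suc n) (wave \<theta> (Suc n)) - ?\<beta> ^ Suc n * wave \<theta> 0 0 (replicate_mset d 0))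
            \<le> cmod (cex (Suc n) (wave \<theta> (Suc n)) - ?\<beta> * cex n (wave \<theta> n)) + cmod ?\<beta> * cmod ?z"
          by (metis norm_triangle_ineq norm_mult)
        also have "cmod ?\<beta> * cmod ?z \<le> 1 * cmod ?z" using \<beta>1 by (intro mult_right_mono) auto
        finally show ?case using one[of n] Suc by (simp add: distrib_left)
      qed (simp add: cex_0)
      also have "\<dots> \<le> K * \<bar>\<theta>\<bar> ^ 3 * (K' * (real n + 1))" using K mom by (intro mult_left_mono) auto
      finally show "cmod (cex n (wave \<theta> n) - ?\<beta> ^ n * wave \<theta> 0 0 (replicate_mset d 0))
          \<le> K * K' * \<bar>\<theta>\<bar> ^ 3 * (real n + 1)" by (simp add: mult_ac)
    qed
  qed
qed

text \<open>The phase \<theta> * v and the factor with w cost order \<bar>\<theta>\<bar> times a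
  first moment and \<theta> ^ 2 times a third moment of the weight. At \<theta> of order n ^ (- 1 /
  2) this tends to 0 like n ^ (- 1 / 4).\<close>

lemma wave_removal:
  "\<exists>K. \<forall>\<theta> n. cmod (cex n (\<lambda>h b. iexp (\<theta> * (real h - real n * \<mu>))) - cex n (wave \<theta> n))
    \<le> K * ((\<bar>\<theta>\<bar> + \<theta>\<^sup>2) * sqrt (sqrt (real n + 1)))"
proof -
  obtain K1 where K1: "0 \<le> K1" "\<And>n. ex n (\<lambda>_ b. weight b ^ 1) \<le> K1 * sqrt (sqrt (real n + 1))"
    using moment_growth[of 1] by blast
  obtain K3 where K3: "0 \<le> K3" "\<And>n. ex n (\<lambda>_ b. weight b ^ 3) \<le> K3 * sqrt (sqrt (real n + 1))"
    using moment_growth[of 3] by auto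
  have "cmod (cex n (\<lambda>h b. iexp (\<theta> * (real h - real n * \<mu>))) - cex n (wave \<theta> n))
    \<le> (D * (K1 + K3)) * ((\<bar>\<theta>\<bar> + \<theta>\<^sup>2) * sqrt (sqrt (real n + 1)))" for \<theta> n
  proof -
    let ?s = "sqrt (sqrt (real n + 1))"
    have "cmod (iexp (\<theta> * (real h - real n * \<mu>)) - wave \<theta> n h b)
        \<le> \<bar>\<theta>\<bar> * D * weight b ^ 1 + \<theta>\<^sup>2 * D * weight b ^ 3" if b: "state b" for h b
    proof -
      have B: "cmod (iexp (\<theta> * v b) - 1) \<le> \<bar>\<theta> * v b\<bar>" using iexp_approx1[of "\<theta> * v b" 0] by simp
      have "iexp (\<theta> * (real h - real n * \<mu>)) - wave \<theta> n h b = iexp (\<theta> * (real h - real n * \<mu>)) *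
          (iexp (\<theta> * v b) * of_real (\<theta>\<^sup>2 / 2 * w b) - (iexp (\<theta> * v b) - 1))"
      proof -
        have e: "iexp (\<theta> * (real h - real n * \<mu> + v b)) = iexp (\<theta> * (real h - real n * \<mu>)) * iexp (\<theta> * v b)"
          by (simp only: distrib_left of_real_add exp_add)
        have g: "x - x * y * of_real (1 - z) = x * (y * of_real z - (y - 1))" for x y :: complex and z
          by (simp add: algebra_simps)
        show ?thesis by (simp only: wave_def e g)
      qed
      then have "cmod (iexp (\<theta> * (real h - real n * \<mu>)) - wave \<theta> n h b) =
          cmod (iexp (\<theta> * v b) * of_real (\<theta>\<^sup>2 / 2 * w b) - (iexp (\<theta> * v b) - 1))"
        by (simp only: norm_mult) simp
      also have "\<dots> \<le> cmod (iexp (\<theta> * v b) * of_real (\<theta>\<^sup>2 / 2 * w b)) + cmod (iexp (\<theta> * v b) - 1)"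
        by (rule norm_triangle_ineq4)
      also have "cmod (iexp (\<theta> * v b) * of_real (\<theta>\<^sup>2 / 2 * w b)) = \<theta>\<^sup>2 / 2 * \<bar>w b\<bar>"
        by (simp only: norm_mult norm_of_real) (simp add: abs_mult)
      also have "\<theta>\<^sup>2 / 2 * \<bar>w b\<bar> \<le> \<theta>\<^sup>2 * (D * weight b ^ 3)" using w_le[OF b] by (intro mult_mono) auto
      also have "cmod (iexp (\<theta> * v b) - 1) \<le> \<bar>\<theta>\<bar> * (D * weight b)"
        using B v_le[OF b] mult_left_mono[of "\<bar>v b\<bar>" "D * weight b" "\<bar>\<theta>\<bar>"] by (simp add: abs_mult)
      finally show ?thesis by (simp add: mult.assoc)
    qed
    then have "cmod (cex n (\<lambda>h b. iexp (\<theta> * (real h - real n * \<mu>)) - wave \<theta> n h b))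
        \<le> ex n (\<lambda>_ b. \<bar>\<theta>\<bar> * D * weight b ^ 1 + \<theta>\<^sup>2 * D * weight b ^ 3)" by (rule norm_cex_le)
    also have "\<dots> \<le> \<bar>\<theta>\<bar> * D * (K1 * ?s) + \<theta>\<^sup>2 * D * (K3 * ?s)"
      unfolding ex_add ex_cmult using K1 K3 D0 by (intro add_mono mult_left_mono) auto
    also have "\<dots> \<le> \<bar>\<theta>\<bar> * D * ((K1 + K3) * ?s) + \<theta>\<^sup>2 * D * ((K1 + K3) * ?s)"
      using K1 K3 D0 by (intro add_mono mult_left_mono mult_right_mono) auto
    finally show ?thesis unfolding cex_diff by (simp add: algebra_simps)
  qed
  then show ?thesis by blast
qed

text \<open>The scale is sqrt (n + 1) because time n of the chain will be time n + 1 of the tree.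
  Removing the correctors costs order n ^ (- 1 / 4); the accumulated error n * \<bar>\<theta>\<bar>
  ^ 3 is of order n ^ (- 1 / 2).\<close>

lemma char_limit:
  "(\<lambda>n. cex n (\<lambda>h b. iexp (t / sqrt (real n + 1) * (real h - real n * \<mu>))))
    \<longlonglongrightarrow> of_real (exp (- (t\<^sup>2 * \<sigma>2 / 2)))"
proof (rule wave_mean)
  fix K
  assume K: "0 \<le> K" and mean: "\<And>\<theta> n. \<bar>\<theta>\<bar> \<le> 1 \<Longrightarrow> \<bar>1 - \<theta>\<^sup>2 / 2 * \<sigma>2\<bar> \<le> 1 \<Longrightarrow>
    cmod (cex n (wave \<theta> n) - of_real (1 - \<theta>\<^sup>2 / 2 * \<sigma>2) ^ n * wave \<theta> 0 0 (replicate_mset d 0))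
      \<le> K * \<bar>\<theta>\<bar> ^ 3 * (real n + 1)"
  obtain K' where K': "\<And>\<theta> n. cmod (cex n (\<lambda>h b. iexp (\<theta> * (real h - real n * \<mu>))) - cex n (wave \<theta> n))
    \<le> K' * ((\<bar>\<theta>\<bar> + \<theta>\<^sup>2) * sqrt (sqrt (real n + 1)))"
    using wave_removal by blast
  define \<theta> where "\<theta> n = t / sqrt (real n + 1)" for n :: nat
  have \<theta>2: "(\<theta> n)\<^sup>2 = t\<^sup>2 / (real n + 1)" for n by (simp add: \<theta>_def power_divide)
  have inv: "(\<lambda>n. 1 / (real n + 1)) \<longlonglongrightarrow> 0"
    using LIMSEQ_Suc[OF lim_1_over_n[where 'a = real]] by (simp add: add.commute)
  have sinv: "(\<lambda>n. 1 / sqrt (real n + 1)) \<longlonglongrightarrow> 0"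
    using tendsto_real_sqrt[OF inv] by (simp add: real_sqrt_divide)
  have \<theta>0: "\<theta> \<longlonglongrightarrow> 0"
    using tendsto_mult[OF tendsto_const[of t] sinv] by (simp add: \<theta>_def[abs_def])
  have small: "eventually (\<lambda>n. \<bar>\<theta> n\<bar> \<le> 1 \<and> \<bar>1 - (\<theta> n)\<^sup>2 / 2 * \<sigma>2\<bar> \<le> 1) sequentially"
  proof -
    have "(\<lambda>n. \<bar>\<theta> n\<bar>) \<longlonglongrightarrow> \<bar>0\<bar>" "(\<lambda>n. (\<theta> n)\<^sup>2 / 2 * \<sigma>2) \<longlonglongrightarrow> 0\<^sup>2 / 2 * \<sigma>2"
      by (intro tendsto_intros \<theta>0; simp)+
    then have "eventually (\<lambda>n. \<bar>\<theta> n\<bar> < 1) sequentially" "eventually (\<lambda>n. (\<theta> n)\<^sup>2 / 2 * \<sigma>2 < 1) sequentially"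
      by (auto elim: order_tendstoD)
    then show ?thesis
    proof eventually_elim
      case (elim n)
      have "0 \<le> (\<theta> n)\<^sup>2 / 2 * \<sigma>2" using sigma2_pos by simp
      then show ?case using elim by linarith
    qed
  qed
  define a where "a n = cex n (\<lambda>h b. iexp (\<theta> n * (real h - real n * \<mu>)))" for n
  define m where "m n = complex_of_real (1 - (\<theta> n)\<^sup>2 / 2 * \<sigma>2) ^ n * wave (\<theta> n) 0 0 (replicate_mset d 0)" for n
  have "(\<lambda>n. a n - m n) \<longlonglongrightarrow> 0"
  proof (rule Lim_null_comparison)
    show "eventually (\<lambda>n. cmod (a n - m n) \<le> \<bar>K'\<bar> * ((\<bar>t\<bar> + t\<^sup>2) * (1 / sqrt (sqrt (real n + 1))))
        + K * \<bar>t\<bar> ^ 3 * (1 / sqrt (real n + 1))) sequentially"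
      using small
    proof eventually_elim
      case (elim n)
      let ?r = "sqrt (real n + 1)"
      have r: "1 \<le> ?r" "?r * ?r = real n + 1" by auto
      have s: "1 \<le> sqrt ?r" "sqrt ?r * sqrt ?r = ?r" using r by auto
      have "cmod (a n - cex n (wave (\<theta> n) n)) \<le> K' * ((\<bar>\<theta> n\<bar> + (\<theta> n)\<^sup>2) * sqrt ?r)"
        unfolding a_def by (rule K')
      also have "\<dots> \<le> \<bar>K'\<bar> * ((\<bar>\<theta> n\<bar> + (\<theta> n)\<^sup>2) * sqrt ?r)" by (intro mult_right_mono) auto
      also have "\<dots> \<le> \<bar>K'\<bar> * ((\<bar>t\<bar> + t\<^sup>2) * (1 / sqrt ?r))"
      proof (intro mult_left_mono)
        have "(\<theta> n)\<^sup>2 \<le> t\<^sup>2 / ?r"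
          unfolding \<theta>2 using r by (intro divide_left_mono) (auto intro: order_trans[OF _ mult_left_mono[of 1 ?r ?r, simplified]])
        then have "\<bar>\<theta> n\<bar> + (\<theta> n)\<^sup>2 \<le> (\<bar>t\<bar> + t\<^sup>2) / ?r" by (simp add: \<theta>_def add_divide_distrib)
        then have "(\<bar>\<theta> n\<bar> + (\<theta> n)\<^sup>2) * sqrt ?r \<le> (\<bar>t\<bar> + t\<^sup>2) / ?r * sqrt ?r" using s by (intro mult_right_mono) auto
        also have "\<dots> = (\<bar>t\<bar> + t\<^sup>2) * (sqrt ?r / (sqrt ?r * sqrt ?r))" unfolding s(2) by simp
        also have "sqrt ?r / (sqrt ?r * sqrt ?r) = 1 / sqrt ?r"
        proof -
          have "x / (x * x) = 1 / x" if "1 \<le> x" for x :: real using that by simp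
          from this[OF s(1)] show ?thesis .
        qed
        finally show "(\<bar>\<theta> n\<bar> + (\<theta> n)\<^sup>2) * sqrt ?r \<le> (\<bar>t\<bar> + t\<^sup>2) * (1 / sqrt ?r)" .
      qed simp
      finally have 1: "cmod (a n - cex n (wave (\<theta> n) n)) \<le> \<bar>K'\<bar> * ((\<bar>t\<bar> + t\<^sup>2) * (1 / sqrt ?r))" .
      have "cmod (cex n (wave (\<theta> n) n) - m n) \<le> K * \<bar>\<theta> n\<bar> ^ 3 * (real n + 1)"
        unfolding m_def using elim by (intro mean) auto
      also have "\<bar>\<theta> n\<bar> ^ 3 = \<bar>t\<bar> ^ 3 / (?r * ?r * ?r)" by (simp add: \<theta>_def power_divide power3_eq_cube)
      also have "K * (\<bar>t\<bar> ^ 3 / (?r * ?r * ?r)) * (real n + 1) = K * \<bar>t\<bar> ^ 3 * (1 / ?r)"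
      proof -
        have "K * (y / (x * x * x)) * (x * x) = K * y * (1 / x)" if "1 \<le> x" for x y :: real
          using that by simp
        from this[OF r(1), of "\<bar>t\<bar> ^ 3"] show ?thesis unfolding r(2) .
      qed
      finally have 2: "cmod (cex n (wave (\<theta> n) n) - m n) \<le> K * \<bar>t\<bar> ^ 3 * (1 / ?r)" .
      show ?case
        using 1 2 norm_triangle_ineq[of "a n - cex n (wave (\<theta> n) n)" "cex n (wave (\<theta> n) n) - m n"] by simp
    qed
    have "(\<lambda>n. sqrt (1 / sqrt (real n + 1))) \<longlonglongrightarrow> sqrt 0" by (intro tendsto_real_sqrt sinv)
    then have "(\<lambda>n. 1 / sqrt (sqrt (real n + 1))) \<longlonglongrightarrow> 0" by (simp add: real_sqrt_divide)
    then have "(\<lambda>n. \<bar>K'\<bar> * ((\<bar>t\<bar> + t\<^sup>2) * (1 / sqrt (sqrt (real n + 1)))) + K * \<bar>t\<bar> ^ 3 * (1 / sqrt (real n + 1)))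
        \<longlonglongrightarrow> \<bar>K'\<bar> * ((\<bar>t\<bar> + t\<^sup>2) * 0) + K * \<bar>t\<bar> ^ 3 * 0"
      by (intro tendsto_intros sinv)
    then show "(\<lambda>n. \<bar>K'\<bar> * ((\<bar>t\<bar> + t\<^sup>2) * (1 / sqrt (sqrt (real n + 1)))) + K * \<bar>t\<bar> ^ 3 * (1 / sqrt (real n + 1)))
        \<longlonglongrightarrow> 0" by simp
  qed
  moreover have "m \<longlonglongrightarrow> of_real (exp (- (t\<^sup>2 * \<sigma>2 / 2)))"
  proof -
    define x where "x = - (t\<^sup>2 * \<sigma>2 / 2)"
    have e: "1 - (\<theta> n)\<^sup>2 / 2 * \<sigma>2 = 1 + x / (real n + 1)" for n by (simp add: \<theta>2 x_def)
    have base: "(\<lambda>n. 1 + x / (real n + 1)) \<longlonglongrightarrow> 1"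
      using tendsto_add[OF tendsto_const[of 1] tendsto_mult[OF tendsto_const[of x] inv]] by simp
    have "(\<lambda>n. (1 + x / (real n + 1)) ^ Suc n) \<longlonglongrightarrow> exp x"
      using LIMSEQ_Suc[OF tendsto_exp_limit_sequentially[of x]] by (simp add: add.commute)
    \<comment> \<open>The exponential limit has exponent n + 1, the mean only n; the extra factor
      tends to 1 and is divided out.\<close>
    then have "(\<lambda>n. (1 + x / (real n + 1)) ^ Suc n / (1 + x / (real n + 1))) \<longlonglongrightarrow> exp x / 1"
      by (intro tendsto_divide base) auto
    moreover have "eventually (\<lambda>n. (1 + x / (real n + 1)) ^ Suc n / (1 + x / (real n + 1)) = (1 + x / (real n + 1)) ^ n) sequentially"
      by (rule eventually_mono[OF order_tendstoD(1)[OF base, of 0]]) auto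
    ultimately have "(\<lambda>n. (1 + x / (real n + 1)) ^ n) \<longlonglongrightarrow> exp x" by (simp only: tendsto_cong) simp
    then have pow: "(\<lambda>n. (1 - (\<theta> n)\<^sup>2 / 2 * \<sigma>2) ^ n) \<longlonglongrightarrow> exp x" unfolding e .
    let ?e = "replicate_mset d 0"
    have "(\<lambda>n. of_real ((1 - (\<theta> n)\<^sup>2 / 2 * \<sigma>2) ^ n) *
        (exp (\<i> * of_real (\<theta> n * v ?e)) * of_real (1 - (\<theta> n)\<^sup>2 / 2 * w ?e)))
        \<longlonglongrightarrow> of_real (exp x) * (exp (\<i> * of_real (0 * v ?e)) * of_real (1 - 0\<^sup>2 / 2 * w ?e))"
      by (intro tendsto_intros pow \<theta>0) auto
    moreover have "m = (\<lambda>n. of_real ((1 - (\<theta> n)\<^sup>2 / 2 * \<sigma>2) ^ n) *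
        (exp (\<i> * of_real (\<theta> n * v ?e)) * of_real (1 - (\<theta> n)\<^sup>2 / 2 * w ?e)))"
      by (simp add: m_def wave_def fun_eq_iff)
    ultimately show ?thesis by (simp add: x_def)
  qed
  ultimately have "(\<lambda>n. (a n - m n) + m n) \<longlonglongrightarrow> 0 + of_real (exp (- (t\<^sup>2 * \<sigma>2 / 2)))"
    by (rule tendsto_add)
  then show ?thesis by (simp add: a_def \<theta>_def)
qed

end

text \<open>Replacing n by one of the neighbouring squares changes the quotient, by monotonicity, at
  most by the factor ((k + 1) / k) ^ 2, which tends to 1.\<close>

lemma tendsto_from_squares:
  fixes a :: "nat \<Rightarrow> real"
  assumes mono: "\<And>m n. m \<le> n \<Longrightarrow> a m \<le> a n" and nonneg: "\<And>n. 0 \<le> a n"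
    and sq: "(\<lambda>k. a (k\<^sup>2) / real (k\<^sup>2)) \<longlonglongrightarrow> \<mu>"
  shows "(\<lambda>n. a n / real n) \<longlonglongrightarrow> \<mu>"
proof -
  define g where "g k = a (k\<^sup>2) / real (k\<^sup>2)" for k
  have g: "g \<longlonglongrightarrow> \<mu>" using sq by (simp add: g_def[abs_def])
  define k where "k n = nat \<lfloor>sqrt (real n)\<rfloor>" for n
  have k: "(k n)\<^sup>2 \<le> n" "n \<le> (Suc (k n))\<^sup>2" for n
  proof -
    have "real (k n) \<le> sqrt (real n)" unfolding k_def by simp
    then have "(real (k n))\<^sup>2 \<le> (sqrt (real n))\<^sup>2" by (intro power_mono) auto
    then have "real ((k n)\<^sup>2) \<le> real n" by simp
    then show "(k n)\<^sup>2 \<le> n" by (simp only: of_nat_le_iff)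
    have "sqrt (real n) \<le> real (Suc (k n))" unfolding k_def by linarith
    then have "(sqrt (real n))\<^sup>2 \<le> (real (Suc (k n)))\<^sup>2" by (intro power_mono) auto
    then have "real n \<le> real ((Suc (k n))\<^sup>2)" by simp
    then show "n \<le> (Suc (k n))\<^sup>2" by (simp only: of_nat_le_iff)
  qed
  have k_lim: "filterlim k at_top sequentially"
  proof (unfold filterlim_at_top, intro allI)
    fix Z
    have "Z \<le> k n" if "Z\<^sup>2 \<le> n" for n
    proof -
      have "real (Z\<^sup>2) \<le> real n" using that by (simp only: of_nat_le_iff)
      then have "real Z \<le> sqrt (real n)" by (intro real_le_rsqrt) simp
      then show ?thesis unfolding k_def by (simp add: le_nat_floor)
    qed
    then show "eventually (\<lambda>n. Z \<le> k n) sequentially"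
      by (rule eventually_mono[OF eventually_ge_at_top[of "Z\<^sup>2"]])
  qed
  have U: "(\<lambda>j. g (Suc j) * (1 + 1 / real j)\<^sup>2) \<longlonglongrightarrow> \<mu> * (1 + 0)\<^sup>2"
    by (intro tendsto_intros LIMSEQ_Suc g)
  have L: "(\<lambda>j. g j * (1 / (1 + 1 / real j))\<^sup>2) \<longlonglongrightarrow> \<mu> * (1 / (1 + 0))\<^sup>2"
    by (intro tendsto_intros g) auto
  have bounds: "g (k n) * (1 / (1 + 1 / real (k n)))\<^sup>2 \<le> a n / real n"
    "a n / real n \<le> g (Suc (k n)) * (1 + 1 / real (k n))\<^sup>2" if "1 \<le> k n" for n
  proof -
    have "1 \<le> (k n)\<^sup>2" using that by simp
    then have n: "0 < real n" using k(1)[of n] by linarith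
    have kk: "real ((k n)\<^sup>2) \<le> real n" "real n \<le> real ((Suc (k n))\<^sup>2)" "0 < real ((k n)\<^sup>2)"
      unfolding of_nat_le_iff using k[of n] that by auto
    have "1 / (1 + 1 / real (k n)) = real (k n) / real (Suc (k n))" using that by (simp add: field_simps)
    then have "g (k n) * (1 / (1 + 1 / real (k n)))\<^sup>2 = a ((k n)\<^sup>2) / real ((Suc (k n))\<^sup>2)"
      using that by (simp add: g_def power_divide)
    also have "\<dots> \<le> a n / real n" by (rule frac_le[OF nonneg mono[OF k(1)] n kk(2)])
    finally show "g (k n) * (1 / (1 + 1 / real (k n)))\<^sup>2 \<le> a n / real n" .
    have "a n / real n \<le> a ((Suc (k n))\<^sup>2) / real ((k n)\<^sup>2)"
      by (rule frac_le[OF nonneg mono[OF k(2)] kk(3) kk(1)])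
    also have "1 + 1 / real (k n) = real (Suc (k n)) / real (k n)" using that by (simp add: field_simps)
    then have "a ((Suc (k n))\<^sup>2) / real ((k n)\<^sup>2) = g (Suc (k n)) * (1 + 1 / real (k n))\<^sup>2"
      using that by (simp add: g_def power_divide del: of_nat_Suc)
    finally show "a n / real n \<le> g (Suc (k n)) * (1 + 1 / real (k n))\<^sup>2" .
  qed
  have ev: "eventually (\<lambda>n. 1 \<le> k n) sequentially"
    using k_lim unfolding filterlim_at_top by blast
  show ?thesis
  proof (rule tendsto_sandwich)
    show "eventually (\<lambda>n. g (k n) * (1 / (1 + 1 / real (k n)))\<^sup>2 \<le> a n / real n) sequentially"
      using ev by eventually_elim (rule bounds)
    show "eventually (\<lambda>n. a n / real n \<le> g (Suc (k n)) * (1 + 1 / real (k n))\<^sup>2) sequentially"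
      using ev by eventually_elim (rule bounds)
    show "(\<lambda>n. g (k n) * (1 / (1 + 1 / real (k n)))\<^sup>2) \<longlonglongrightarrow> \<mu>"
      using filterlim_compose[OF L k_lim] by simp
    show "(\<lambda>n. g (Suc (k n)) * (1 + 1 / real (k n))\<^sup>2) \<longlonglongrightarrow> \<mu>"
      using filterlim_compose[OF U k_lim] by simp
  qed
qed

text \<open>The series of the squares has finite expectation, so it converges almost surely and its
  terms tend to 0.\<close>

lemma (in prob_space) AE_tendsto_0_square_summable:
  fixes Z :: "nat \<Rightarrow> 'a \<Rightarrow> real"
  assumes int: "\<And>k. integrable M (\<lambda>\<omega>. (Z k \<omega>)\<^sup>2)"
    and le: "\<And>k. (\<integral>\<omega>. (Z k \<omega>)\<^sup>2 \<partial>M) \<le> c k" and c: "summable c"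
  shows "AE \<omega> in M. (\<lambda>k. Z k \<omega>) \<longlonglongrightarrow> 0"
proof -
  have c0: "0 \<le> c k" for k using le[of k] by (rule order_trans[rotated]) simp
  have meas: "(\<lambda>\<omega>. ennreal ((Z k \<omega>)\<^sup>2)) \<in> borel_measurable M" for k
    using borel_measurable_integrable[OF int] by measurable
  have sum_meas: "(\<lambda>\<omega>. \<Sum>k. f k \<omega>) \<in> borel_measurable M"
    if "\<And>k. f k \<in> borel_measurable M" for f :: "nat \<Rightarrow> 'a \<Rightarrow> ennreal"
    using that by measurable
  have "(\<integral>\<^sup>+\<omega>. (\<Sum>k. ennreal ((Z k \<omega>)\<^sup>2)) \<partial>M) = (\<Sum>k. \<integral>\<^sup>+\<omega>. ennreal ((Z k \<omega>)\<^sup>2) \<partial>M)"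
    by (rule nn_integral_suminf) (rule meas)
  also have "\<dots> \<le> (\<Sum>k. ennreal (c k))"
    using int le by (intro suminf_le) (auto simp: nn_integral_eq_integral ennreal_leI)
  also have "\<dots> < \<infinity>" using suminf_ennreal2[OF c0 c] by simp
  finally have "AE \<omega> in M. (\<Sum>k. ennreal ((Z k \<omega>)\<^sup>2)) \<noteq> \<infinity>"
    by (intro nn_integral_noteq_infinite sum_meas meas) auto
  then show ?thesis
  proof eventually_elim
    case (elim \<omega>)
    then have "summable (\<lambda>k. (Z k \<omega>)\<^sup>2)" by (intro summable_suminf_not_top) auto
    then have "(\<lambda>k. (Z k \<omega>)\<^sup>2) \<longlonglongrightarrow> 0" by (rule summable_LIMSEQ_zero)
    then have "(\<lambda>k. sqrt ((Z k \<omega>)\<^sup>2)) \<longlonglongrightarrow> sqrt 0" by (rule tendsto_real_sqrt)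
    then show ?case by (simp add: tendsto_rabs_zero_iff)
  qed
qed

lemma char_normal_density:
  assumes "0 < \<sigma>"
  shows "char (density lborel (normal_density 0 \<sigma>)) t = of_real (exp (- (t\<^sup>2 * \<sigma>\<^sup>2 / 2)))"
proof -
  interpret N: prob_space std_normal_distribution by (rule prob_space_normal_density) simp
  have "distributed std_normal_distribution lborel (\<lambda>x. x) std_normal_density"
    unfolding distributed_def by (auto simp: distr_id2)
  from N.normal_density_affine[OF this, of \<sigma> 0] assms
  have "distributed std_normal_distribution lborel (\<lambda>x. \<sigma> * x) (normal_density 0 \<sigma>)" by simp
  then have d: "density lborel (normal_density 0 \<sigma>) = distr std_normal_distribution lborel (\<lambda>x. \<sigma> * x)"
    by (simp add: distributed_def)
  have "char (density lborel (normal_density 0 \<sigma>)) t = char std_normal_distribution (t * \<sigma>)"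
    unfolding d char_def by (subst integral_distr) (auto simp: mult_ac)
  also have "\<dots> = of_real (exp (- (t\<^sup>2 * \<sigma>\<^sup>2 / 2)))"
    by (simp add: char_std_normal_distribution power_mult_distrib)
  finally show ?thesis .
qed

section \<open>Limit laws for the height of the chain\<close>

context corrected_chain
begin

text \<open>At time k ^ 2 the mean square error of the quotient is of order 1 / k ^ 2, which is
  summable; monotonicity fills the gaps between squares.\<close>

lemma height_strong_law: "AE \<omega> in M. (\<lambda>n. real (H n \<omega>) / real n) \<longlonglongrightarrow> \<mu>"
proof -
  obtain K where K: "\<And>n. ex n (\<lambda>h b. (real h - real n * \<mu>)\<^sup>2) \<le> K * (real n + 1)"
    using second_moment by blast
  have K0: "0 \<le> K"
  proof -
    have "0 \<le> ex 0 (\<lambda>h b. (real h - real 0 * \<mu>)\<^sup>2)" by (rule ex_nonneg) simp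
    then show ?thesis using K[of 0] by simp
  qed
  \<comment> \<open>The squares start at 1, which avoids division by 0.\<close>
  define Z where "Z k \<omega> = real (H ((Suc k)\<^sup>2) \<omega>) / real ((Suc k)\<^sup>2) - \<mu>" for k \<omega>
  have Z: "(Z k \<omega>)\<^sup>2 = (1 / real ((Suc k)\<^sup>2))\<^sup>2 * (real (H ((Suc k)\<^sup>2) \<omega>) - real ((Suc k)\<^sup>2) * \<mu>)\<^sup>2" for k \<omega>
  proof -
    have "Z k \<omega> = 1 / real ((Suc k)\<^sup>2) * (real (H ((Suc k)\<^sup>2) \<omega>) - real ((Suc k)\<^sup>2) * \<mu>)"
      by (simp add: Z_def right_diff_distrib del: of_nat_Suc)
    then show ?thesis by (simp only: power_mult_distrib)
  qed
  have "AE \<omega> in M. (\<lambda>k. Z k \<omega>) \<longlonglongrightarrow> 0"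
  proof (rule AE_tendsto_0_square_summable)
    show "integrable M (\<lambda>\<omega>. (Z k \<omega>)\<^sup>2)" for k
      unfolding Z by (rule integrable_chain[of "\<lambda>h _. (1 / real ((Suc k)\<^sup>2))\<^sup>2 * (real h - real ((Suc k)\<^sup>2) * \<mu>)\<^sup>2"])
    show "(\<integral>\<omega>. (Z k \<omega>)\<^sup>2 \<partial>M) \<le> 2 * K * inverse (real (Suc k) ^ 2)" for k
    proof -
      let ?n = "(Suc k)\<^sup>2"
      have n: "1 \<le> real ?n" by simp
      have "(\<integral>\<omega>. (Z k \<omega>)\<^sup>2 \<partial>M) = (1 / real ?n)\<^sup>2 * ex ?n (\<lambda>h b. (real h - real ?n * \<mu>)\<^sup>2)"
        unfolding Z ex_def by simp
      also have "\<dots> \<le> (1 / real ?n)\<^sup>2 * (K * (real ?n + 1))" by (intro mult_left_mono K) auto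
      also have "\<dots> \<le> (1 / real ?n)\<^sup>2 * (K * (2 * real ?n))" using n K0 by (intro mult_left_mono) auto
      also have "\<dots> = 2 * K * inverse (real ?n)" using n by (simp add: power2_eq_square field_simps del: of_nat_Suc)
      finally show ?thesis by (simp del: of_nat_Suc)
    qed
    show "summable (\<lambda>k. 2 * K * inverse (real (Suc k) ^ 2))"
      using summable_Suc_iff[of "\<lambda>k. inverse (real k ^ 2)"] inverse_power_summable[of 2, where 'a = real]
      by (intro summable_mult) simp
  qed
  moreover have "AE \<omega> in M. \<forall>n. H n \<omega> \<le> H (Suc n) \<omega>"
    using chain_mono by (simp add: AE_all_countable)
  ultimately show ?thesis
  proof eventually_elim
    case (elim \<omega>)
    have mono: "H m \<omega> \<le> H n \<omega>" if "m \<le> n" for m n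
      by (rule lift_Suc_mono_le[of "\<lambda>n. H n \<omega>", OF _ that]) (rule elim(2)[rule_format])
    have "(\<lambda>k. Z k \<omega> + \<mu>) \<longlonglongrightarrow> 0 + \<mu>" by (intro tendsto_intros elim)
    then have "(\<lambda>k. real (H ((Suc k)\<^sup>2) \<omega>) / real ((Suc k)\<^sup>2)) \<longlonglongrightarrow> \<mu>"
      unfolding Z_def diff_add_cancel add_0 .
    then have "(\<lambda>k. real (H (k\<^sup>2) \<omega>) / real (k\<^sup>2)) \<longlonglongrightarrow> \<mu>"
      by (rule LIMSEQ_imp_Suc[of "\<lambda>k. real (H (k\<^sup>2) \<omega>) / real (k\<^sup>2)"])
    moreover have "real (H m \<omega>) \<le> real (H n \<omega>)" if "m \<le> n" for m n
      using mono[OF that] by simp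
    ultimately show ?case by (intro tendsto_from_squares[of "\<lambda>n. real (H n \<omega>)"]) simp_all
  qed
qed

text \<open>Centring at (n + 1) * \<mu> instead of n * \<mu> multiplies the characteristic function
  by a phase that tends to 1.\<close>

lemma char_limit_shifted:
  "(\<lambda>n. \<integral>\<omega>. iexp (t * ((real (H n \<omega>) - real (Suc n) * \<mu>) / sqrt (real (Suc n)))) \<partial>M)
    \<longlonglongrightarrow> of_real (exp (- (t\<^sup>2 * \<sigma>2 / 2)))"
proof -
  let ?r = "\<lambda>n. sqrt (real n + 1)"
  have "(\<lambda>n. 1 / (real n + 1)) \<longlonglongrightarrow> 0"
    using LIMSEQ_Suc[OF lim_1_over_n[where 'a = real]] by (simp add: add.commute)
  from tendsto_real_sqrt[OF this] have "(\<lambda>n. 1 / ?r n) \<longlonglongrightarrow> 0" by (simp add: real_sqrt_divide)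
  then have "(\<lambda>n. - (t * \<mu>) * (1 / ?r n)) \<longlonglongrightarrow> - (t * \<mu>) * 0" by (intro tendsto_intros)
  then have "(\<lambda>n. exp (\<i> * of_real (- (t * \<mu>) * (1 / ?r n)))) \<longlonglongrightarrow> exp (\<i> * of_real (- (t * \<mu>) * 0))"
    by (rule tendsto_exp[OF tendsto_mult[OF tendsto_const tendsto_of_real]])
  from tendsto_mult[OF this char_limit[of t]]
  have "(\<lambda>n. iexp (- (t * \<mu>) * (1 / ?r n)) * cex n (\<lambda>h b. iexp (t / ?r n * (real h - real n * \<mu>))))
      \<longlonglongrightarrow> of_real (exp (- (t\<^sup>2 * \<sigma>2 / 2)))" by simp
  moreover have "iexp (- (t * \<mu>) * (1 / ?r n)) * cex n (\<lambda>h b. iexp (t / ?r n * (real h - real n * \<mu>)))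
      = (\<integral>\<omega>. iexp (t * ((real (H n \<omega>) - real (Suc n) * \<mu>) / sqrt (real (Suc n)))) \<partial>M)" for n
  proof -
    have "- (t * \<mu>) * (1 / ?r n) + t / ?r n * (real h - real n * \<mu>) = t * ((real h - real (Suc n) * \<mu>) / sqrt (real (Suc n)))" for h
      by (simp add: add.commute add_divide_distrib[symmetric] diff_divide_distrib[symmetric] algebra_simps)
    then have "iexp (- (t * \<mu>) * (1 / ?r n)) * iexp (t / ?r n * (real h - real n * \<mu>))
        = iexp (t * ((real h - real (Suc n) * \<mu>) / sqrt (real (Suc n))))" for h
      unfolding exp_add[symmetric] distrib_left[symmetric] of_real_add[symmetric] by (simp only:)
    then show ?thesis unfolding cex_cmult[symmetric] unfolding cex_def by (simp only:)
  qed
  ultimately show ?thesis by (simp only:)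
qed

end

context boundary_profile
begin

section \<open>From trees to profiles\<close>

text \<open>The truncated subtraction is exact on the boundary of a finite subtree, by
  \<open>boundary_length\<close>.\<close>

definition profile :: "nat list set \<Rightarrow> nat multiset" where
  "profile B = image_mset (\<lambda>x. tree_height B + 1 - length x) (mset_set (ext_boundary d B))"

lemma length_le_height:
  assumes "B \<in> finite_subtrees d" "x \<in> B"
  shows "length x \<le> tree_height B"
  unfolding tree_height_def using assms by (intro Max_ge) (auto simp: finite_subtrees_def)

lemma boundary_length:
  assumes "B \<in> finite_subtrees d" "x \<in> ext_boundary d B"
  shows "length x \<le> tree_height B + 1"
  using length_le_height[OF assms(1), of "butlast x"] assms(2) by (auto simp: ext_boundary_def)

lemma ext_boundary_insert:
  assumes B: "B \<in> finite_subtrees d" and x: "x \<in> ext_boundary d B"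
  shows "ext_boundary d (insert x B) = (ext_boundary d B - {x}) \<union> (\<lambda>i. x @ [i]) ` {..<d}"
    and "((\<lambda>i. x @ [i]) ` {..<d}) \<inter> ext_boundary d B = {}"
proof -
  have x': "x \<in> vertices d" "x \<notin> B" using x by (auto simp: ext_boundary_def)
  have B': "[] \<in> B" "\<And>y. y \<in> B \<Longrightarrow> butlast y \<in> B" using B by (auto simp: finite_subtrees_def)
  have child: "x @ [i] \<notin> B" for i using B'(2)[of "x @ [i]"] x' by auto
  show "((\<lambda>i. x @ [i]) ` {..<d}) \<inter> ext_boundary d B = {}"
    using x' by (auto simp: ext_boundary_def)
  show "ext_boundary d (insert x B) = (ext_boundary d B - {x}) \<union> (\<lambda>i. x @ [i]) ` {..<d}"
  proof (intro equalityI subsetI)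
    fix y assume y: "y \<in> ext_boundary d (insert x B)"
    show "y \<in> (ext_boundary d B - {x}) \<union> (\<lambda>i. x @ [i]) ` {..<d}"
    proof (cases "butlast y = x")
      case True
      have "y \<noteq> []" using True x' B' by auto
      then have "y = x @ [last y]" "last y < d" using True y by (auto simp: ext_boundary_def vertices_def)
      then show ?thesis by auto
    next
      case False
      then show ?thesis using y by (auto simp: ext_boundary_def)
    qed
  next
    fix y assume "y \<in> (ext_boundary d B - {x}) \<union> (\<lambda>i. x @ [i]) ` {..<d}"
    then show "y \<in> ext_boundary d (insert x B)"
      using child x' by (auto simp: ext_boundary_def vertices_def)
  qed
qed

lemma tree_height_insert:
  assumes "B \<in> finite_subtrees d"
  shows "tree_height (insert x B) = max (length x) (tree_height B)"
  using assms unfolding tree_height_def by (subst image_insert, subst Max_insert) (auto simp: finite_subtrees_def)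

text \<open>The children replace x in the boundary. If the height is unchanged all other depths
  stay; otherwise each grows by one, since no subtraction is truncated.\<close>

lemma profile_insert:
  assumes B: "B \<in> finite_subtrees d" and x: "x \<in> ext_boundary d B"
  shows "length x \<le> tree_height B \<Longrightarrow> tree_height (insert x B) = tree_height B \<and>
      profile (insert x B) = ring (tree_height B + 1 - length x) (profile B)"
    and "length x = tree_height B + 1 \<Longrightarrow> tree_height (insert x B) = Suc (tree_height B) \<and>
      profile (insert x B) = rise (profile B)"
proof -
  let ?C = "(\<lambda>i. x @ [i]) ` {..<d}" and ?E = "ext_boundary d B" and ?h = "tree_height B"
  have fin: "finite ?E" by (rule finite_ext_boundary[OF B])
  have dis: "(?E - {x}) \<inter> ?C = {}" using ext_boundary_insert(2)[OF B x] by auto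
  have E: "mset_set ?E = add_mset x (mset_set (?E - {x}))" by (rule mset_set.remove[OF fin x])
  have card: "card ?C = d" by (simp add: card_image inj_on_def)
  have new: "profile (insert x B) = image_mset (\<lambda>y. tree_height (insert x B) + 1 - length y) (mset_set (?E - {x}))
      + replicate_mset d (tree_height (insert x B) + 1 - Suc (length x))"
  proof -
    have "image_mset (\<lambda>y. tree_height (insert x B) + 1 - length y) (mset_set ?C)
        = image_mset (\<lambda>_. tree_height (insert x B) + 1 - Suc (length x)) (mset_set ?C)"
      by (rule image_mset_cong) auto
    also have "\<dots> = replicate_mset d (tree_height (insert x B) + 1 - Suc (length x))"
      by (simp add: image_mset_const_eq card)
    finally show ?thesis
      unfolding profile_def ext_boundary_insert(1)[OF B x] using fin dis by (simp add: mset_set_Union)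
  qed
  show "tree_height (insert x B) = ?h \<and> profile (insert x B) = ring (?h + 1 - length x) (profile B)"
    if "length x \<le> ?h"
  proof
    show h: "tree_height (insert x B) = ?h" using tree_height_insert[OF B, of x] that by simp
    show "profile (insert x B) = ring (?h + 1 - length x) (profile B)"
      unfolding new h by (simp add: ring_def profile_def E)
  qed
  show "tree_height (insert x B) = Suc ?h \<and> profile (insert x B) = rise (profile B)"
    if l: "length x = ?h + 1"
  proof
    show h: "tree_height (insert x B) = Suc ?h" using tree_height_insert[OF B, of x] l by simp
    have "image_mset (\<lambda>y. Suc ?h + 1 - length y) (mset_set (?E - {x}))
        = image_mset Suc (image_mset (\<lambda>y. ?h + 1 - length y) (mset_set (?E - {x})))"
      unfolding image_mset.compositionality o_def
      using boundary_length[OF B] fin by (intro image_mset_cong) (auto simp: Suc_diff_le)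
    then show "profile (insert x B) = rise (profile B)"
      unfolding new h by (simp add: rise_def profile_def E l)
  qed
qed

lemma state_profile:
  assumes B: "B \<in> finite_subtrees d"
  shows "state (profile B)"
proof -
  have fin: "finite B" and ne: "B \<noteq> {}" using B by (auto simp: finite_subtrees_def)
  have "Max (length ` B) \<in> length ` B" using fin ne by (intro Max_in) auto
  then obtain x where x: "x \<in> B" "length x = tree_height B" by (auto simp: tree_height_def)
  let ?C = "(\<lambda>i. x @ [i]) ` {..<d}"
  have "x @ [i] \<notin> B" for i using length_le_height[OF B, of "x @ [i]"] x by auto
  moreover have "x \<in> vertices d" using x B by (auto simp: finite_subtrees_def)
  ultimately have "?C \<subseteq> {y \<in> ext_boundary d B. tree_height B + 1 - length y = 0}"
    using x \<open>x \<in> vertices d\<close> by (auto simp: ext_boundary_def vertices_def)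
  moreover have "card ?C = d" by (simp add: card_image inj_on_def)
  ultimately have "d \<le> card {y \<in> ext_boundary d B. tree_height B + 1 - length y = 0}"
    using card_mono[OF finite_subset[OF _ finite_ext_boundary[OF B]], of _ ?C] by auto
  then show ?thesis
    using finite_ext_boundary[OF B]
    by (auto simp: state_def profile_def count_image_mset_eq_card_vimage intro: order_trans card_mono)
qed

text \<open>The factor \<open>\<alpha> powi (- int (h + 1))\<close> common to all boundary vertices
  cancels in \<open>growth_prob\<close>, so the law of the next height and profile depends on the
  tree only through its height and profile. Positive depth and depth 0 give the two parts of
  \<open>step\<close>.\<close>

lemma sum_growth:
  assumes B: "B \<in> finite_subtrees d"
  shows "(\<Sum>x\<in>ext_boundary d B. growth_prob d \<alpha> B x * f (tree_height (insert x B)) (profile (insert x B)))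
    = step f (tree_height B) (profile B)"
proof -
  let ?E = "ext_boundary d B" and ?h = "tree_height B"
  define \<delta> where "\<delta> x = ?h + 1 - length x" for x :: "nat list"
  have fin: "finite ?E" by (rule finite_ext_boundary[OF B])
  have prof: "profile B = image_mset \<delta> (mset_set ?E)"
    unfolding profile_def by (rule image_mset_cong) (simp add: \<delta>_def)
  have p: "\<alpha> powi (- int (length x)) = \<alpha> ^ \<delta> x * \<alpha> powi (- int (?h + 1))" if "x \<in> ?E" for x
  proof -
    have "- int (length x) = int (\<delta> x) + (- int (?h + 1))"
      using boundary_length[OF B that] by (simp add: \<delta>_def)
    moreover have "\<alpha> powi (int i + j) = \<alpha> ^ i * \<alpha> powi j" for i j
      using al0 by (simp add: power_int_add)
    ultimately show ?thesis by (simp only:)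
  qed
  have "weight (profile B) = (\<Sum>x\<in>?E. \<alpha> ^ \<delta> x)"
    unfolding weight_def prof by (simp add: image_mset.compositionality o_def sum_unfold_sum_mset)
  then have w: "(\<Sum>x\<in>?E. \<alpha> powi (- int (length x))) = weight (profile B) * \<alpha> powi (- int (?h + 1))"
    using p by (simp add: sum_distrib_right)
  have g: "growth_prob d \<alpha> B x = \<alpha> ^ \<delta> x / weight (profile B)" if "x \<in> ?E" for x
    unfolding growth_prob_def w using al0 by (simp add: p[OF that])
  let ?f = "\<lambda>x. f (tree_height (insert x B)) (profile (insert x B))"
  have "(\<Sum>x\<in>?E. growth_prob d \<alpha> B x * ?f x) = (\<Sum>x\<in>?E. \<alpha> ^ \<delta> x * ?f x) / weight (profile B)"
    by (simp add: g sum_divide_distrib)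
  also have "(\<Sum>x\<in>?E. \<alpha> ^ \<delta> x * ?f x)
      = (\<Sum>x\<in>{x\<in>?E. 0 < \<delta> x}. \<alpha> ^ \<delta> x * ?f x) + (\<Sum>x\<in>{x\<in>?E. \<delta> x = 0}. \<alpha> ^ \<delta> x * ?f x)"
  proof -
    have "?E = {x\<in>?E. 0 < \<delta> x} \<union> {x\<in>?E. \<delta> x = 0}" by auto
    then show ?thesis using fin by (subst (1) \<open>?E = _\<close>, subst sum.union_disjoint) auto
  qed
  also have "(\<Sum>x\<in>{x\<in>?E. 0 < \<delta> x}. \<alpha> ^ \<delta> x * ?f x) = low_sum (f ?h) (profile B)"
  proof -
    have "(\<Sum>x\<in>{x\<in>?E. 0 < \<delta> x}. \<alpha> ^ \<delta> x * ?f x) = (\<Sum>x\<in>{x\<in>?E. 0 < \<delta> x}. \<alpha> ^ \<delta> x * f ?h (ring (\<delta> x) (profile B)))"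
      using profile_insert(1)[OF B] by (intro sum.cong) (auto simp: \<delta>_def)
    also have "\<dots> = low_sum (f ?h) (profile B)"
      unfolding low_sum_def lower_def prof filter_mset_image_mset
      using fin by (simp add: image_mset.compositionality o_def sum_unfold_sum_mset)
    finally show ?thesis .
  qed
  also have "(\<Sum>x\<in>{x\<in>?E. \<delta> x = 0}. \<alpha> ^ \<delta> x * ?f x) = tops (profile B) * f (Suc ?h) (rise (profile B))"
  proof -
    have "(\<Sum>x\<in>{x\<in>?E. \<delta> x = 0}. \<alpha> ^ \<delta> x * ?f x) = (\<Sum>x\<in>{x\<in>?E. \<delta> x = 0}. f (Suc ?h) (rise (profile B)))"
    proof (rule sum.cong)
      fix x assume x: "x \<in> {x\<in>?E. \<delta> x = 0}"
      then have "length x = ?h + 1" using boundary_length[OF B, of x] by (auto simp: \<delta>_def)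
      then show "\<alpha> ^ \<delta> x * ?f x = f (Suc ?h) (rise (profile B))" using x profile_insert(2)[OF B, of x] by simp
    qed simp
    moreover have "tops (profile B) = real (card {x\<in>?E. \<delta> x = 0})"
    proof -
      have "count (profile B) 0 = size (filter_mset (\<lambda>i. i = 0) (profile B))"
        by (simp add: filter_eq_replicate_mset)
      also have "filter_mset (\<lambda>i. i = 0) (profile B) = image_mset \<delta> (mset_set {x\<in>?E. \<delta> x = 0})"
        unfolding prof filter_mset_image_mset using fin by simp
      finally show ?thesis by (simp add: tops_def)
    qed
    ultimately show ?thesis by simp
  qed
  finally show ?thesis by (simp add: step_def)
qed

lemma profile_root: "tree_height {[]} = 0" "profile {[]} = replicate_mset d 0"
proof -
  show h: "tree_height {[]} = 0" by (simp add: tree_height_def)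
  have "ext_boundary d {[]} = (\<lambda>i. [i]) ` {..<d}"
  proof (intro equalityI subsetI)
    fix x assume "x \<in> ext_boundary d {[]}"
    then show "x \<in> (\<lambda>i. [i]) ` {..<d}"
      by (cases x rule: rev_cases) (auto simp: ext_boundary_def vertices_def)
  qed (auto simp: ext_boundary_def vertices_def)
  then have "profile {[]} = image_mset (\<lambda>x. 0 + 1 - length x) (mset_set ((\<lambda>i. [i]) ` {..<d}))"
    by (simp add: profile_def h)
  also have "\<dots> = image_mset (\<lambda>_. 0) (mset_set ((\<lambda>i. [i]) ` {..<d}))"
    by (rule image_mset_cong) auto
  also have "\<dots> = replicate_mset d 0" by (simp add: image_mset_const_eq card_image inj_on_def)
  finally show "profile {[]} = replicate_mset d 0" .
qed

lemma growth_prob_sum: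
  assumes B: "B \<in> finite_subtrees d"
  shows "(\<Sum>x\<in>ext_boundary d B. growth_prob d \<alpha> B x) = 1" "\<And>x. 0 \<le> growth_prob d \<alpha> B x"
proof -
  show "(\<Sum>x\<in>ext_boundary d B. growth_prob d \<alpha> B x) = 1"
    using sum_growth[OF B, of "\<lambda>_ _. 1"] weight_ge_1[OF state_profile[OF B]] by (simp add: step_def low_sum_const)
  show "0 \<le> growth_prob d \<alpha> B x" for x
    unfolding growth_prob_def using al0 by (intro divide_nonneg_nonneg sum_nonneg) auto
qed

end

section \<open>The growth model as a profile chain\<close>

locale deep_growth_model = boundary_profile d \<alpha> + growth_model d \<alpha> M A
  for d \<alpha> and M :: "'w measure" and A
begin

lemma tree_subtree: "1 \<le> n \<Longrightarrow> \<omega> \<in> space M \<Longrightarrow> A n \<omega> \<in> finite_subtrees d"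
  using measurable_space[OF measurable_tree] by simp

lemma tree_event: "1 \<le> n \<Longrightarrow> {\<omega> \<in> space M. A n \<omega> = B} \<in> sets M"
proof -
  assume n: "1 \<le> n"
  have "{\<omega> \<in> space M. A n \<omega> = B} = A n -` ({B} \<inter> finite_subtrees d) \<inter> space M"
    using tree_subtree[OF n] by auto
  also have "\<dots> \<in> sets M" by (rule measurable_sets[OF measurable_tree[OF n]]) auto
  finally show ?thesis .
qed

text \<open>\<open>growth_step\<close> conditions on whole histories. Those ending in B with
  positive probability all give the same conditional probability, and countably many histories
  exhaust the event, so the formula passes to conditioning on the present tree.\<close>

lemma transition_prob:
  assumes n: "1 \<le> n" and B: "B \<in> finite_subtrees d" and x: "x \<in> ext_boundary d B"
  shows "prob {\<omega> \<in> space M. A n \<omega> = B \<and> A (Suc n) \<omega> = insert x B} =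
    growth_prob d \<alpha> B x * prob {\<omega> \<in> space M. A n \<omega> = B}"
proof -
  let ?p = "growth_prob d \<alpha> B x"
  have p: "0 \<le> ?p" by (rule growth_prob_sum[OF B])
  define I where "I = {C \<in> {1..n} \<rightarrow>\<^sub>E finite_subtrees d. C n = B}"
  define F where "F C = {\<omega> \<in> space M. \<forall>i\<in>{1..n}. A i \<omega> = C i}" for C
  define E where "E = {\<omega> \<in> space M. A (Suc n) \<omega> = insert x B}"
  have I: "countable I"
    unfolding I_def by (rule countable_subset[of _ "{1..n} \<rightarrow>\<^sub>E finite_subtrees d"]) (auto intro!: countable_PiE countable_subtrees)
  have F: "F C \<in> sets M" for C
    unfolding F_def by (intro sets.sets_Collect_finite_All' tree_event) (use n in auto)
  have E: "E \<in> sets M" unfolding E_def by (rule tree_event) simp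
  have disj: "disjoint_family_on (\<lambda>C. F C \<inter> G) I" for G
    unfolding disjoint_family_on_def
  proof (intro ballI impI)
    fix C C' assume C: "C \<in> I" "C' \<in> I" "C \<noteq> C'"
    have "\<exists>i\<in>{1..n}. C i \<noteq> C' i"
    proof (rule ccontr)
      assume "\<not> ?thesis"
      then have "C = C'"
        using C(1,2) unfolding I_def by (intro PiE_ext[of C "{1..n}" "\<lambda>_. finite_subtrees d"]) auto
      with C(3) show False by simp
    qed
    then obtain i where "i \<in> {1..n}" "C i \<noteq> C' i" by blast
    then show "(F C \<inter> G) \<inter> (F C' \<inter> G) = {}" by (auto simp: F_def)
  qed
  have un: "{\<omega> \<in> space M. A n \<omega> = B} = (\<Union>C\<in>I. F C \<inter> space M)"
  proof (intro equalityI subsetI)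
    fix \<omega> assume \<omega>: "\<omega> \<in> {\<omega> \<in> space M. A n \<omega> = B}"
    then have "restrict (\<lambda>i. A i \<omega>) {1..n} \<in> I" unfolding I_def using tree_subtree n by auto
    moreover have "\<omega> \<in> F (restrict (\<lambda>i. A i \<omega>) {1..n}) \<inter> space M" using \<omega> by (auto simp: F_def)
    ultimately show "\<omega> \<in> (\<Union>C\<in>I. F C \<inter> space M)" by blast
  qed (use n in \<open>auto simp: I_def F_def\<close>)
  then have un': "{\<omega> \<in> space M. A n \<omega> = B \<and> A (Suc n) \<omega> = insert x B} = (\<Union>C\<in>I. F C \<inter> E)"
    by (auto simp: E_def)
  have one: "emeasure M (F C \<inter> E) = ennreal ?p * emeasure M (F C \<inter> space M)" if C: "C \<in> I" for C
  proof -
    have eq: "F C \<inter> E = {\<omega> \<in> space M. A (Suc n) \<omega> = insert x (C n) \<and> (\<forall>i\<in>{1..n}. A i \<omega> = C i)}"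
      using C by (auto simp: F_def E_def I_def)
    have sp: "F C \<inter> space M = F C" by (auto simp: F_def)
    have "prob (F C \<inter> E) = ?p * prob (F C)"
    proof (cases "prob (F C) > 0")
      case True
      have "\<P>(\<omega> in M. A (Suc n) \<omega> = insert x (C n) \<bar> \<forall>i\<in>{1..n}. A i \<omega> = C i) = growth_prob d \<alpha> (C n) x"
        by (rule growth_step[OF n]) (use True C x in \<open>auto simp: F_def I_def\<close>)
      then have "prob (F C \<inter> E) / prob (F C) = ?p"
        unfolding cond_prob_def eq F_def[symmetric] using C by (simp add: I_def)
      then show ?thesis using True by (simp add: field_simps)
    next
      case False
      then have "prob (F C) = 0" using measure_nonneg[of M "F C"] by linarith
      moreover have "prob (F C \<inter> E) \<le> prob (F C)" by (rule finite_measure_mono) (auto simp: F)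
      ultimately show ?thesis using measure_nonneg[of M "F C \<inter> E"] by simp
    qed
    then show ?thesis unfolding sp by (simp add: emeasure_eq_measure ennreal_mult p)
  qed
  have "emeasure M (\<Union>C\<in>I. F C \<inter> E) = (\<integral>\<^sup>+C. emeasure M (F C \<inter> E) \<partial>count_space I)"
    by (rule emeasure_UN_countable) (use F E I disj in auto)
  also have "\<dots> = (\<integral>\<^sup>+C. ennreal ?p * emeasure M (F C \<inter> space M) \<partial>count_space I)"
    by (rule nn_integral_cong) (simp add: one)
  also have "\<dots> = ennreal ?p * (\<integral>\<^sup>+C. emeasure M (F C \<inter> space M) \<partial>count_space I)"
    by (rule nn_integral_cmult) simp
  also have "(\<integral>\<^sup>+C. emeasure M (F C \<inter> space M) \<partial>count_space I) = emeasure M (\<Union>C\<in>I. F C \<inter> space M)"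
    by (rule emeasure_UN_countable[symmetric]) (use F I disj[of "space M"] in auto)
  finally show ?thesis
    unfolding un'[symmetric] un[symmetric]
    by (simp add: emeasure_eq_measure p ennreal_mult[symmetric])
qed

text \<open>The growth probabilities over the boundary sum to 1, so nothing is left for other
  transitions.\<close>

lemma AE_growth:
  assumes n: "1 \<le> n"
  shows "AE \<omega> in M. \<exists>x\<in>ext_boundary d (A n \<omega>). A (Suc n) \<omega> = insert x (A n \<omega>)"
proof -
  have "AE \<omega> in M. A n \<omega> = B \<longrightarrow> (\<exists>x\<in>ext_boundary d B. A (Suc n) \<omega> = insert x B)"
    if B: "B \<in> finite_subtrees d" for B
  proof -
    define E where "E x = {\<omega> \<in> space M. A n \<omega> = B \<and> A (Suc n) \<omega> = insert x B}" for x
    define F where "F = {\<omega> \<in> space M. A n \<omega> = B}"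
    have F: "F \<in> sets M" unfolding F_def by (rule tree_event[OF n])
    have E: "E x \<in> sets M" for x
    proof -
      have "E x = F \<inter> {\<omega> \<in> space M. A (Suc n) \<omega> = insert x B}" by (auto simp: E_def F_def)
      then show ?thesis using F tree_event[of "Suc n" "insert x B"] by auto
    qed
    have fin: "finite (ext_boundary d B)" by (rule finite_ext_boundary[OF B])
    have "disjoint_family_on E (ext_boundary d B)"
      by (auto simp: disjoint_family_on_def E_def ext_boundary_def)
    then have "prob (\<Union>x\<in>ext_boundary d B. E x) = (\<Sum>x\<in>ext_boundary d B. prob (E x))"
      using fin E by (intro finite_measure_finite_Union) auto
    also have "\<dots> = prob F"
      unfolding E_def F_def using transition_prob[OF n B] growth_prob_sum(1)[OF B]
      by (simp add: sum_distrib_right[symmetric])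
    finally have "prob (F - (\<Union>x\<in>ext_boundary d B. E x)) = 0"
      using F E fin by (subst finite_measure_Diff) (auto simp: E_def F_def)
    then have "F - (\<Union>x\<in>ext_boundary d B. E x) \<in> null_sets M"
      using F E fin by (intro null_setsI) (auto simp: emeasure_eq_measure)
    then have "AE \<omega> in M. \<omega> \<notin> F - (\<Union>x\<in>ext_boundary d B. E x)" by (rule AE_not_in)
    then show ?thesis by (rule AE_mp) (auto simp: F_def E_def)
  qed
  then have "AE \<omega> in M. \<forall>B\<in>finite_subtrees d. A n \<omega> = B \<longrightarrow> (\<exists>x\<in>ext_boundary d B. A (Suc n) \<omega> = insert x B)"
    unfolding AE_ball_countable[OF countable_subtrees] by blast
  then show ?thesis by (rule AE_mp) (use tree_subtree[OF n] in auto)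
qed

lemma finite_range: "\<exists>S. finite S \<and> S \<subseteq> finite_subtrees d \<and> (AE \<omega> in M. A (Suc n) \<omega> \<in> S)"
proof (induction n)
  case 0
  show ?case
    using initial_tree by (intro exI[of _ "{{[]}}"]) (auto simp: finite_subtrees_def vertices_def)
next
  case (Suc n)
  then obtain S where S: "finite S" "S \<subseteq> finite_subtrees d" "AE \<omega> in M. A (Suc n) \<omega> \<in> S" by blast
  let ?S = "\<Union>B\<in>S. (\<lambda>x. insert x B) ` ext_boundary d B"
  have "finite ?S" using S finite_ext_boundary by auto
  moreover have "?S \<subseteq> finite_subtrees d" using S insert_subtrees by auto
  moreover have "AE \<omega> in M. A (Suc (Suc n)) \<omega> \<in> ?S"
    using S(3) AE_growth[of "Suc n", simplified] by eventually_elim auto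
  ultimately show ?case by blast
qed

text \<open>Almost surely only finitely many pairs of a tree and an added vertex occur, so both
  sides are finite sums matched by \<open>transition_prob\<close>.\<close>

lemma integral_growth:
  fixes \<phi> :: "nat list set \<Rightarrow> real"
  shows "(\<integral>\<omega>. \<phi> (A (Suc (Suc n)) \<omega>) \<partial>M) =
    (\<integral>\<omega>. (\<Sum>x\<in>ext_boundary d (A (Suc n) \<omega>). growth_prob d \<alpha> (A (Suc n) \<omega>) x * \<phi> (insert x (A (Suc n) \<omega>))) \<partial>M)"
proof -
  obtain S where S: "finite S" "S \<subseteq> finite_subtrees d" "AE \<omega> in M. A (Suc n) \<omega> \<in> S" using finite_range by blast
  let ?b = "ext_boundary d" and ?g = "growth_prob d \<alpha>"
  define E where "E B x = {\<omega> \<in> space M. A (Suc n) \<omega> = B \<and> A (Suc (Suc n)) \<omega> = insert x B}" for B x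
  define F where "F B = {\<omega> \<in> space M. A (Suc n) \<omega> = B}" for B
  have F: "F B \<in> sets M" for B unfolding F_def by (rule tree_event) simp
  have E: "E B x \<in> sets M" for B x
  proof -
    have "E B x = F B \<inter> {\<omega> \<in> space M. A (Suc (Suc n)) \<omega> = insert x B}" by (auto simp: E_def F_def)
    then show ?thesis using F tree_event[of "Suc (Suc n)" "insert x B"] by auto
  qed
  have fin: "finite (?b B)" if "B \<in> S" for B using S that finite_ext_boundary by blast
  have meas: "(\<lambda>\<omega>. \<psi> (A (Suc m) \<omega>)) \<in> borel_measurable M" for m and \<psi> :: "nat list set \<Rightarrow> real"
    by (rule measurable_compose[OF measurable_tree]) auto
  have "(\<integral>\<omega>. \<phi> (A (Suc (Suc n)) \<omega>) \<partial>M) = (\<integral>\<omega>. (\<Sum>B\<in>S. \<Sum>x\<in>?b B. \<phi> (insert x B) * indicator (E B x) \<omega>) \<partial>M)"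
  proof (rule integral_cong_AE[OF meas])
    show "(\<lambda>\<omega>. \<Sum>B\<in>S. \<Sum>x\<in>?b B. \<phi> (insert x B) * indicator (E B x) \<omega>) \<in> borel_measurable M"
      using E by (intro borel_measurable_sum borel_measurable_times borel_measurable_indicator) auto
    have "AE \<omega> in M. \<omega> \<in> space M" by (rule AE_space)
    then show "AE \<omega> in M. \<phi> (A (Suc (Suc n)) \<omega>) = (\<Sum>B\<in>S. \<Sum>x\<in>?b B. \<phi> (insert x B) * indicator (E B x) \<omega>)"
      using S(3) AE_growth[of "Suc n", simplified]
    proof eventually_elim
      case (elim \<omega>)
      let ?B = "A (Suc n) \<omega>"
      obtain y where y: "y \<in> ?b ?B" "A (Suc (Suc n)) \<omega> = insert y ?B" using elim by blast
      have "(\<Sum>B\<in>S. \<Sum>x\<in>?b B. \<phi> (insert x B) * indicator (E B x) \<omega>)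
          = (\<Sum>B\<in>S. if B = ?B then \<Sum>x\<in>?b B. \<phi> (insert x B) * indicator (E B x) \<omega> else 0)"
        by (intro sum.cong) (auto simp: E_def)
      also have "\<dots> = (\<Sum>x\<in>?b ?B. \<phi> (insert x ?B) * indicator (E ?B x) \<omega>)"
        using elim S(1) by simp
      also have "\<dots> = (\<Sum>x\<in>?b ?B. if x = y then \<phi> (insert x ?B) else 0)"
      proof (rule sum.cong)
        fix x assume "x \<in> ?b ?B"
        then have "insert x ?B = insert y ?B \<longleftrightarrow> x = y" using y by (auto simp: ext_boundary_def)
        then show "\<phi> (insert x ?B) * indicator (E ?B x) \<omega> = (if x = y then \<phi> (insert x ?B) else 0)"
          using elim y by (auto simp: E_def indicator_def)
      qed simp
      also have "\<dots> = \<phi> (insert y ?B)" using y(1) fin elim by simp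
      finally show ?case using y by simp
    qed
  qed
  also have "\<dots> = (\<Sum>B\<in>S. \<Sum>x\<in>?b B. \<phi> (insert x B) * prob (E B x))"
    using E by (simp add: Bochner_Integration.integral_sum integrable_real_indicator emeasure_eq_measure)
  also have "\<dots> = (\<Sum>B\<in>S. (\<Sum>x\<in>?b B. ?g B x * \<phi> (insert x B)) * prob (F B))"
    using S(2) transition_prob[of "Suc n", simplified] unfolding E_def F_def
    by (intro sum.cong refl) (auto simp: sum_distrib_right intro!: sum.cong)
  also have "\<dots> = (\<integral>\<omega>. (\<Sum>B\<in>S. (\<Sum>x\<in>?b B. ?g B x * \<phi> (insert x B)) * indicator (F B) \<omega>) \<partial>M)"
    using F by (simp add: Bochner_Integration.integral_sum integrable_real_indicator emeasure_eq_measure)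
  also have "\<dots> = (\<integral>\<omega>. (\<Sum>x\<in>?b (A (Suc n) \<omega>). ?g (A (Suc n) \<omega>) x * \<phi> (insert x (A (Suc n) \<omega>))) \<partial>M)"
  proof (rule integral_cong_AE)
    show "(\<lambda>\<omega>. \<Sum>B\<in>S. (\<Sum>x\<in>?b B. ?g B x * \<phi> (insert x B)) * indicator (F B) \<omega>) \<in> borel_measurable M"
      using F by (intro borel_measurable_sum borel_measurable_times borel_measurable_indicator) auto
    show "(\<lambda>\<omega>. \<Sum>x\<in>?b (A (Suc n) \<omega>). ?g (A (Suc n) \<omega>) x * \<phi> (insert x (A (Suc n) \<omega>))) \<in> borel_measurable M"
      by (rule meas)
    have "AE \<omega> in M. \<omega> \<in> space M" by (rule AE_space)
    then show "AE \<omega> in M. (\<Sum>B\<in>S. (\<Sum>x\<in>?b B. ?g B x * \<phi> (insert x B)) * indicator (F B) \<omega>)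
        = (\<Sum>x\<in>?b (A (Suc n) \<omega>). ?g (A (Suc n) \<omega>) x * \<phi> (insert x (A (Suc n) \<omega>)))"
      using S(3)
    proof eventually_elim
      case (elim \<omega>)
      have "(\<Sum>B\<in>S. (\<Sum>x\<in>?b B. ?g B x * \<phi> (insert x B)) * indicator (F B) \<omega>)
          = (\<Sum>B\<in>S. if B = A (Suc n) \<omega> then \<Sum>x\<in>?b B. ?g B x * \<phi> (insert x B) else 0)"
        using elim by (intro sum.cong) (auto simp: F_def indicator_def)
      then show ?case using elim S(1) by simp
    qed
  qed
  finally show ?thesis .
qed

text \<open>Time is shifted by one: the chain starts at time 0, the growth model at time 1.\<close>

sublocale profile_chain d \<alpha> M "\<lambda>n \<omega>. tree_height (A (Suc n) \<omega>)" "\<lambda>n \<omega>. profile (A (Suc n) \<omega>)"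
proof
  fix n :: nat
  show "(\<lambda>\<omega>. (tree_height (A (Suc n) \<omega>), profile (A (Suc n) \<omega>))) \<in> M \<rightarrow>\<^sub>M count_space UNIV"
    by (rule measurable_compose[OF measurable_tree]) auto
  obtain S where S: "finite S" "AE \<omega> in M. A (Suc n) \<omega> \<in> S" using finite_range by blast
  show "\<exists>S. finite S \<and> (AE \<omega> in M. (tree_height (A (Suc n) \<omega>), profile (A (Suc n) \<omega>)) \<in> S)"
    using S by (intro exI[of _ "(\<lambda>B. (tree_height B, profile B)) ` S"]) (auto elim!: eventually_mono)
  have sub: "AE \<omega> in M. A (Suc n) \<omega> \<in> finite_subtrees d"
    using AE_space by eventually_elim (simp add: tree_subtree)
  show "AE \<omega> in M. state (profile (A (Suc n) \<omega>))"
    using sub by eventually_elim (rule state_profile)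
  show "AE \<omega> in M. tree_height (A (Suc 0) \<omega>) = 0 \<and> profile (A (Suc 0) \<omega>) = replicate_mset d 0"
    using initial_tree by eventually_elim (simp add: profile_root)
  show "AE \<omega> in M. tree_height (A (Suc n) \<omega>) \<le> tree_height (A (Suc (Suc n)) \<omega>)"
    using sub AE_growth[of "Suc n", simplified]
    by eventually_elim (auto simp: tree_height_insert)
  fix f :: "nat \<Rightarrow> nat multiset \<Rightarrow> real"
  show "(\<integral>\<omega>. f (tree_height (A (Suc (Suc n)) \<omega>)) (profile (A (Suc (Suc n)) \<omega>)) \<partial>M)
      = (\<integral>\<omega>. step f (tree_height (A (Suc n) \<omega>)) (profile (A (Suc n) \<omega>)) \<partial>M)"
    unfolding integral_growth[of "\<lambda>B. f (tree_height B) (profile B)"]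
    by (rule Bochner_Integration.integral_cong[OF refl]) (simp add: sum_growth tree_subtree)
qed

end

section \<open>Transfer to the time of the tree\<close>

lemma growth_height_limits:
  fixes M :: "'w measure"
  assumes "corrected_profile d \<alpha> \<mu> \<sigma>2 D v w" "growth_model d \<alpha> M A"
  shows "\<mu> < 1" "0 < \<sigma>2" "height_LLN M A \<mu>" "height_CLT M A \<mu> \<sigma>2"
proof -
  interpret C: corrected_profile d \<alpha> \<mu> \<sigma>2 D v w by fact
  interpret G: growth_model d \<alpha> M A by fact
  interpret T: deep_growth_model d \<alpha> M A ..
  interpret K: corrected_chain d \<alpha> \<mu> \<sigma>2 D v w M
    "\<lambda>n \<omega>. tree_height (A (Suc n) \<omega>)" "\<lambda>n \<omega>. C.profile (A (Suc n) \<omega>)"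
    by (rule corrected_chain.intro[OF assms(1) T.profile_chain_axioms])
  show "\<mu> < 1" by (rule K.mu_less_1)
  show \<sigma>2: "0 < \<sigma>2" by (rule K.sigma2_pos)
  show "height_LLN M A \<mu>"
    unfolding height_LLN_def
    using K.height_strong_law
  proof eventually_elim
    case (elim \<omega>)
    \<comment> \<open>Changes the divisor from n, the time of the chain, to n + 1, the time of the
      tree.\<close>
    have "(\<lambda>n. 1 - 1 / real (Suc n)) \<longlonglongrightarrow> 1 - 0"
      by (intro tendsto_diff tendsto_const LIMSEQ_Suc[OF lim_1_over_n])
    from tendsto_mult[OF elim this]
    have "(\<lambda>n. real (tree_height (A (Suc n) \<omega>)) / real n * (1 - 1 / real (Suc n))) \<longlonglongrightarrow> \<mu>" by simp
    moreover have "real (tree_height (A (Suc n) \<omega>)) / real n * (1 - 1 / real (Suc n))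
        = real (tree_height (A (Suc n) \<omega>)) / real (Suc n)" if "0 < n" for n
    proof -
      have "1 - 1 / real (Suc n) = real n / real (Suc n)" by (simp add: field_simps)
      then show ?thesis using that by (simp del: of_nat_Suc)
    qed
    then have "eventually (\<lambda>n. real (tree_height (A (Suc n) \<omega>)) / real n * (1 - 1 / real (Suc n))
        = real (tree_height (A (Suc n) \<omega>)) / real (Suc n)) sequentially"
      by (rule eventually_mono[OF eventually_gt_at_top[of 0]])
    ultimately have "(\<lambda>n. real (tree_height (A (Suc n) \<omega>)) / real (Suc n)) \<longlonglongrightarrow> \<mu>"
      by (rule Lim_transform_eventually)
    then show ?case by (rule LIMSEQ_imp_Suc)
  qed
  let ?X = "\<lambda>n \<omega>. (real (tree_height (A n \<omega>)) - real n * \<mu>) / sqrt (real n)"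
  \<comment> \<open>At n = 0, where A 0 is unconstrained, division by sqrt 0 makes the function
    constantly 0.\<close>
  have X: "?X n \<in> borel_measurable M" for n
  proof (cases n)
    case (Suc m)
    have "(\<lambda>\<omega>. (\<lambda>B. (real (tree_height B) - real n * \<mu>) / sqrt (real n)) (A n \<omega>)) \<in> borel_measurable M"
      by (rule measurable_compose[OF G.measurable_tree]) (auto simp: Suc)
    then show ?thesis by simp
  qed simp
  show "height_CLT M A \<mu> \<sigma>2"
    unfolding height_CLT_def
  proof (rule levy_continuity)
    show "real_distribution (distr M borel (?X n))" for n
      using X by (rule G.real_distribution_distr)
    show "real_distribution (density lborel (normal_density 0 (sqrt \<sigma>2)))"
      using prob_space_normal_density[of "sqrt \<sigma>2" 0] \<sigma>2
      by (auto simp: real_distribution_def real_distribution_axioms_def)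
    fix t
    have "char (distr M borel (?X n)) t = (\<integral>\<omega>. iexp (t * ?X n \<omega>) \<partial>M)" for n
      unfolding char_def using X by (subst integral_distr) auto
    then have "(\<lambda>n. char (distr M borel (?X (Suc n))) t) \<longlonglongrightarrow> of_real (exp (- (t\<^sup>2 * \<sigma>2 / 2)))"
      using K.char_limit_shifted[of t] by (simp only:)
    then have "(\<lambda>n. char (distr M borel (?X n)) t) \<longlonglongrightarrow> of_real (exp (- (t\<^sup>2 * \<sigma>2 / 2)))"
      by (rule LIMSEQ_imp_Suc)
    then show "(\<lambda>n. char (distr M borel (?X n)) t) \<longlonglongrightarrow> char (density lborel (normal_density 0 (sqrt \<sigma>2))) t"
      using char_normal_density[of "sqrt \<sigma>2" t] \<sigma>2 by simp
  qed
qed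

theorem theorem1p1:
  fixes d :: nat and \<alpha> :: real
  assumes "d \<ge> 2" and "0 < \<alpha>" and "\<alpha> < 1"
  shows "\<exists>\<mu>\<^sub>0 v :: real. 0 < \<mu>\<^sub>0 \<and> \<mu>\<^sub>0 < 1 \<and> 0 < v \<and>
    (\<forall>(M :: (nat \<Rightarrow> nat list set) measure) A. growth_model d \<alpha> M A \<longrightarrow>
       height_LLN M A \<mu>\<^sub>0 \<and> height_CLT M A \<mu>\<^sub>0 v) \<and>
    (\<forall>(M :: 'w measure) A. growth_model d \<alpha> M A \<longrightarrow>
       height_LLN M A \<mu>\<^sub>0 \<and> height_CLT M A \<mu>\<^sub>0 v)"
proof -
  interpret boundary_profile d \<alpha> by unfold_locales (use assms in auto)
  show ?thesis
  proof (rule correctors)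
    fix \<mu> v w \<sigma>2 D
    assume par: "0 < \<mu>" "\<mu> \<le> 1" "0 \<le> D"
      "\<And>b. state b \<Longrightarrow> \<bar>v b\<bar> \<le> D * weight b"
      "\<And>m r r'. state m \<Longrightarrow> 0 \<notin># r \<Longrightarrow> 0 \<notin># r' \<Longrightarrow>
        \<bar>v (m + r) - v (m + r')\<bar> \<le> D * (weight r + weight r') * (weight m + weight r + weight r')"
      "\<And>b. state b \<Longrightarrow> weight b * (v b + \<mu>) = low_sum v b + tops b * (1 + v (rise b))"
      "\<And>b. state b \<Longrightarrow> \<bar>w b\<bar> \<le> D * weight b ^ 3"
      "\<And>b. state b \<Longrightarrow>
        weight b * (w b + \<sigma>2) = variance_rate v \<mu> b + low_sum w b + tops b * w (rise b)"
    have C: "corrected_profile d \<alpha> \<mu> \<sigma>2 D v w"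
      by (rule corrected_profile.intro[OF boundary_profile_axioms], rule corrected_profile_axioms.intro)
        (fact par)+
    \<comment> \<open>The constants are fixed before any model is considered, but \<mu> < 1 and 0 <
      \<sigma>2 are proved by taking expectations, so one model has to exist.\<close>
    obtain M :: "(nat \<Rightarrow> nat list set) measure" and A where M: "growth_model d \<alpha> M A"
      using growth_model_exists[of d \<alpha>] assms by auto
    show ?thesis
    proof (rule exI, rule exI, intro conjI allI impI)
      show "0 < \<mu>" by (rule par(1))
      show "\<mu> < 1" "0 < \<sigma>2" by (rule growth_height_limits[OF C M])+
    qed (rule growth_height_limits[OF C], assumption)+
  qed
qed

end
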